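(* Let $\Gamma$ be a distance-regular graph with vertex set $X$, diameter $D\ge 1$, distance-matrices $\{A_i\}_{i=0}^D$, primitive idempotents $\{E_i\}_{i=0}^D$ and intersection numbers $\{c_i\}_{i=1}^D$, $\{b_i\}_{i=0}^{D-1}$. Assume that $\Gamma$ is formally self-dual with respect to $\{E_i\}_{i=0}^D$, with eigenvalue sequence $\{\theta_i\}_{i=0}^D$. Assume that there exist nonzero $a,q\in\mathbb C$ such that, with $$\alpha=\frac{(aq^{2-D}-a^{-1}q^{D-2})(a+q^{D-1})}{q^{D-1}(q^{-1}-q)(aq-a^{-1}q^{-1})(a-q^{1-D})},\qquad \beta=\frac{q(a+a^{-1})(a+q^{-D-1})(aq^{2-D}-a^{-1}q^{D-2})}{(q-q^{-1})(a-q^{1-D})(aq-a^{-1}q^{-1})},$$ the following hold: $$\theta_i=\alpha(aq^{2i-D}+a^{-1}q^{D-2i})+\beta\quad(0\le i\le D),$$ $$q^{2i}\ne1\ (1\le i\le D),\qquad a^2q^{2i}\neq 1\ (1-D\le i\le D-1),\qquad a^3q^{2i-D-1}\ne 1\ (1\le i\le D),$$ $$b_0=\frac{\alpha(q^{-D}-q^D)(a^3-q^{D-1})}{a(a+q^{D-1})},\qquad c_D=\frac{\alpha(q^{-D}-q^D)(a-q^{D-1})}{q^{D-1}(a+q^{1-D})},$$ and for $1\le i\le D-1$ $$b_i=\frac{\alpha(q^{i-D}-q^{D-i})(aq^{i-D}-a^{-1}q^{D-i})(a^3-q^{D-2i-1})}{a(aq^{2i-D}-a^{-1}q^{D-2i})(a+q^{D-2i-1})},\qquad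 c_i=\frac{\alpha a(q^i-q^{-i})(aq^i-a^{-1}q^{-i})(a^{-1}-q^{D-2i+1})}{(aq^{2i-D}-a^{-1}q^{D-2i})(a+q^{D-2i+1})}.$$ Assume moreover that for all $x\in X$ and all irreducible $T(x)$-modules $U$, writing $r$ for the endpoint and $d$ for the diameter of $U$: (i) $U$ is thin; (ii) the endpoint and the dual endpoint of $U$ are equal; (iii) the intersection numbers $\{c_i(U)\}_{i=1}^d$, $\{b_i(U)\}_{i=0}^{d-1}$ of $U$ satisfy, for $1\le i\le d-1$, $$b_i(U)=\frac{\alpha(q^{i-d}-q^{d-i})(aq^{2r+i-D}-a^{-1}q^{D-2r-i})(a^3-q^{3D-2d-6r-2i-1})}{aq^{D-d-2r}(aq^{2r+2i-D}-a^{-1}q^{D-2r-2i})(a+q^{D-2r-2i-1})},$$ $$c_i(U)=\frac{\alpha a(q^i-q^{-i})(aq^{d+2r+i-D}-a^{-1}q^{D-d-2r-i})(a^{-1}-q^{2d-D+2r-2i+1})}{q^{d-D+2r}(aq^{2r+2i-D}-a^{-1}q^{D-2r-2i})(a+q^{D-2r-2i+1})},$$ and (when $d\ge1$) $$b_0(U)=\frac{\alpha(q^{-d}-q^d)(a^3-q^{3D-2d-6r-1})}{aq^{D-d-2r}(a+q^{D-2r-1})},\qquad c_d(U)=\frac{\alpha(q^{-d}-q^d)(a-q^{D-2r-1})}{q^{d-1}(a+q^{D-2d-2r+1})}.$$ Define $$\tau_i=(-1)^ia^{-i}q^{i(D-i)}\quad(0\le i\le D),$$ let $f\in\mathbb C$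 satisfy $$f^2=\frac{|X|^{3/2}(aq^{1-D};q^2)_D}{(a^{-2};q^2)_D},$$ and define $W=f\sum_{i=0}^D\tau_iE_i$. Then $W$ is a spin model afforded by $\Gamma$.
   Context: Notation: $(\xi;q)_n=(1-\xi)(1-\xi q)\cdots(1-\xi q^{n-1})$, so $(\xi;q^2)_n=\prod_{j=0}^{n-1}(1-\xi q^{2j})$. For real $t>0$, $t^{1/2}$ is the positive square root. Distance-regular graphs. $X$ is a finite nonempty set; $\mathrm{Mat}_X(\mathbb C)$ is the algebra of complex matrices with rows and columns indexed by $X$; $I$ is the identity and $J$ the all-ones matrix; $V=\mathbb C^X$ is the space of column vectors indexed by $X$, on which $\mathrm{Mat}_X(\mathbb C)$ acts by left multiplication. $\Gamma$ is an undirected connected graph without loops or multiple edges, vertex set $X$, path-length distance $\partial$, diameter $D=\max\partial$. It is distance-regular if for all $0\le h,i,j\le D$ and all $x,y$ with $\partial(x,y)=h$ the number $p^h_{ij}=|\{z:\partial(x,z)=i,\ \partial(y,z)=j\}|$ depends only on $h,i,j$. Put $c_i=p^i_{1,i-1}$ $(1\le i\le D)$, $b_i=p^i_{1,i+1}$ $(0\le i\le D-1)$. The distance-matrix $A_i$ has $(x,y)$-entry $1$ if $\partial(x,y)=i$ and $0$ otherwise. The Bose-Mesner algebra $M=\mathrm{Span}\{A_i\}_{i=0}^D$ is a commutative subalgebra and has a basis $\{E_i\}_{i=0}^D$ with $E_0=|X|^{-1}J$, $E_iE_j=\delta_{ij}E_i$, $\sum_iE_i=I$ (the primitive idempotents;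 the ordering of $E_1,\dots,E_D$ is part of the data). Define matrices $P,Q$ by $A_j=\sum_iP_{ij}E_i$, $E_j=|X|^{-1}\sum_iQ_{ij}A_i$. The eigenvalue sequence is $\theta_i=P_{i1}$. $\Gamma$ is formally self-dual with respect to $\{E_i\}_{i=0}^D$ if $P=Q$. For $x\in X$: $E_i^*(x)$ is the diagonal matrix with $(y,y)$-entry $1$ if $\partial(x,y)=i$ and $0$ otherwise; $A_i^*(x)$ is the diagonal matrix with $(y,y)$-entry $|X|E_i(x,y)$; $T(x)$ (the Terwilliger algebra) is the subalgebra of $\mathrm{Mat}_X(\mathbb C)$ generated by $M$ and all $E_i^*(x)$. A $T(x)$-module is a subspace of $V$ invariant under $T(x)$; it is irreducible if it is nonzero and has no submodules except $0$ and itself. For an irreducible $T(x)$-module $U$: the endpoint is $\min\{i:E_i^*(x)U\ne0\}$; the dual endpoint is $\min\{i:E_iU\neq0\}$; the diameter is $d=|\{i:E_i^*(x)U\ne0\}|-1$; $U$ is thin if $\dim E_i^*(x)U\le1$ for all $i$. Intersection numbers of $U$. If $U$ is thin irreducible with endpoint $r$, dual endpoint $s$ and diameter $d$ (with $\Gamma$ formally self-dual), then for $0\ne u\in E_sU$ the vectors $\{E^*_{r+i}(x)u\}_{i=0}^d$ form a basis of $U$ and the scalars $c_i(U),a_i(U),b_i(U)$ are defined by $A_1E^*_{r+i}(x)u=c_{i+1}(U)E^*_{r+i+1}(x)u+a_i(U)E^*_{r+i}(x)u+b_{i-1}(U)E^*_{r+i-1}(x)u$ $(0\le i\le d)$, with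 out-of-range terms zero. Spin models. $W\in\mathrm{Mat}_X(\mathbb C)$ is type II if it is symmetric with all entries nonzero and $\sum_{y\in X}W(a,y)/W(b,y)=|X|\delta_{a,b}$ for all $a,b\in X$. It is a spin model if it is type II and $\sum_{y\in X}\frac{W(a,y)W(b,y)}{W(c,y)}=|X|^{1/2}\frac{W(a,b)}{W(a,c)W(b,c)}$ for all $a,b,c\in X$. For $W$ type II, let $\mathbf u_{b,c}\in V$ have $y$-entry $W(b,y)/W(c,y)$, and let $N(W)$ be the set of symmetric $B\in\mathrm{Mat}_X(\mathbb C)$ with $B\mathbf u_{b,c}\in\mathbb C\mathbf u_{b,c}$ for all $b,c\in X$. $\Gamma$ affords the spin model $W$ if $W\in M\subseteq N(W)$. *)

theory Defs
  imports "HOL-Analysis.Analysis"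
begin

section \<open>Complex matrices indexed by a finite type\<close>

definition cmat_scale :: "complex \<Rightarrow> complex^'x^'x \<Rightarrow> complex^'x^'x" (infixr "*\<^sub>M" 75)
  where "c *\<^sub>M A = (\<chi> i j. c * A $ i $ j)"

text \<open>The generic \<open>span\<close> and \<open>subspace\<close> of HOL-Analysis are real-linear.
  Complex-linear notions are written \<open>cmat.span\<close>, \<open>cmat.subspace\<close>, \dots for matrices, and
  (as in the library) \<open>vec.subspace\<close>, \<open>vec.dim\<close> for vectors.\<close>

interpretation cmat: vector_space "cmat_scale :: complex \<Rightarrow> complex^'x^'x \<Rightarrow> complex^'x^'x"
  by unfold_locales (simp_all add: cmat_scale_def vec_eq_iff algebra_simps)

definition qpochhammer :: "complex \<Rightarrow> complex \<Rightarrow> nat \<Rightarrow> complex"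
  where "qpochhammer \<xi> p n = (\<Prod>j<n. 1 - \<xi> * p ^ j)"


section \<open>Distance-regular graphs\<close>

text \<open>A graph on the vertex set \<open>UNIV :: 'x set\<close> is given by its adjacency relation \<open>R\<close>.\<close>

definition connected_simple_graph :: "('x::finite \<times> 'x) set \<Rightarrow> bool"
  where "connected_simple_graph R \<longleftrightarrow> sym R \<and> irrefl R \<and> (\<forall>x y. (x, y) \<in> R\<^sup>*)"

definition graph_dist :: "('x::finite \<times> 'x) set \<Rightarrow> 'x \<Rightarrow> 'x \<Rightarrow> nat"
  where "graph_dist R x y = (LEAST n. (x, y) \<in> R ^^ n)"

definition graph_diameter :: "('x::finite \<times> 'x) set \<Rightarrow> nat"
  where "graph_diameter R = Max {graph_dist R x y | x y. True}"

definition distance_regular :: "('x::finite \<times> 'x) set \<Rightarrow> bool"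
  where "distance_regular R \<longleftrightarrow> connected_simple_graph R \<and>
    (\<forall>h\<le>graph_diameter R. \<forall>i\<le>graph_diameter R. \<forall>j\<le>graph_diameter R. \<exists>n.
       \<forall>x y. graph_dist R x y = h \<longrightarrow>
         card {z. graph_dist R x z = i \<and> graph_dist R y z = j} = n)"

definition intersection_number :: "('x::finite \<times> 'x) set \<Rightarrow> nat \<Rightarrow> nat \<Rightarrow> nat \<Rightarrow> nat"
  where "intersection_number R h i j = (THE n.
       \<forall>x y. graph_dist R x y = h \<longrightarrow>
         card {z. graph_dist R x z = i \<and> graph_dist R y z = j} = n)"

definition graph_c :: "('x::finite \<times> 'x) set \<Rightarrow> nat \<Rightarrow> nat"
  where "graph_c R i = intersection_number R i 1 (i - 1)"

definition graph_b :: "('x::finite \<times> 'x) set \<Rightarrow> nat \<Rightarrow> nat"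
  where "graph_b R i = intersection_number R i 1 (i + 1)"


section \<open>Bose-Mesner algebra, primitive idempotents, formal self-duality\<close>

definition dist_matrix :: "('x::finite \<times> 'x) set \<Rightarrow> nat \<Rightarrow> complex^'x^'x"
  where "dist_matrix R i = (\<chi> x y. if graph_dist R x y = i then 1 else 0)"

definition bose_mesner :: "('x::finite \<times> 'x) set \<Rightarrow> (complex^'x^'x) set"
  where "bose_mesner R = cmat.span (dist_matrix R ` {..graph_diameter R})"

text \<open>The family \<open>E\<close> is only meaningful at the indices \<open>0, \<dots>, D\<close>.\<close>

definition primitive_idempotents ::
    "('x::finite \<times> 'x) set \<Rightarrow> (nat \<Rightarrow> complex^'x^'x) \<Rightarrow> bool"
  where "primitive_idempotents R E \<longleftrightarrow> (let D = graph_diameter R in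
    inj_on E {..D} \<and> cmat.independent (E ` {..D}) \<and> cmat.span (E ` {..D}) = bose_mesner R \<and>
    E 0 = (1 / of_nat CARD('x)) *\<^sub>M (\<chi> x y. 1) \<and>
    (\<forall>i\<le>D. \<forall>j\<le>D. E i ** E j = (if i = j then E i else 0)) \<and>
    (\<Sum>i\<le>D. E i) = mat 1)"

text \<open>The matrices \<open>P\<close> and \<open>Q\<close> are read off as coordinates; the two lemmas below give the
  usual defining expansions.\<close>

definition eigenmatrix_P ::
    "('x::finite \<times> 'x) set \<Rightarrow> (nat \<Rightarrow> complex^'x^'x) \<Rightarrow> nat \<Rightarrow> nat \<Rightarrow> complex"
  where "eigenmatrix_P R E i j =
    cmat.representation (E ` {..graph_diameter R}) (dist_matrix R j) (E i)"

definition eigenmatrix_Q ::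
    "('x::finite \<times> 'x) set \<Rightarrow> (nat \<Rightarrow> complex^'x^'x) \<Rightarrow> nat \<Rightarrow> nat \<Rightarrow> complex"
  where "eigenmatrix_Q R E i j = of_nat CARD('x) *
    cmat.representation (dist_matrix R ` {..graph_diameter R}) (E j) (dist_matrix R i)"

definition formally_self_dual ::
    "('x::finite \<times> 'x) set \<Rightarrow> (nat \<Rightarrow> complex^'x^'x) \<Rightarrow> bool"
  where "formally_self_dual R E \<longleftrightarrow>
    (\<forall>i\<le>graph_diameter R. \<forall>j\<le>graph_diameter R. eigenmatrix_P R E i j = eigenmatrix_Q R E i j)"

lemma sum_eigenmatrix_P:
  assumes "primitive_idempotents R E" "j \<le> graph_diameter R"
  shows "dist_matrix R j = (\<Sum>i\<le>graph_diameter R. eigenmatrix_P R E i j *\<^sub>M E i)"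
proof -
  let ?D = "graph_diameter R"
  have inj: "inj_on E {..?D}" and ind: "cmat.independent (E ` {..?D})"
    and sp: "cmat.span (E ` {..?D}) = bose_mesner R"
    using assms(1) by (auto simp: primitive_idempotents_def Let_def)
  have "dist_matrix R j \<in> cmat.span (E ` {..?D})"
    unfolding sp bose_mesner_def using assms(2) by (intro cmat.span_base) auto
  then have "(\<Sum>B\<in>E ` {..?D}. cmat.representation (E ` {..?D}) (dist_matrix R j) B *\<^sub>M B)
      = dist_matrix R j"
    by (intro cmat.sum_representation_eq[OF ind]) auto
  then show ?thesis
    by (simp add: sum.reindex[OF inj] eigenmatrix_P_def)
qed

lemma ex_graph_dist_eq:
  assumes "connected_simple_graph R" "i \<le> graph_diameter R"
  shows "\<exists>x y. graph_dist R x y = i"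
proof -
  have conn: "\<exists>n. (x, y) \<in> R ^^ n" for x y
    using assms(1) by (simp add: connected_simple_graph_def rtrancl_power)
  have fin: "finite {graph_dist R x y | x y. True}"
  proof -
    have "{graph_dist R x y | x y. True} = (\<lambda>(x, y). graph_dist R x y) ` UNIV"
      by auto
    then show ?thesis by simp
  qed
  have "graph_diameter R \<in> {graph_dist R x y | x y. True}"
    unfolding graph_diameter_def using fin by (intro Max_in) auto
  then obtain x y where xy: "graph_dist R x y = graph_diameter R"
    by auto
  have "(x, y) \<in> R ^^ graph_dist R x y"
    unfolding graph_dist_def using conn by (rule LeastI_ex)
  then have "(x, y) \<in> R ^^ (i + (graph_dist R x y - i))"
    using assms(2) xy by simp
  then obtain z where z: "(x, z) \<in> R ^^ i" "(z, y) \<in> R ^^ (graph_dist R x y - i)"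
    unfolding relpow_add by auto
  have "graph_dist R x z \<le> i"
    unfolding graph_dist_def using z(1) by (rule Least_le)
  moreover have "\<not> graph_dist R x z < i"
  proof
    assume less: "graph_dist R x z < i"
    have "(x, z) \<in> R ^^ graph_dist R x z"
      unfolding graph_dist_def using conn by (rule LeastI_ex)
    with z(2) have "(x, y) \<in> R ^^ (graph_dist R x z + (graph_dist R x y - i))"
      unfolding relpow_add by auto
    then have "graph_dist R x y \<le> graph_dist R x z + (graph_dist R x y - i)"
      unfolding graph_dist_def[of R x y] by (rule Least_le)
    with less xy assms(2) show False by linarith
  qed
  ultimately have "graph_dist R x z = i" by simp
  then show ?thesis by blast
qed

lemma inj_on_dist_matrix:
  assumes "connected_simple_graph R"
  shows "inj_on (dist_matrix R) {..graph_diameter R}"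
proof (rule inj_onI)
  fix i j assume ij: "i \<in> {..graph_diameter R}" "dist_matrix R i = dist_matrix R j"
  from ij(1) obtain x y where "graph_dist R x y = i"
    using ex_graph_dist_eq[OF assms] by blast
  moreover have "dist_matrix R i $ x $ y = dist_matrix R j $ x $ y"
    using ij(2) by simp
  ultimately show "i = j"
    by (simp add: dist_matrix_def split: if_splits)
qed

lemma independent_dist_matrix:
  assumes "connected_simple_graph R"
  shows "cmat.independent (dist_matrix R ` {..graph_diameter R})"
proof (rule cmat.independent_if_scalars_zero)
  fix f B
  assume sum0: "(\<Sum>A\<in>dist_matrix R ` {..graph_diameter R}. f A *\<^sub>M A) = 0"
    and "B \<in> dist_matrix R ` {..graph_diameter R}"
  then obtain i where i: "i \<le> graph_diameter R" "B = dist_matrix R i" by auto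
  obtain x y where xy: "graph_dist R x y = i"
    using ex_graph_dist_eq[OF assms i(1)] by blast
  have "0 = (\<Sum>j\<le>graph_diameter R. f (dist_matrix R j) *\<^sub>M dist_matrix R j) $ x $ y"
    using sum0 by (simp add: sum.reindex[OF inj_on_dist_matrix[OF assms]])
  also have "\<dots> = (\<Sum>j\<le>graph_diameter R. if j = i then f (dist_matrix R j) else 0)"
    unfolding sum_component
    by (intro sum.cong refl) (auto simp: cmat_scale_def dist_matrix_def xy)
  also have "\<dots> = f B"
    using i by simp
  finally show "f B = 0" by simp
qed auto

lemma sum_eigenmatrix_Q:
  fixes R :: "('x::finite \<times> 'x) set"
  assumes "connected_simple_graph R" "primitive_idempotents R E" "j \<le> graph_diameter R"
  shows "E j = (1 / of_nat CARD('x)) *\<^sub>M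
    (\<Sum>i\<le>graph_diameter R. eigenmatrix_Q R E i j *\<^sub>M dist_matrix R i)"
proof -
  let ?D = "graph_diameter R"
  let ?S = "dist_matrix R ` {..?D}"
  have "cmat.span (E ` {..?D}) = cmat.span ?S"
    using assms(2) by (auto simp: primitive_idempotents_def bose_mesner_def Let_def)
  then have "E j \<in> cmat.span ?S"
    using assms(3) cmat.span_base[of "E j" "E ` {..?D}"] by auto
  then have "(\<Sum>B\<in>?S. cmat.representation ?S (E j) B *\<^sub>M B) = E j"
    by (intro cmat.sum_representation_eq[OF independent_dist_matrix[OF assms(1)]]) auto
  then have "E j = (\<Sum>i\<le>?D. cmat.representation ?S (E j) (dist_matrix R i) *\<^sub>M dist_matrix R i)"
    by (simp add: sum.reindex[OF inj_on_dist_matrix[OF assms(1)]])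
  then show ?thesis
    by (simp add: eigenmatrix_Q_def cmat.scale_sum_right)
qed


section \<open>Terwilliger algebra and its modules\<close>

definition dual_idempotent :: "('x::finite \<times> 'x) set \<Rightarrow> 'x \<Rightarrow> nat \<Rightarrow> complex^'x^'x"
  where "dual_idempotent R x i = (\<chi> y z. if y = z \<and> graph_dist R x y = i then 1 else 0)"

definition cmat_subalgebra :: "(complex^'x^'x) set \<Rightarrow> bool"
  where "cmat_subalgebra S \<longleftrightarrow>
    cmat.subspace S \<and> mat 1 \<in> S \<and> (\<forall>A\<in>S. \<forall>B\<in>S. A ** B \<in> S)"

definition terwilliger_algebra :: "('x::finite \<times> 'x) set \<Rightarrow> 'x \<Rightarrow> (complex^'x^'x) set"
  where "terwilliger_algebra R x =
    cmat_subalgebra hull (bose_mesner R \<union> dual_idempotent R x ` {..graph_diameter R})"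

definition T_module :: "('x::finite \<times> 'x) set \<Rightarrow> 'x \<Rightarrow> (complex^'x) set \<Rightarrow> bool"
  where "T_module R x U \<longleftrightarrow>
    vec.subspace U \<and> (\<forall>B\<in>terwilliger_algebra R x. \<forall>u\<in>U. B *v u \<in> U)"

definition irreducible_T_module :: "('x::finite \<times> 'x) set \<Rightarrow> 'x \<Rightarrow> (complex^'x) set \<Rightarrow> bool"
  where "irreducible_T_module R x U \<longleftrightarrow> T_module R x U \<and> U \<noteq> {0} \<and>
    (\<forall>U'. T_module R x U' \<and> U' \<subseteq> U \<longrightarrow> U' = {0} \<or> U' = U)"

definition module_support :: "('x::finite \<times> 'x) set \<Rightarrow> 'x \<Rightarrow> (complex^'x) set \<Rightarrow> nat set"
  where "module_support R x U =
    {i. i \<le> graph_diameter R \<and> (*v) (dual_idempotent R x i) ` U \<noteq> {0}}"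

definition endpoint :: "('x::finite \<times> 'x) set \<Rightarrow> 'x \<Rightarrow> (complex^'x) set \<Rightarrow> nat"
  where "endpoint R x U = Min (module_support R x U)"

definition dual_endpoint ::
    "('x::finite \<times> 'x) set \<Rightarrow> (nat \<Rightarrow> complex^'x^'x) \<Rightarrow> (complex^'x) set \<Rightarrow> nat"
  where "dual_endpoint R E U = Min {i. i \<le> graph_diameter R \<and> (*v) (E i) ` U \<noteq> {0}}"

definition module_diameter :: "('x::finite \<times> 'x) set \<Rightarrow> 'x \<Rightarrow> (complex^'x) set \<Rightarrow> nat"
  where "module_diameter R x U = card (module_support R x U) - 1"

definition thin_module :: "('x::finite \<times> 'x) set \<Rightarrow> 'x \<Rightarrow> (complex^'x) set \<Rightarrow> bool"
  where "thin_module R x U \<longleftrightarrow>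
    (\<forall>i\<le>graph_diameter R. vec.dim ((*v) (dual_idempotent R x i) ` U) \<le> 1)"

text \<open>The three-term relation defining the intersection numbers of a thin irreducible module.
  It determines \<open>c i\<close> for \<open>1 \<le> i \<le> d\<close>, \<open>a i\<close> for \<open>0 \<le> i \<le> d\<close> and \<open>b i\<close> for \<open>0 \<le> i \<le> d - 1\<close>;
  all other values are unconstrained.\<close>

definition module_three_term ::
    "('x::finite \<times> 'x) set \<Rightarrow> (nat \<Rightarrow> complex^'x^'x) \<Rightarrow> 'x \<Rightarrow> (complex^'x) set \<Rightarrow>
     (nat \<Rightarrow> complex) \<Rightarrow> (nat \<Rightarrow> complex) \<Rightarrow> (nat \<Rightarrow> complex) \<Rightarrow> bool"
  where "module_three_term R E x U c a b \<longleftrightarrow>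
    (let r = endpoint R x U; s = dual_endpoint R E U; d = module_diameter R x U in
     \<forall>u \<in> (*v) (E s) ` U. u \<noteq> 0 \<longrightarrow> (\<forall>i\<le>d.
       dist_matrix R 1 *v (dual_idempotent R x (r + i) *v u) =
         (if i < d then c (i + 1) *s (dual_idempotent R x (r + i + 1) *v u) else 0)
         + a i *s (dual_idempotent R x (r + i) *v u)
         + (if 0 < i then b (i - 1) *s (dual_idempotent R x (r + i - 1) *v u) else 0)))"

definition module_c ::
    "('x::finite \<times> 'x) set \<Rightarrow> (nat \<Rightarrow> complex^'x^'x) \<Rightarrow> 'x \<Rightarrow> (complex^'x) set \<Rightarrow> nat \<Rightarrow> complex"
  where "module_c R E x U = (SOME c. \<exists>a b. module_three_term R E x U c a b)"

definition module_b ::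
    "('x::finite \<times> 'x) set \<Rightarrow> (nat \<Rightarrow> complex^'x^'x) \<Rightarrow> 'x \<Rightarrow> (complex^'x) set \<Rightarrow> nat \<Rightarrow> complex"
  where "module_b R E x U = (SOME b. \<exists>c a. module_three_term R E x U c a b)"


section \<open>Spin models\<close>

definition type_II :: "complex^'x^('x::finite) \<Rightarrow> bool"
  where "type_II W \<longleftrightarrow> transpose W = W \<and> (\<forall>a b. W $ a $ b \<noteq> 0) \<and>
    (\<forall>a b. (\<Sum>y\<in>UNIV. W $ a $ y / W $ b $ y) = (if a = b then of_nat CARD('x) else 0))"

definition spin_model :: "complex^'x^('x::finite) \<Rightarrow> bool"
  where "spin_model W \<longleftrightarrow> type_II W \<and>
    (\<forall>a b c. (\<Sum>y\<in>UNIV. W $ a $ y * W $ b $ y / W $ c $ y) =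
       complex_of_real (sqrt (real CARD('x))) * (W $ a $ b / (W $ a $ c * W $ b $ c)))"

definition spin_vector :: "complex^'x^('x::finite) \<Rightarrow> 'x \<Rightarrow> 'x \<Rightarrow> complex^'x"
  where "spin_vector W b c = (\<chi> y. W $ b $ y / W $ c $ y)"

definition nomura_algebra :: "complex^'x^('x::finite) \<Rightarrow> (complex^'x^'x) set"
  where "nomura_algebra W = {B. transpose B = B \<and>
    (\<forall>b c. \<exists>k. B *v spin_vector W b c = k *s spin_vector W b c)}"

definition affords :: "('x::finite \<times> 'x) set \<Rightarrow> complex^'x^'x \<Rightarrow> bool"
  where "affords R W \<longleftrightarrow> W \<in> bose_mesner R \<and> bose_mesner R \<subseteq> nomura_algebra W"

end

theory Submission
  imports Defs
begin

text \<open>Fix a vertex \<open>x\<close>. Write \<open>A = \<Sum>\<^sub>i \<theta>\<^sub>i E\<^sub>i\<close> for the adjacency matrix, \<open>S = \<Sum>\<^sub>i \<theta>\<^sub>i E\<^sup>*\<^sub>i(x)\<close> for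
  its dual (usually written \<open>A\<^sup>*\<close>), \<open>T = \<Sum>\<^sub>i \<tau>\<^sub>i E\<^sub>i\<close> and \<open>T\<^sup>* = \<Sum>\<^sub>i \<tau>\<^sub>i E\<^sup>*\<^sub>i(x)\<close>, so that \<open>W = f T\<close>. By
  formal self-duality \<open>S\<close> is the diagonal matrix with entries \<open>|X| E\<^sub>1(x,y)\<close>. Everything follows
  from the single relation

    \<open>A T\<^sup>* T = T\<^sup>* T S\<close>.

  Since the \<open>\<theta>\<^sub>i\<close> are distinct, it carries over from \<open>A\<close> and \<open>S\<close> to equal functions of them, in
  particular to \<open>T T\<^sup>* T = T\<^sup>* T T\<^sup>*\<close>. Applied to the unit vector at \<open>x\<close>, which \<open>S\<close> multiplies by
  \<open>\<theta>\<^sub>0\<close>, the relation says that \<open>T\<^sup>* T\<close> sends it to a multiple \<open>\<kappa>\<close> of the all-ones vector. Hence the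
  entries of \<open>T\<close> are \<open>\<kappa> / \<tau>\<^sub>h\<close> at distance \<open>h\<close>, and \<open>T T\<^sup>* T = T\<^sup>* T T\<^sup>*\<close>, read entrywise, is the spin
  equation for \<open>W\<close> up to the factor \<open>f\<^sup>2 \<kappa>\<close>. The transposed relation, applied to the all-ones
  vector, is the type II equation. The vector \<open>u\<^sub>b\<^sub>,\<^sub>c\<close> is a multiple of \<open>T\<^sup>*(c) T\<close> applied to the unit
  vector at \<open>b\<close>, hence an eigenvector of \<open>A\<close> and of the whole Bose-Mesner algebra, so that
  \<open>M \<subseteq> N(W)\<close>.

  The relation is verified on each irreducible \<open>T(x)\<close>-module \<open>U\<close>, which is enough by complete
  reducibility. Thinness and the equality \<open>r\<close> of endpoint and dual endpoint provide a vector \<open>u\<close>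
  in \<open>E\<^sub>rU\<close> whose components \<open>E\<^sup>*\<^sub>r\<^sub>+\<^sub>iu\<close> are a basis of \<open>U\<close> on which \<open>S\<close> is diagonal and \<open>A\<close> is
  tridiagonal, with the intersection numbers of \<open>U\<close> as coefficients (lemma \<open>module_action\<close>). After
  an affine normalization \<open>X\<close>, \<open>Y\<close> of \<open>A\<close>, \<open>S\<close> with eigenvalues \<open>t\<^sub>i + 1/t\<^sub>i\<close>, \<open>t\<^sub>i = a q\<^sup>2\<^sup>i\<^sup>-\<^sup>D\<close>, and with
  \<open>Z = (T\<^sup>*)\<^sup>-\<^sup>1 X T\<^sup>*\<close>, the given coefficients amount to two of the Askey-Wilson relations

    \<open>q Y X - q\<^sup>-\<^sup>1 X Y + k Z = g\<close>  and  \<open>q X Z - q\<^sup>-\<^sup>1 Z X + k Y = g\<close>,  with \<open>k = q\<^sup>2 - q\<^sup>-\<^sup>2\<close>.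

  The goal \<open>X T\<^sup>* T = T\<^sup>* T Y\<close> is \<open>\<tau>\<^sub>i E\<^sub>i Y E\<^sub>j = \<tau>\<^sub>j E\<^sub>i Z E\<^sub>j\<close> for all \<open>i\<close>, \<open>j\<close>. The first relation, cut out by \<open>E\<^sub>i\<close>
  and \<open>E\<^sub>j\<close>, gives this for \<open>|i - j| = 1\<close>; for \<open>|i - j| > 1\<close> both blocks vanish because
  \<open>E\<^sub>i S E\<^sub>j = 0\<close> (lemma \<open>tri_E\<close>); and for \<open>i = j\<close> the two relations together
  give it unless \<open>t\<^sub>i\<close> is \<open>q\<close> or \<open>q\<^sup>-\<^sup>1\<close>. These exceptions occur only for \<open>i = 0\<close>, where the block
  vanishes on \<open>U\<close> or is computed directly, and for \<open>i = D\<close>, which is avoided by testing the goal on the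
  vectors \<open>(Y - \<theta>\<^sub>r) \<cdots> (Y - \<theta>\<^sub>r\<^sub>+\<^sub>m\<^sub>-\<^sub>1) u\<close>: these have no component in \<open>E\<^sub>D\<close> before the last one,
  and the last one is an eigenvector (theorem \<open>intertwining\<close>).

  It remains to find \<open>\<kappa>\<close>, because the spin equation needs \<open>f\<^sup>2 \<kappa> = |X|\<^sup>1\<^sup>/\<^sup>2\<close>. Writing \<open>T\<^sup>-\<^sup>1\<close> as the
  Newton interpolation polynomial of degree \<open>D\<close> in \<open>A\<close>, an entry of \<open>T\<^sup>-\<^sup>1\<close> at distance \<open>D\<close> sees only the
  leading coefficient, multiplied by \<open>c\<^sub>1 \<cdots> c\<^sub>D\<close>. Comparison with the type II equation expresses \<open>\<kappa>\<close> by
  products that rearrange into the two \<open>q\<close>-Pochhammer symbols of the normalization (lemmas \<open>tau_last\<close>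
  and \<open>kappa_value\<close>).\<close>

section \<open>Matrices acting on column vectors\<close>

lemma cmat_scale_vec: "(c *\<^sub>M A) *v v = c *s (A *v v)"
  by (simp add: vec_eq_iff cmat_scale_def matrix_vector_mult_def sum_distrib_left mult.assoc)

lemma sum_matrix_vec: "(\<Sum>i\<in>I. A i) *v v = (\<Sum>i\<in>I. A i *v (v::complex^'x))"
  by (induction I rule: infinite_finite_induct) (simp_all add: matrix_vector_mult_add_rdistrib)

lemma matrix_vec_sum: "A *v (\<Sum>i\<in>I. g i) = (\<Sum>i\<in>I. A *v (g i::complex^'x))"
  by (induction I rule: infinite_finite_induct) (simp_all add: matrix_vector_right_distrib)

lemma matrix_vec_scale: "A *v (c *s v) = c *s (A *v (v::complex^'x))"
  by (rule vector_scalar_commute)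

lemma matrix_eq_vecI: "(\<And>v. A *v v = B *v v) \<Longrightarrow> A = (B::complex^'x^'y)"
  by (simp add: matrix_eq)

section \<open>Resolutions of the identity\<close>

definition idempotent_resolution :: "nat \<Rightarrow> (nat \<Rightarrow> complex^'x^'x::finite) \<Rightarrow> bool"
  where "idempotent_resolution D E \<longleftrightarrow>
    (\<forall>i\<le>D. \<forall>j\<le>D. E i ** E j = (if i = j then E i else 0)) \<and> (\<Sum>i\<le>D. E i) = mat 1"

definition spectral_sum ::
    "nat \<Rightarrow> (nat \<Rightarrow> complex^'x^'x::finite) \<Rightarrow> (nat \<Rightarrow> complex) \<Rightarrow> complex^'x^'x"
  where "spectral_sum D E \<phi> = (\<Sum>i\<le>D. \<phi> i *\<^sub>M E i)"

lemma resolution_sum: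
  assumes "idempotent_resolution D E"
  shows "(\<Sum>i\<le>D. E i *v v) = v"
  using assms by (simp add: idempotent_resolution_def flip: sum_matrix_vec)

lemma resolution_idem:
  assumes "idempotent_resolution D E" "i \<le> D" "j \<le> D"
  shows "E i *v (E j *v v) = (if i = j then E i *v v else 0)"
  using assms by (auto simp: idempotent_resolution_def matrix_vector_mul_assoc)

lemma resolution_ext:
  assumes "idempotent_resolution D E" "\<And>i. i \<le> D \<Longrightarrow> E i *v v = E i *v w"
  shows "v = w"
proof -
  have "v = (\<Sum>i\<le>D. E i *v v)" by (simp add: resolution_sum[OF assms(1)])
  also have "\<dots> = (\<Sum>i\<le>D. E i *v w)" using assms(2) by (intro sum.cong) auto
  also have "\<dots> = w" by (rule resolution_sum[OF assms(1)])
  finally show ?thesis .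
qed

lemma spectral_sum_vec: "spectral_sum D E \<phi> *v v = (\<Sum>i\<le>D. \<phi> i *s (E i *v v))"
  by (simp add: spectral_sum_def sum_matrix_vec cmat_scale_vec)

lemma spectral_sum_cong:
  "(\<And>i. i \<le> D \<Longrightarrow> \<phi> i = \<psi> i) \<Longrightarrow> spectral_sum D E \<phi> = spectral_sum D E \<psi>"
  by (simp add: spectral_sum_def)

lemma resolution_spectral:
  assumes "idempotent_resolution D E" "i \<le> D"
  shows "E i *v (spectral_sum D E \<phi> *v v) = \<phi> i *s (E i *v v)"
proof -
  have "E i *v (spectral_sum D E \<phi> *v v) = (\<Sum>j\<le>D. \<phi> j *s (E i *v (E j *v v)))"
    by (simp add: spectral_sum_vec matrix_vec_sum matrix_vec_scale)
  also have "\<dots> = (\<Sum>j\<le>D. if j = i then \<phi> i *s (E i *v v) else 0)"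
    using assms by (intro sum.cong refl) (auto simp: resolution_idem)
  finally show ?thesis using assms by simp
qed

lemma spectral_resolution:
  assumes "idempotent_resolution D E" "i \<le> D"
  shows "spectral_sum D E \<phi> *v (E i *v v) = \<phi> i *s (E i *v v)"
proof -
  have "spectral_sum D E \<phi> *v (E i *v v) = (\<Sum>j\<le>D. if j = i then \<phi> i *s (E i *v v) else 0)"
    unfolding spectral_sum_vec
    using assms by (intro sum.cong refl) (auto simp: resolution_idem)
  then show ?thesis using assms by simp
qed

lemma spectral_spectral:
  assumes "idempotent_resolution D E"
  shows "spectral_sum D E \<phi> *v (spectral_sum D E \<psi> *v v) = spectral_sum D E (\<lambda>i. \<phi> i * \<psi> i) *v v"
  by (rule resolution_ext[OF assms]) (simp add: resolution_spectral[OF assms(1)])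

lemma spectral_one:
  assumes "idempotent_resolution D E" "\<And>i. i \<le> D \<Longrightarrow> \<phi> i = 1"
  shows "spectral_sum D E \<phi> *v v = v"
  by (rule resolution_ext[OF assms(1)]) (simp add: resolution_spectral[OF assms(1)] assms(2))

lemma spectral_inverse:
  assumes "idempotent_resolution D E" "\<And>i. i \<le> D \<Longrightarrow> \<phi> i * \<psi> i = 1"
  shows "spectral_sum D E \<phi> *v (spectral_sum D E \<psi> *v v) = v"
  unfolding spectral_spectral[OF assms(1)] by (rule spectral_one) (use assms in auto)

lemma spectral_eigenvector:
  assumes E: "idempotent_resolution D E" and inj: "inj_on \<theta> {..D}"
    and v: "spectral_sum D E \<theta> *v v = l *s v" "v \<noteq> 0"
  obtains i where "i \<le> D" "l = \<theta> i" "E i *v v = v"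
proof -
  have *: "(\<theta> i - l) *s (E i *v v) = 0" if "i \<le> D" for i
    using resolution_spectral[OF E that, of \<theta> v] v(1)
    by (auto simp: matrix_vec_scale)
  obtain i where i: "i \<le> D" "E i *v v \<noteq> 0"
    using v(2) resolution_ext[OF E, of v 0] by auto
  with * have l: "l = \<theta> i" by auto
  have "E j *v v = 0" if "j \<le> D" "j \<noteq> i" for j
    using *[OF that(1)] inj_onD[OF inj, of j i] that i(1) l by auto
  then have "(\<Sum>j\<le>D. E j *v v) = (\<Sum>j\<le>D. if j = i then E i *v v else 0)"
    by (intro sum.cong refl) auto
  then have "E i *v v = v" using i(1) by (simp add: resolution_sum[OF E])
  with i l show ?thesis using that by blast
qed

text \<open>The idempotents are polynomials in the matrix: multiplying a vector by all factors
  \<open>A - \<theta>\<^sub>l\<close> with \<open>l \<noteq> i\<close> leaves a nonzero multiple of its \<open>i\<close>-th component.\<close>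

lemma resolution_invariant:
  assumes E: "idempotent_resolution D E" and inj: "inj_on \<theta> {..D}"
    and U: "vec.subspace U" and inv: "\<And>v. v \<in> U \<Longrightarrow> spectral_sum D E \<theta> *v v \<in> U"
    and i: "i \<le> D" and v: "v \<in> U"
  shows "E i *v v \<in> U"
proof -
  have prod_in: "spectral_sum D E (\<lambda>j. \<Prod>l\<in>L. \<theta> j - \<theta> l) *v v \<in> U" if "finite L" for L
    using that
  proof (induction L)
    case empty
    then show ?case using v spectral_one[OF E] by simp
  next
    case (insert l L)
    let ?w = "spectral_sum D E (\<lambda>j. \<Prod>l\<in>L. \<theta> j - \<theta> l) *v v"
    have "spectral_sum D E (\<lambda>j. \<Prod>l\<in>insert l L. \<theta> j - \<theta> l) *v v
        = spectral_sum D E \<theta> *v ?w - \<theta> l *s ?w"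
      by (rule resolution_ext[OF E])
        (use insert in \<open>simp add: resolution_spectral[OF E] matrix_vector_mult_diff_distrib
           matrix_vec_scale vector_smult_assoc flip: vector_sub_rdistrib left_diff_distrib\<close>)
    then show ?case
      using insert inv U by (simp add: vec.subspace_diff vec.subspace_scale)
  qed
  let ?L = "{..D} - {i}"
  have nz: "(\<Prod>l\<in>?L. \<theta> i - \<theta> l) \<noteq> 0"
    using inj i by (auto simp: inj_on_def)
  have "spectral_sum D E (\<lambda>j. \<Prod>l\<in>?L. \<theta> j - \<theta> l) *v v = (\<Prod>l\<in>?L. \<theta> i - \<theta> l) *s (E i *v v)"
  proof (rule resolution_ext[OF E])
    fix j assume j: "j \<le> D"
    have "(\<Prod>l\<in>?L. \<theta> j - \<theta> l) = 0" if "j \<noteq> i"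
      by (rule prod_zero) (use that j in auto)
    then show "E j *v (spectral_sum D E (\<lambda>j. \<Prod>l\<in>?L. \<theta> j - \<theta> l) *v v)
        = E j *v ((\<Prod>l\<in>?L. \<theta> i - \<theta> l) *s (E i *v v))"
      using i j by (auto simp: resolution_spectral[OF E] matrix_vec_scale resolution_idem[OF E])
  qed
  then have "(\<Prod>l\<in>?L. \<theta> i - \<theta> l) *s (E i *v v) \<in> U"
    using prod_in[of ?L] by simp
  then have "inverse (\<Prod>l\<in>?L. \<theta> i - \<theta> l) *s ((\<Prod>l\<in>?L. \<theta> i - \<theta> l) *s (E i *v v)) \<in> U"
    by (rule vec.subspace_scale[OF U])
  then show ?thesis using nz by (simp add: vector_smult_assoc)
qed

text \<open>An intertwiner of two matrices with the same simple spectrum matches eigenspaces with equal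
  eigenvalues, so it intertwines every function of them.\<close>

lemma intertwine_spectral:
  assumes E: "idempotent_resolution D E" and F: "idempotent_resolution D F"
    and inj: "inj_on \<theta> {..D}"
    and M: "\<And>v. spectral_sum D E \<theta> *v (M *v v) = M *v (spectral_sum D F \<theta> *v v)"
  shows "spectral_sum D E \<phi> *v (M *v v) = M *v (spectral_sum D F \<phi> *v v)"
proof (rule resolution_ext[OF E])
  fix i assume i: "i \<le> D"
  have off: "E i *v (M *v (F j *v w)) = 0" if "j \<le> D" "j \<noteq> i" for j w
  proof -
    have "\<theta> i *s (E i *v (M *v (F j *v w))) = E i *v (spectral_sum D E \<theta> *v (M *v (F j *v w)))"
      by (simp only: resolution_spectral[OF E i])
    also have "\<dots> = E i *v (M *v (spectral_sum D F \<theta> *v (F j *v w)))"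
      by (simp only: M)
    also have "\<dots> = \<theta> j *s (E i *v (M *v (F j *v w)))"
      by (simp only: spectral_resolution[OF F that(1)] matrix_vec_scale)
    finally have "\<theta> i = \<theta> j \<or> E i *v (M *v (F j *v w)) = 0"
      by (simp only: vector_mul_rcancel)
    then show ?thesis using inj_onD[OF inj, of i j] that i by auto
  qed
  have diag: "E i *v (M *v w) = E i *v (M *v (F i *v w))" for w
  proof -
    have "E i *v (M *v w) = (\<Sum>j\<le>D. E i *v (M *v (F j *v w)))"
      by (simp add: resolution_sum[OF F] flip: matrix_vec_sum)
    also have "\<dots> = (\<Sum>j\<le>D. if j = i then E i *v (M *v (F i *v w)) else 0)"
      using off by (intro sum.cong refl) auto
    finally show ?thesis using i by simp
  qed
  show "E i *v (spectral_sum D E \<phi> *v (M *v v)) = E i *v (M *v (spectral_sum D F \<phi> *v v))"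
    unfolding resolution_spectral[OF E i] diag[of v] diag[of "spectral_sum D F \<phi> *v v"]
      resolution_spectral[OF F i] by (simp add: matrix_vec_scale)
qed

section \<open>Invariant subspaces of a pair of self-adjoint matrices\<close>

text \<open>The inner product is the real one on \<open>\<complex>\<^sup>X\<close>, the real part of the Hermitian form. A matrix that
  is self-adjoint for it is self-adjoint for the Hermitian form, as \<open>v\<close> may be replaced by \<open>\<i> v\<close>.\<close>

definition selfadjoint :: "complex^'x^'x::finite \<Rightarrow> bool"
  where "selfadjoint B \<longleftrightarrow> (\<forall>v w. inner (B *v v) w = inner v (B *v w))"

lemma selfadjoint_real_symmetric:
  assumes "transpose B = B" "\<And>x y. Im (B $ x $ y) = 0"
  shows "selfadjoint B"
  unfolding selfadjoint_def
proof (intro allI)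
  fix v w :: "complex^'a"
  have sym: "B $ x $ y = B $ y $ x" for x y
    using assms(1) by (metis transpose_def vec_lambda_beta)
  have "inner (B *v v) w = (\<Sum>x\<in>UNIV. \<Sum>y\<in>UNIV. inner (B $ x $ y * v $ y) (w $ x))"
    by (simp add: inner_vec_def matrix_vector_mult_def inner_sum_left)
  also have "\<dots> = (\<Sum>y\<in>UNIV. \<Sum>x\<in>UNIV. inner (B $ x $ y * v $ y) (w $ x))"
    by (rule sum.swap)
  also have "\<dots> = (\<Sum>y\<in>UNIV. \<Sum>x\<in>UNIV. inner (v $ y) (B $ y $ x * w $ x))"
    by (intro sum.cong refl) (simp add: inner_complex_def assms(2) sym[of _ "_ :: 'a"] algebra_simps)
  also have "\<dots> = inner v (B *v w)"
    by (simp add: inner_vec_def matrix_vector_mult_def inner_sum_right)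
  finally show "inner (B *v v) w = inner v (B *v w)" .
qed

definition invariant_subspace ::
    "complex^'x^'x::finite \<Rightarrow> complex^'x^'x \<Rightarrow> (complex^'x) set \<Rightarrow> bool"
  where "invariant_subspace A S U \<longleftrightarrow>
    vec.subspace U \<and> (\<forall>v\<in>U. A *v v \<in> U) \<and> (\<forall>v\<in>U. S *v v \<in> U)"

definition irreducible_subspace ::
    "complex^'x^'x::finite \<Rightarrow> complex^'x^'x \<Rightarrow> (complex^'x) set \<Rightarrow> bool"
  where "irreducible_subspace A S U \<longleftrightarrow> invariant_subspace A S U \<and> U \<noteq> {0} \<and>
    (\<forall>U'. invariant_subspace A S U' \<and> U' \<subseteq> U \<longrightarrow> U' = {0} \<or> U' = U)"

lemma scaleR_vec_complex: "c *\<^sub>R (v::complex^'x) = complex_of_real c *s v"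
  unfolding vec_eq_iff vector_scaleR_component vector_smult_component
  by (simp add: scaleR_conv_of_real)

lemma subspace_of_vec_subspace: "vec.subspace U \<Longrightarrow> subspace (U :: (complex^'x::finite) set)"
  by (simp add: subspace_def vec.subspace_def scaleR_vec_complex)

lemma inner_vec_mult_swap: "inner (c *s v) w = inner v (cnj c *s (w::complex^'x::finite))"
  by (simp add: inner_vec_def inner_complex_def algebra_simps)

text \<open>The real inner product of \<open>\<complex>\<^sup>X\<close> suffices here: the real orthogonal complement of a complex
  subspace is again a complex subspace.\<close>

lemma vec_subspace_orthogonal_comp:
  assumes "vec.subspace (U :: (complex^'x::finite) set)"
  shows "vec.subspace (orthogonal_comp U)"
proof -
  have "c *s v \<in> orthogonal_comp U" if v: "v \<in> orthogonal_comp U" for c v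
  proof -
    have "inner (c *s v) w = 0" if "w \<in> U" for w
      using v vec.subspace_scale[OF assms that, of "cnj c"] unfolding inner_vec_mult_swap
      by (auto simp: orthogonal_comp_def orthogonal_def inner_commute)
    then show ?thesis by (auto simp: orthogonal_comp_def orthogonal_def inner_commute[of _ "c *s v"])
  qed
  then show ?thesis
    using subspace_orthogonal_comp[of U] by (auto simp: vec.subspace_def subspace_def)
qed

lemma invariant_subspace_inter_comp:
  assumes "selfadjoint A" "selfadjoint S" "invariant_subspace A S U" "invariant_subspace A S V"
  shows "invariant_subspace A S (orthogonal_comp U \<inter> V)"
proof -
  have "B *v v \<in> orthogonal_comp U"
    if "selfadjoint B" "\<forall>u\<in>U. B *v u \<in> U" "v \<in> orthogonal_comp U" for B v
    using that by (auto simp: orthogonal_comp_def orthogonal_def selfadjoint_def inner_commute)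
      (metis inner_commute)
  then show ?thesis
    using assms by (auto simp: invariant_subspace_def vec_subspace_orthogonal_comp vec.subspace_inter)
qed

text \<open>Complete reducibility: a linear condition on vectors can be checked on the irreducible
  invariant subspaces, since every invariant subspace splits off an orthogonal complement.\<close>

theorem vanishes_if_vanishes_on_irreducibles:
  fixes A S B :: "complex^'x::finite^'x"
  assumes A: "selfadjoint A" and S: "selfadjoint S"
    and irr: "\<And>U v. irreducible_subspace A S U \<Longrightarrow> v \<in> U \<Longrightarrow> B *v v = 0"
  shows "B *v v = 0"
proof -
  have "\<forall>v\<in>V. B *v v = 0" if "invariant_subspace A S V" for V
    using that
  proof (induction "vec.dim V" arbitrary: V rule: less_induct)
    case less
    show ?case
    proof (cases "irreducible_subspace A S V \<or> V = {0}")
      case True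
      then show ?thesis using irr by auto
    next
      case False
      with less.prems obtain U where U: "invariant_subspace A S U" "U \<subseteq> V" "U \<noteq> {0}" "U \<noteq> V"
        by (auto simp: irreducible_subspace_def)
      let ?U' = "orthogonal_comp U \<inter> V"
      have U': "invariant_subspace A S ?U'"
        by (rule invariant_subspace_inter_comp[OF A S U(1) less.prems])
      have sub: "vec.subspace U" "vec.subspace V" "vec.subspace ?U'"
        using U less.prems U' by (auto simp: invariant_subspace_def)
      have dim_less: "vec.dim U1 < vec.dim V" if "vec.subspace U1" "U1 \<subseteq> V" "U1 \<noteq> V" for U1
      proof -
        have "vec.dim U1 \<noteq> vec.dim V"
          using vec.subspace_dim_equal[of U1 V] that sub(2) by auto
        moreover have "vec.dim U1 \<le> vec.dim V" by (rule vec.dim_subset[OF that(2)])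
        ultimately show ?thesis by simp
      qed
      have split: "\<exists>u\<in>U. \<exists>u'\<in>?U'. v = u + u'" if v: "v \<in> V" for v
      proof -
        have "v \<in> U + orthogonal_comp U"
          using subspace_sum_orthogonal_comp[OF subspace_of_vec_subspace[OF sub(1)]] by simp
        then obtain u u' where uu: "u \<in> U" "u' \<in> orthogonal_comp U" "v = u + u'"
          by (auto simp: set_plus_def)
        then have "u' = v - u" by simp
        then have "u' \<in> V" using v uu(1) U(2) sub(2) vec.subspace_diff by blast
        then show ?thesis using uu by blast
      qed
      have ne: "?U' \<noteq> V"
      proof
        assume eq: "?U' = V"
        obtain u where "u \<in> U" "u \<noteq> 0"
          using U(3) vec.subspace_0[OF sub(1)] by auto
        then have "u \<in> orthogonal_comp U" using eq U(2) by auto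
        then have "inner u u = 0" using \<open>u \<in> U\<close>
          by (auto simp: orthogonal_comp_def orthogonal_def)
        then show False using \<open>u \<noteq> 0\<close> by simp
      qed
      have "\<forall>v\<in>U. B *v v = 0"
        by (rule less.hyps[OF dim_less[OF sub(1) U(2,4)] U(1)])
      moreover have "\<forall>v\<in>?U'. B *v v = 0"
        by (rule less.hyps[OF dim_less[OF sub(3) _ ne] U']) auto
      ultimately show ?thesis
        using split by (metis (no_types, lifting) add.right_neutral matrix_vector_right_distrib)
    qed
  qed
  moreover have "invariant_subspace A S UNIV"
    by (simp add: invariant_subspace_def)
  ultimately show ?thesis by auto
qed

text \<open>A self-adjoint matrix has real eigenvalues and orthogonal eigenspaces, so its spectral
  projections are self-adjoint as well.\<close>

lemma selfadjoint_resolution: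
  assumes E: "idempotent_resolution D E" and inj: "inj_on \<theta> {..D}"
    and A: "selfadjoint (spectral_sum D E \<theta>)" and i: "i \<le> D"
  shows "selfadjoint (E i)"
proof -
  have swap: "inner v ((cnj (\<theta> i) - \<theta> j) * m *s w) = 0"
    if ij: "i \<le> D" "j \<le> D" "E i *v v = v" "E j *v w = w" for i j v w m
  proof -
    have "inner (\<theta> i *s v) (m *s w) = inner v (\<theta> j *s (m *s w))"
      using A spectral_resolution[OF E ij(1), of \<theta> v] spectral_resolution[OF E ij(2), of \<theta> w] ij
      by (metis selfadjoint_def matrix_vec_scale vector_smult_assoc mult.commute)
    then show ?thesis
      by (simp add: inner_vec_mult_swap inner_diff_right left_diff_distrib vec.scale_left_diff_distrib)
  qed
  have orth: "inner (E i *v v) (E j *v w) = 0" if ij: "i \<le> D" "j \<le> D" "i \<noteq> j" for i j v w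
  proof (cases "cnj (\<theta> i) = \<theta> j")
    case False
    then show ?thesis
      using swap[of i j "E i *v v" "E j *v w" "inverse (cnj (\<theta> i) - \<theta> j)"] ij
      by (simp add: resolution_idem[OF E])
  next
    case True
    have "\<theta> j \<noteq> \<theta> i" using inj_onD[OF inj, of i j] ij by auto
    then have "cnj (\<theta> i) - \<theta> i \<noteq> 0" using True by simp
    then have "inner (E i *v v) (E i *v v) = 0"
      using swap[of i i "E i *v v" "E i *v v" "inverse (cnj (\<theta> i) - \<theta> i)"] ij
      by (simp add: resolution_idem[OF E])
    then show ?thesis by simp
  qed
  have "inner (E i *v v) w = inner (E i *v v) (E i *v w)" for v w
  proof -
    have "inner (E i *v v) w = inner (E i *v v) (\<Sum>j\<le>D. E j *v w)"
      by (simp add: resolution_sum[OF E])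
    also have "\<dots> = (\<Sum>j\<le>D. if j = i then inner (E i *v v) (E i *v w) else 0)"
      unfolding inner_sum_right using orth i by (intro sum.cong) auto
    finally show ?thesis using i by simp
  qed
  then show ?thesis unfolding selfadjoint_def by (metis inner_commute)
qed

text \<open>A matrix that is both symmetric and Hermitian is real. This is how the idempotents of a
  graph are seen to have real entries.\<close>

lemma selfadjoint_symmetric_real:
  assumes B: "selfadjoint B" "transpose B = B"
  shows "Im (B $ x $ y) = 0"
proof -
  have sym: "B $ x $ y = B $ y $ x" using B(2) by (metis transpose_def vec_lambda_beta)
  have col: "B *v axis y m = (\<chi> z. B $ z $ y * m)" for y m
    by (simp add: vec_eq_iff matrix_vector_mult_def axis_def if_distrib cong: if_cong)
  have "inner (B *v axis y 1) (axis x \<i>) = inner (axis y 1) (B *v axis x \<i>)"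
    using B(1) by (simp add: selfadjoint_def)
  then have "inner (B $ x $ y) \<i> = inner 1 (B $ y $ x * \<i>)"
    unfolding col by (simp add: inner_axis inner_axis')
  then show ?thesis by (simp add: inner_complex_def sym)
qed

section \<open>Thin tridiagonal modules\<close>

definition eigen_support :: "nat \<Rightarrow> (nat \<Rightarrow> complex^'x^'x::finite) \<Rightarrow> (complex^'x) set \<Rightarrow> nat set"
  where "eigen_support D E U = {i. i \<le> D \<and> (\<exists>v\<in>U. E i *v v \<noteq> 0)}"

lemma finite_eigen_support: "finite (eigen_support D E U)"
  by (rule finite_subset[of _ "{..D}"]) (auto simp: eigen_support_def)

lemma irreducible_subspace_commute: "irreducible_subspace A S U \<longleftrightarrow> irreducible_subspace S A U"
  by (auto simp: irreducible_subspace_def invariant_subspace_def)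

lemma convex_nat_set_eq_interval:
  fixes S :: "nat set"
  assumes "finite S" "S \<noteq> {}" and convex: "\<And>i j k. i \<in> S \<Longrightarrow> k \<in> S \<Longrightarrow> i < j \<Longrightarrow> j < k \<Longrightarrow> j \<in> S"
  shows "S = {Min S..Min S + (card S - 1)}"
proof -
  have *: "S = {Min S..Max S}"
  proof (intro equalityI subsetI)
    fix j assume "j \<in> {Min S..Max S}"
    then show "j \<in> S"
      using convex[of "Min S" "Max S" j] Min_in[OF assms(1,2)] Max_in[OF assms(1,2)]
      by (cases "j = Min S \<or> j = Max S") auto
  qed (use assms(1) in auto)
  have "card S = card {Min S..Max S}" by (rule arg_cong[OF *])
  moreover have "Min S \<le> Max S" using assms by simp
  ultimately have e: "Min S + (card S - 1) = Max S" by simp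
  show ?thesis unfolding e by (rule *)
qed

text \<open>The setting is symmetric in the two families \<open>E\<close> and \<open>F\<close>: each of the matrices
  \<open>\<Sum>\<^sub>i \<theta>\<^sub>i E\<^sub>i\<close> and \<open>\<Sum>\<^sub>i \<theta>\<^sub>i F\<^sub>i\<close> acts tridiagonally on the eigenspaces of the other. Interpreting the
  locale with the two exchanged yields the dual of every fact.\<close>

locale tridiagonal_module =
  fixes D :: nat and E F :: "nat \<Rightarrow> complex^'x::finite^'x" and \<theta> :: "nat \<Rightarrow> complex"
    and U :: "(complex^'x) set"
  assumes E: "idempotent_resolution D E" and F: "idempotent_resolution D F"
    and inj: "inj_on \<theta> {..D}"
    and E_adj: "\<And>i. i \<le> D \<Longrightarrow> selfadjoint (E i)" and F_adj: "\<And>i. i \<le> D \<Longrightarrow> selfadjoint (F i)"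
    and irr: "irreducible_subspace (spectral_sum D E \<theta>) (spectral_sum D F \<theta>) U"
    and tri_F: "\<And>i j v. i \<le> D \<Longrightarrow> j \<le> D \<Longrightarrow> j + 1 < i \<or> i + 1 < j \<Longrightarrow>
        F i *v (spectral_sum D E \<theta> *v (F j *v v)) = 0"
    and tri_E: "\<And>i j v. i \<le> D \<Longrightarrow> j \<le> D \<Longrightarrow> j + 1 < i \<or> i + 1 < j \<Longrightarrow>
        E i *v (spectral_sum D F \<theta> *v (E j *v v)) = 0"
begin

abbreviation "A \<equiv> spectral_sum D E \<theta>"
abbreviation "S \<equiv> spectral_sum D F \<theta>"
abbreviation "supp \<equiv> eigen_support D F U"

lemma dual: "tridiagonal_module D F E \<theta> U"
  by unfold_locales
    (use E F inj E_adj F_adj irr tri_F tri_E in \<open>auto simp: irreducible_subspace_commute\<close>)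

lemma U_sub: "vec.subspace U" and A_U: "v \<in> U \<Longrightarrow> A *v v \<in> U" and S_U: "v \<in> U \<Longrightarrow> S *v v \<in> U"
  using irr by (auto simp: irreducible_subspace_def invariant_subspace_def)

lemma F_U: "i \<le> D \<Longrightarrow> v \<in> U \<Longrightarrow> F i *v v \<in> U"
  using resolution_invariant[OF F inj U_sub] S_U by blast

lemma supp_nonempty: "supp \<noteq> {}"
proof -
  obtain v where v: "v \<in> U" "v \<noteq> 0"
    using irr U_sub vec.subspace_0 by (auto simp: irreducible_subspace_def)
  then obtain i where "i \<le> D" "F i *v v \<noteq> 0"
    using resolution_ext[OF F, of v 0] by auto
  then show ?thesis using v by (auto simp: eigen_support_def)
qed

text \<open>If \<open>A\<close> never leads from level \<open>i + 1\<close> down to level \<open>i\<close>, the vectors supported above level \<open>i\<close>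
  form an invariant subspace. By irreducibility it is all of \<open>U\<close> as soon as a level above \<open>i\<close>
  occurs.\<close>

lemma cut_below:
  assumes drop: "\<And>v. v \<in> U \<Longrightarrow> F i *v (A *v (F (Suc i) *v v)) = 0"
    and j: "j \<in> supp" "i < j" and l: "l \<le> i" and v: "v \<in> U"
  shows "F l *v v = 0"
proof -
  define U' where "U' = {v \<in> U. \<forall>l\<le>i. F l *v v = 0}"
  have iD: "Suc i \<le> D" using j by (auto simp: eigen_support_def)
  have "A *v v \<in> U'" if "v \<in> U'" for v
  proof -
    have "F l *v (A *v v) = 0" if l: "l \<le> i" for l
    proof -
      have "F l *v (A *v v) = F l *v (A *v (\<Sum>m\<le>D. F m *v v))"
        by (simp add: resolution_sum[OF F])
      also have "\<dots> = (\<Sum>m\<le>D. F l *v (A *v (F m *v v)))"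
        by (simp add: matrix_vec_sum)
      also have "\<dots> = 0"
      proof (rule sum.neutral, intro ballI)
        fix m assume "m \<in> {..D}"
        then consider "m \<le> i" | "m = Suc i" "l = i" | "l + 1 < m" "m \<le> D" using l by fastforce
        then show "F l *v (A *v (F m *v v)) = 0"
        proof cases
          case 1
          then show ?thesis using \<open>v \<in> U'\<close> by (simp add: U'_def)
        next
          case 2
          then show ?thesis using drop \<open>v \<in> U'\<close> by (simp add: U'_def)
        next
          case 3
          then show ?thesis using tri_F l iD by simp
        qed
      qed
      finally show ?thesis .
    qed
    then show ?thesis using that A_U by (simp add: U'_def)
  qed
  moreover have "S *v v \<in> U'" if "v \<in> U'" for v
    using that S_U iD by (simp add: U'_def resolution_spectral[OF F])
  moreover have "vec.subspace U'"
    using U_sub by (auto simp: U'_def vec.subspace_def matrix_vector_right_distrib matrix_vec_scale)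
  ultimately have "invariant_subspace A S U'" by (simp add: invariant_subspace_def)
  moreover have "U' \<subseteq> U" by (auto simp: U'_def)
  moreover have "U' \<noteq> {0}"
  proof -
    obtain w where w: "w \<in> U" "F j *v w \<noteq> 0" "j \<le> D" using j(1) by (auto simp: eigen_support_def)
    then have "F j *v w \<in> U'" using j(2) F_U iD by (auto simp: U'_def resolution_idem[OF F])
    then show ?thesis using w by auto
  qed
  ultimately have "U' = U" using irr by (auto simp: irreducible_subspace_def)
  then show ?thesis using v l by (auto simp: U'_def)
qed

lemma supp_convex:
  assumes "i \<in> supp" "k \<in> supp" "i < j" "j < k"
  shows "j \<in> supp"
proof (rule ccontr)
  assume "j \<notin> supp"
  then have z: "F j *v v = 0" if "v \<in> U" for v
    using that assms by (auto simp: eigen_support_def)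
  have "F i *v v = 0" if "v \<in> U" for v
    by (rule cut_below[of j k]) (use assms that z F_U A_U in \<open>auto simp: eigen_support_def\<close>)
  then show False using assms(1) by (auto simp: eigen_support_def)
qed

lemma supp_interval: "supp = {Min supp..Min supp + (card supp - 1)}"
  by (rule convex_nat_set_eq_interval[OF finite_eigen_support supp_nonempty]) (rule supp_convex)

end

locale thin_tridiagonal_module = tridiagonal_module +
  assumes thin: "\<And>i. i \<le> D \<Longrightarrow> \<exists>w. \<forall>v\<in>U. \<exists>m. F i *v v = m *s w"
begin

text \<open>An eigenvector of a tridiagonal matrix is determined by its first component: at the lowest level
  \<open>k\<close> where it does not vanish, the eigenvalue equation at level \<open>k - 1\<close> says that \<open>A\<close> does not lead from \<open>k\<close> down
  to \<open>k - 1\<close> on this vector, hence by thinness not at all, against irreducibility.\<close>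

lemma eigenvector_first_component:
  assumes v: "v \<in> U" "A *v v = l *s v" and first: "F (Min supp) *v v = 0"
  shows "v = 0"
proof -
  let ?r = "Min supp"
  have r: "?r \<in> supp" using Min_in[OF finite_eigen_support supp_nonempty] .
  have "F i *v v = 0" if "i \<le> D" for i
    using that
  proof (induction i rule: less_induct)
    case (less k)
    show ?case
    proof (cases "k \<le> ?r")
      case True
      show ?thesis
      proof (cases "k = ?r")
        case False
        then have "k \<notin> supp" using True Min_le[OF finite_eigen_support, of k D F U] by auto
        then show ?thesis using less.prems v by (auto simp: eigen_support_def)
      qed (use first in simp)
    next
      case False
      then obtain i where k: "k = Suc i" "?r \<le> i" by (cases k) auto
      show ?thesis
      proof (rule ccontr)
        assume nz: "F k *v v \<noteq> 0"
        have iD: "i \<le> D" using k less.prems by simp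
        have "0 = F i *v (A *v v)"
          using less.IH[of i] k iD by (simp add: v(2) matrix_vec_scale)
        also have "\<dots> = F i *v (A *v (\<Sum>m\<le>D. F m *v v))"
          by (simp add: resolution_sum[OF F])
        also have "\<dots> = (\<Sum>m\<le>D. F i *v (A *v (F m *v v)))"
          by (simp add: matrix_vec_sum)
        also have "\<dots> = (\<Sum>m\<le>D. if m = k then F i *v (A *v (F k *v v)) else 0)"
        proof (intro sum.cong refl)
          fix m assume "m \<in> {..D}"
          then consider "m < k" | "m = k" | "i + 1 < m" "m \<le> D" using k by fastforce
          then show "F i *v (A *v (F m *v v)) = (if m = k then F i *v (A *v (F k *v v)) else 0)"
            using less.IH[of m] less.prems tri_F[OF iD, of m v] k by cases auto
        qed
        finally have Av: "F i *v (A *v (F k *v v)) = 0" using less.prems by simp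
        obtain w where w: "\<forall>v\<in>U. \<exists>m. F k *v v = m *s w" using thin[OF less.prems] by blast
        then obtain m where m: "F k *v v = m *s w" using v by blast
        have "m \<noteq> 0" using nz m by auto
        have "F i *v (A *v w) = inverse m *s (F i *v (A *v (F k *v v)))"
          unfolding m using \<open>m \<noteq> 0\<close> by (simp add: matrix_vec_scale)
        then have Aw: "F i *v (A *v w) = 0" using Av by simp
        have drop: "F i *v (A *v (F (Suc i) *v v')) = 0" if "v' \<in> U" for v'
          using w that Aw k by (fastforce simp: matrix_vec_scale)
        have "k \<in> supp" using nz v less.prems by (auto simp: eigen_support_def)
        then have "F ?r *v v' = 0" if "v' \<in> U" for v'
          using cut_below[OF drop, of k ?r] k that by auto
        then show False using r by (auto simp: eigen_support_def)
      qed
    qed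
  qed
  then show ?thesis using resolution_ext[OF F, of v 0] by simp
qed

text \<open>Thinness passes from \<open>F\<close> to \<open>E\<close>: the vectors of \<open>E\<^sub>iU\<close> are eigenvectors of \<open>A\<close>, and their
  first components lie on one line.\<close>

lemma thin_E: "i \<le> D \<Longrightarrow> \<exists>w. \<forall>v\<in>U. \<exists>m. E i *v v = m *s w"
proof -
  assume i: "i \<le> D"
  interpret dual: tridiagonal_module D F E \<theta> U by (rule dual)
  show ?thesis
  proof (cases "\<exists>v0\<in>U. E i *v v0 \<noteq> 0")
    case True
    then obtain v0 where v0: "v0 \<in> U" "E i *v v0 \<noteq> 0" by blast
    let ?w = "E i *v v0" and ?r = "Min supp"
    have rD: "?r \<le> D" using Min_in[OF finite_eigen_support supp_nonempty] by (simp add: eigen_support_def)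
    obtain w' where w': "\<forall>v\<in>U. \<exists>m. F ?r *v v = m *s w'" using thin[OF rD] by blast
    have w_U: "?w \<in> U" using dual.F_U i v0 by blast
    obtain m1 where m1: "F ?r *v ?w = m1 *s w'" using w' w_U by blast
    have "m1 \<noteq> 0"
      using eigenvector_first_component[OF w_U spectral_resolution[OF E i]] v0 m1 by auto
    have "\<exists>m. E i *v v = m *s ?w" if v: "v \<in> U" for v
    proof -
      have v1: "E i *v v \<in> U" using dual.F_U i v by blast
      then obtain m2 where m2: "F ?r *v (E i *v v) = m2 *s w'" using w' by blast
      let ?z = "E i *v v - (m2 / m1) *s ?w"
      have "?z \<in> U" using v1 w_U U_sub by (simp add: vec.subspace_diff vec.subspace_scale)
      moreover have "A *v ?z = \<theta> i *s ?z"
        by (simp add: matrix_vector_mult_diff_distrib matrix_vec_scale spectral_resolution[OF E i]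
            vec.scale_right_diff_distrib mult.commute)
      moreover have "F ?r *v ?z = 0"
        using \<open>m1 \<noteq> 0\<close> by (simp add: matrix_vector_mult_diff_distrib matrix_vec_scale m1 m2)
      ultimately have "?z = 0" by (rule eigenvector_first_component)
      then show ?thesis by auto
    qed
    then show ?thesis by blast
  next
    case False
    then show ?thesis by (intro exI[of _ 0]) auto
  qed
qed

lemma dual_thin: "thin_tridiagonal_module D F E \<theta> U"
  using dual thin_E by (simp add: thin_tridiagonal_module_def thin_tridiagonal_module_axioms_def)

text \<open>If \<open>F\<^sub>mu = 0\<close>, then \<open>u\<close> is orthogonal to \<open>F\<^sub>mU\<close>. But by the dual of
  \<open>eigenvector_first_component\<close> a nonzero vector of \<open>F\<^sub>mU\<close> has a nonzero component in \<open>E\<^sub>sU\<close>, where \<open>s\<close> is the least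
  index with \<open>E\<^sub>sU \<noteq> 0\<close>; this space is the line through \<open>u\<close>.\<close>

lemma seed_component:
  assumes u: "u \<in> U" "u \<noteq> 0" "E (Min (eigen_support D E U)) *v u = u" and m: "m \<in> supp"
  shows "F m *v u \<noteq> 0"
proof
  assume F0: "F m *v u = 0"
  let ?s = "Min (eigen_support D E U)"
  interpret dual: thin_tridiagonal_module D F E \<theta> U by (rule dual_thin)
  have sD: "?s \<le> D"
    using Min_in[OF finite_eigen_support dual.supp_nonempty] by (simp add: eigen_support_def)
  obtain v0 where v0: "v0 \<in> U" "F m *v v0 \<noteq> 0" and mD: "m \<le> D" using m by (auto simp: eigen_support_def)
  let ?v = "F m *v v0"
  have v: "?v \<in> U" using F_U mD v0 by blast
  have nz: "E ?s *v ?v \<noteq> 0"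
    using dual.eigenvector_first_component[OF v spectral_resolution[OF F mD]] v0 by blast
  obtain w where w: "\<forall>v\<in>U. \<exists>m. E ?s *v v = m *s w" using thin_E[OF sD] by blast
  obtain m1 m2 where m12: "E ?s *v ?v = m1 *s w" "E ?s *v u = m2 *s w" using w v u(1) by blast
  have m_nz: "m1 \<noteq> 0" "m2 \<noteq> 0" using nz m12 u by auto
  \<comment> \<open>The multiple of \<open>?v\<close> with \<open>E\<^sub>s\<close>-component \<open>u\<close>; its inner
    product with \<open>u\<close> is that of \<open>u\<close> with itself.\<close>
  let ?v' = "(m2 / m1) *s ?v"
  have Ev': "E ?s *v ?v' = u"
    using m12 m_nz u(3) by (simp add: matrix_vec_scale)
  have Fv': "F m *v ?v' = ?v'" using mD by (simp add: matrix_vec_scale resolution_idem[OF F])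
  have "0 = inner (F m *v u) ?v'" using F0 by simp
  also have "\<dots> = inner u ?v'"
    using F_adj[OF mD] Fv' by (simp add: selfadjoint_def)
  also have "\<dots> = inner (E ?s *v u) ?v'" by (simp only: u(3))
  also have "\<dots> = inner u u"
    using E_adj[OF sD] Ev' by (simp add: selfadjoint_def)
  finally show False using u(2) by simp
qed

lemma coordinates:
  fixes u assumes u: "u \<in> U" "u \<noteq> 0" "E (Min (eigen_support D E U)) *v u = u"
  defines "r \<equiv> Min supp" and "d \<equiv> card supp - 1"
  assumes v: "v \<in> U"
  shows "\<exists>f. v = (\<Sum>i\<le>d. f i *s (F (r + i) *v u))"
proof -
  have supp: "supp = {r..r + d}" using supp_interval by (simp add: r_def d_def)
  have "r + d \<in> supp" using supp by simp
  then have rd: "r + d \<le> D" by (simp add: eigen_support_def)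
  have "\<exists>m. F (r + i) *v v = m *s (F (r + i) *v u)" if "i \<le> d" for i
  proof -
    have "r + i \<le> D" using rd that by simp
    then obtain w where w: "\<forall>v\<in>U. \<exists>m. F (r + i) *v v = m *s w" using thin by blast
    obtain m1 m2 where m12: "F (r + i) *v v = m1 *s w" "F (r + i) *v u = m2 *s w" using w v u(1) by blast
    moreover have "F (r + i) *v u \<noteq> 0" using seed_component[OF u, of "r + i"] supp that by simp
    ultimately have "m2 \<noteq> 0" by auto
    then have "F (r + i) *v v = (m1 / m2) *s (F (r + i) *v u)" using m12 by simp
    then show ?thesis by blast
  qed
  then obtain f where f: "F (r + i) *v v = f i *s (F (r + i) *v u)" if "i \<le> d" for i by metis
  have "v = (\<Sum>j\<le>D. F j *v v)" by (simp add: resolution_sum[OF F])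
  also have "\<dots> = (\<Sum>j\<in>{r..r + d}. F j *v v)"
    using v rd supp by (intro sum.mono_neutral_right) (auto simp: eigen_support_def)
  also have "\<dots> = (\<Sum>i\<le>d. F (r + i) *v v)"
    by (rule sum.reindex_bij_witness[of _ "\<lambda>i. r + i" "\<lambda>j. j - r"]) auto
  also have "\<dots> = (\<Sum>i\<le>d. f i *s (F (r + i) *v u))"
    using f by (intro sum.cong) auto
  finally show ?thesis by blast
qed

lemma three_term:
  fixes u assumes u: "u \<in> U" "u \<noteq> 0" "E (Min (eigen_support D E U)) *v u = u"
  defines "r \<equiv> Min supp" and "d \<equiv> card supp - 1"
  shows "\<exists>c a b. \<forall>i\<le>d. A *v (F (r + i) *v u) =
      (if i < d then c (i + 1) *s (F (r + i + 1) *v u) else 0) + a i *s (F (r + i) *v u)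
      + (if 0 < i then b (i - 1) *s (F (r + i - 1) *v u) else 0)"
proof -
  have supp: "supp = {r..r + d}" using supp_interval by (simp add: r_def d_def)
  have "r + d \<in> supp" using supp by simp
  then have rd: "r + d \<le> D" by (simp add: eigen_support_def)
  have nz: "F (r + i) *v u \<noteq> 0" if "i \<le> d" for i
    using seed_component[OF u, of "r + i"] supp that by simp
  have "\<exists>g. A *v (F (r + i) *v u) = (\<Sum>j\<le>d. g j *s (F (r + j) *v u))" if "i \<le> d" for i
    using coordinates[OF u, of "A *v (F (r + i) *v u)"] A_U F_U u(1) rd that
    unfolding r_def d_def by auto
  then obtain g where g: "A *v (F (r + i) *v u) = (\<Sum>j\<le>d. g i j *s (F (r + j) *v u))" if "i \<le> d" for i
    by metis
  have g0: "g i j = 0" if ij: "i \<le> d" "j \<le> d" "j + 1 < i \<or> i + 1 < j" for i j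
  proof -
    have "0 = F (r + j) *v (A *v (F (r + i) *v u))"
      using tri_F[of "r + j" "r + i" u] ij rd by auto
    also have "\<dots> = (\<Sum>l\<le>d. g i l *s (F (r + j) *v (F (r + l) *v u)))"
      unfolding g[OF ij(1)] by (simp add: matrix_vec_sum matrix_vec_scale)
    also have "\<dots> = (\<Sum>l\<le>d. if l = j then g i j *s (F (r + j) *v u) else 0)"
      using rd ij by (intro sum.cong refl) (auto simp: resolution_idem[OF F])
    finally show ?thesis using nz[OF ij(2)] ij by simp
  qed
  let ?u = "\<lambda>j. F (r + j) *v u"
  have "A *v ?u i = (if i < d then g i (i + 1) *s ?u (i + 1) else 0) + g i i *s ?u i
      + (if 0 < i then g i (i - 1) *s ?u (i - 1) else 0)" if i: "i \<le> d" for i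
  proof -
    have "A *v ?u i = (\<Sum>j\<in>{j. j \<le> d \<and> j \<le> i + 1 \<and> i \<le> j + 1}. g i j *s ?u j)"
      unfolding g[OF i]
    proof (rule sum.mono_neutral_right; (intro ballI)?)
      fix j assume "j \<in> {..d} - {j. j \<le> d \<and> j \<le> i + 1 \<and> i \<le> j + 1}"
      then have "g i j = 0" using g0[OF i, of j] by (auto simp: not_le)
      then show "g i j *s ?u j = 0" by simp
    qed auto
    also have "{j. j \<le> d \<and> j \<le> i + 1 \<and> i \<le> j + 1}
        = (if i < d then {i + 1} else {}) \<union> ({i} \<union> (if 0 < i then {i - 1} else {}))"
      using i by (auto split: if_splits)
    also have "(\<Sum>j\<in>\<dots>. g i j *s ?u j) = (\<Sum>j\<in>(if i < d then {i + 1} else {}). g i j *s ?u j)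
        + ((\<Sum>j\<in>{i}. g i j *s ?u j) + (\<Sum>j\<in>(if 0 < i then {i - 1} else {}). g i j *s ?u j))"
      by (subst sum.union_disjoint; (subst sum.union_disjoint)?; auto split: if_splits)
    finally show ?thesis by simp
  qed
  then show ?thesis
    by (intro exI[of _ "\<lambda>i. g (i - 1) i"] exI[of _ "\<lambda>i. g i i"] exI[of _ "\<lambda>i. g (i + 1) i"])
      (auto simp: add.assoc)
qed

end

section \<open>Askey-Wilson relations for coefficient sequences\<close>

text \<open>The intersection numbers of a module, divided by \<open>\<alpha>\<close>, depend on its endpoint \<open>r\<close> and
  diameter \<open>d\<close> only through \<open>s = a q\<^sup>2\<^sup>r\<^sup>-\<^sup>D\<close> and \<open>\<delta> = q\<^sup>2\<^sup>d\<close>, and on the index only through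
  \<open>\<eta> = q\<^sup>2\<^sup>i\<close>. The coefficients at the two ends are the values of the generic formulas at \<open>\<eta> = 1\<close> and
  \<open>\<eta> = \<delta>\<close> with the factor \<open>s\<^sup>2\<eta>\<^sup>2 - 1\<close> cancelled; they are separate because this factor may
  vanish there.\<close>
abbreviation coeff_b :: "complex \<Rightarrow> complex \<Rightarrow> complex \<Rightarrow> complex \<Rightarrow> complex" where
  "coeff_b s q \<delta> \<eta> \<equiv> (\<eta> - \<delta>) * (s ^ 2 * \<eta> - 1) * (s ^ 3 * \<delta> * q * \<eta> - 1)
    / (s * \<delta> * (s ^ 2 * \<eta> ^ 2 - 1) * (s * q * \<eta> + 1))"

abbreviation coeff_c :: "complex \<Rightarrow> complex \<Rightarrow> complex \<Rightarrow> complex \<Rightarrow> complex" where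
  "coeff_c s q \<delta> \<eta> \<equiv> (\<eta> - 1) * (s ^ 2 * \<delta> * \<eta> - 1) * (\<eta> - s * \<delta> * q)
    / (\<delta> * (s ^ 2 * \<eta> ^ 2 - 1) * (s * \<eta> + q))"

abbreviation coeff_b_first :: "complex \<Rightarrow> complex \<Rightarrow> complex \<Rightarrow> complex" where
  "coeff_b_first s q \<delta> \<equiv> (1 - \<delta>) * (s ^ 3 * \<delta> * q - 1) / (s * \<delta> * (s * q + 1))"

abbreviation coeff_c_last :: "complex \<Rightarrow> complex \<Rightarrow> complex \<Rightarrow> complex" where
  "coeff_c_last s q \<delta> \<equiv> (1 - \<delta>) * (s * q - 1) / (s * \<delta> + q)"

abbreviation relation_scale :: "complex \<Rightarrow> complex \<Rightarrow> complex \<Rightarrow> complex" where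
  "relation_scale s q \<delta> \<equiv> (1 + \<delta> * s * q) * (1 + \<delta> * s ^ 2) / (s ^ 2 * \<delta> * q)"

text \<open>The following two lemmas replace the explicit coefficients by two relations that are linear in
  them. In terms of \<open>x = s \<eta>\<close> and of the eigenvalue \<open>x + 1/x\<close> they carry all that the Askey-Wilson relations use of the
  explicit formulas. Both become polynomial identities once the denominators are cleared.\<close>

lemma coefficients_sum_relation:
  fixes s q \<delta> \<eta> :: complex
  assumes "s \<noteq> 0" "q \<noteq> 0" "\<delta> \<noteq> 0" "s ^ 2 * \<eta> ^ 2 \<noteq> 1" "s * q * \<eta> + 1 \<noteq> 0" "s * \<eta> + q \<noteq> 0"
   "b = coeff_b s q \<delta> \<eta>"
   "c = coeff_c s q \<delta> \<eta>"
  shows "(s + 1 / s - b - c) * ((s * \<eta> + q) * (s * q * \<eta> + 1)) = (s + q) * (relation_scale s q \<delta>) * (s * \<eta> * q)"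
proof -
  define N where "N = s ^ 2 * \<eta> ^ 2 - 1"
  have n: "N \<noteq> 0" using assms by (simp add: N_def)
  have B: "b * (s * \<delta> * N * (s * q * \<eta> + 1)) = (\<eta> - \<delta>) * (s ^ 2 * \<eta> - 1) * (s ^ 3 * \<delta> * q * \<eta> - 1)"
    unfolding assms(7) using assms(1-6) n by (simp add: N_def)
  have C: "c * (\<delta> * N * (s * \<eta> + q)) = (\<eta> - 1) * (s ^ 2 * \<delta> * \<eta> - 1) * (\<eta> - s * \<delta> * q)"
    unfolding assms(8) using assms(1-6) n by (simp add: N_def)
  have "(s + 1 / s - b - c) * ((s * \<eta> + q) * (s * q * \<eta> + 1)) * (s * \<delta> * N)
     = (s ^ 2 + 1) * \<delta> * N * ((s * \<eta> + q) * (s * q * \<eta> + 1))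
       - (b * (s * \<delta> * N * (s * q * \<eta> + 1))) * (s * \<eta> + q) - (c * (\<delta> * N * (s * \<eta> + q))) * (s * (s * q * \<eta> + 1))"
    using assms(1) by (simp add: field_simps power2_eq_square)
  also have "\<dots> = (s + q) * (1 + \<delta> * s * q) * (1 + \<delta> * s ^ 2) * \<eta> * N"
    unfolding B C unfolding N_def by algebra
  also have "\<dots> = (s + q) * (relation_scale s q \<delta>) * (s * \<eta> * q) * (s * \<delta> * N)"
    using assms(1-3) by (simp add: power2_eq_square)
  finally show ?thesis using assms(1,3) n by (metis mult_right_cancel mult_eq_0_iff)
qed

lemma scale_combination: "X * A * B + Y * C + Z * \<delta> * N = W * N \<Longrightarrow> K * (X * A * B + Y * C) + K * Z * \<delta> * N = K * W * N" for K :: complex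
proof -
  assume h: "X * A * B + Y * C + Z * \<delta> * N = W * N"
  have "K * (X * A * B + Y * C) + K * Z * \<delta> * N = K * (X * A * B + Y * C + Z * \<delta> * N)"
    by (simp add: algebra_simps)
  then show ?thesis unfolding h by simp
qed

lemma coefficients_shift_relation:
  fixes s q \<delta> \<eta> :: complex
  assumes "s \<noteq> 0" "q \<noteq> 0" "\<delta> \<noteq> 0" "\<eta> \<noteq> 0" "s ^ 2 * \<eta> ^ 2 \<noteq> 1" "s * q * \<eta> + 1 \<noteq> 0" "s * \<eta> + q \<noteq> 0"
   "b = coeff_b s q \<delta> \<eta>"
   "c = coeff_c s q \<delta> \<eta>"
  shows "c * ((s * \<eta> / q ^ 2 + q ^ 2 / (s * \<eta>)) - (s * \<eta> + 1 / (s * \<eta>))) + b * ((s * \<eta> * q ^ 2 + 1 / (s * \<eta> * q ^ 2)) - (s * \<eta> + 1 / (s * \<eta>)))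
     + (s + 1 / s - (s * q ^ 2 + 1 / (s * q ^ 2))) * (s * \<eta> + 1 / (s * \<eta>)) = (1 - s * q) * (relation_scale s q \<delta>) * ((q ^ 2 - 1) / q)"
proof -
  define N where "N = s ^ 2 * \<eta> ^ 2 - 1"
  have n: "N \<noteq> 0" using assms by (simp add: N_def)
  have B: "b * (s * \<delta> * N * (s * q * \<eta> + 1)) = (\<eta> - \<delta>) * (s ^ 2 * \<eta> - 1) * (s ^ 3 * \<delta> * q * \<eta> - 1)"
    unfolding assms(8) using assms(1-7) n by (simp add: N_def)
  have C: "c * (\<delta> * N * (s * \<eta> + q)) = (\<eta> - 1) * (s ^ 2 * \<delta> * \<eta> - 1) * (\<eta> - s * \<delta> * q)"
    unfolding assms(9) using assms(1-7) n by (simp add: N_def)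
  define K where "K = (q ^ 2 - 1) / (s * q ^ 2 * \<eta>)"
  have e1: "(s * \<eta> / q ^ 2 + q ^ 2 / (s * \<eta>)) - (s * \<eta> + 1 / (s * \<eta>)) = K * ((q + s * \<eta>) * (q - s * \<eta>))"
    unfolding K_def using assms(1-4) by (simp add: field_simps power2_eq_square)
  have e2: "(s * \<eta> * q ^ 2 + 1 / (s * \<eta> * q ^ 2)) - (s * \<eta> + 1 / (s * \<eta>)) = K * ((s * q * \<eta> + 1) * (s * q * \<eta> - 1))"
    unfolding K_def using assms(1-4) by (simp add: field_simps power2_eq_square)
  have e3: "(s + 1 / s - (s * q ^ 2 + 1 / (s * q ^ 2))) * (s * \<eta> + 1 / (s * \<eta>)) * s = K * ((1 - s ^ 2 * q ^ 2) * (s ^ 2 * \<eta> ^ 2 + 1))"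
    unfolding K_def using assms(1-4) by (simp add: field_simps power2_eq_square)
  have e4: "(1 - s * q) * (relation_scale s q \<delta>) * ((q ^ 2 - 1) / q) * s * \<delta>
     = K * ((1 - s * q) * (1 + \<delta> * s * q) * (1 + \<delta> * s ^ 2) * \<eta>)"
    unfolding K_def using assms(1-4) by (simp add: power2_eq_square)
  have "(c * (K * ((q + s * \<eta>) * (q - s * \<eta>))) + b * (K * ((s * q * \<eta> + 1) * (s * q * \<eta> - 1)))
     + (s + 1 / s - (s * q ^ 2 + 1 / (s * q ^ 2))) * (s * \<eta> + 1 / (s * \<eta>))) * (s * \<delta> * N)
    = K * ((c * (\<delta> * N * (s * \<eta> + q))) * (q - s * \<eta>) * s + (b * (s * \<delta> * N * (s * q * \<eta> + 1))) * (s * q * \<eta> - 1))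
     + ((s + 1 / s - (s * q ^ 2 + 1 / (s * q ^ 2))) * (s * \<eta> + 1 / (s * \<eta>)) * s) * \<delta> * N"
    by (simp add: algebra_simps)
  also have "\<dots> = K * ((1 - s * q) * (1 + \<delta> * s * q) * (1 + \<delta> * s ^ 2) * \<eta>) * N"
  proof -
    have "(\<eta> - 1) * (s ^ 2 * \<delta> * \<eta> - 1) * (\<eta> - s * \<delta> * q) * (q - s * \<eta>) * s
      + (\<eta> - \<delta>) * (s ^ 2 * \<eta> - 1) * (s ^ 3 * \<delta> * q * \<eta> - 1) * (s * q * \<eta> - 1)
      + (1 - s ^ 2 * q ^ 2) * (s ^ 2 * \<eta> ^ 2 + 1) * \<delta> * N
      = (1 - s * q) * (1 + \<delta> * s * q) * (1 + \<delta> * s ^ 2) * \<eta> * N"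
      unfolding N_def by algebra
    then show ?thesis unfolding B C e3 by (rule scale_combination)
  qed
  also have "\<dots> = ((1 - s * q) * (relation_scale s q \<delta>) * ((q ^ 2 - 1) / q)) * (s * \<delta> * N)"
    unfolding e4[symmetric] by (simp add: algebra_simps)
  finally show ?thesis unfolding e1 e2 using assms(1,3) n by (metis mult_right_cancel mult_eq_0_iff)
qed

definition aw_node :: "complex \<Rightarrow> complex \<Rightarrow> nat \<Rightarrow> complex"
  where "aw_node s q i = s * q ^ (2 * i)"

definition aw_eig :: "complex \<Rightarrow> complex \<Rightarrow> nat \<Rightarrow> complex"
  where "aw_eig s q i = aw_node s q i + 1 / aw_node s q i"

text \<open>With \<open>a\<^sub>i = \<theta>\<^sub>0 - b\<^sub>i - c\<^sub>i\<close>, the coefficients \<open>c\<^sub>i\<close>, \<open>a\<^sub>i\<close>, \<open>b\<^sub>i\<close> are those of a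
  tridiagonal operator with eigenvector \<open>1\<close> for the eigenvalue \<open>\<theta>\<^sub>0\<close>. The second relation says
  that this operator maps \<open>\<theta>\<close> to \<open>\<theta>\<^sub>1 \<theta> + const\<close>, which is the first step of a recursion for an
  eigenfunction; the first relation makes \<open>a\<^sub>i\<close> an explicit rational function of \<open>x\<^sub>i\<close>.\<close>

locale askey_wilson_sequence =
  fixes s q \<omega> :: complex and d :: nat and b c :: "nat \<Rightarrow> complex"
  assumes s: "s \<noteq> 0" and q: "q \<noteq> 0" and q4: "q ^ 4 \<noteq> 1"
    and c_0: "c 0 = 0" and b_d: "b d = 0"
    and node_nz: "\<And>i. i < d \<Longrightarrow> aw_node s q i * q + 1 \<noteq> 0"
    and sum_rule: "\<And>i. i \<le> d \<Longrightarrow> (aw_eig s q 0 - b i - c i)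
        * ((aw_node s q i + q) * (aw_node s q i * q + 1)) = (s + q) * \<omega> * (aw_node s q i * q)"
    and shift_relation: "\<And>i. i \<le> d \<Longrightarrow> c i * (aw_eig s q (i - 1) - aw_eig s q i)
        + b i * (aw_eig s q (i + 1) - aw_eig s q i) + (aw_eig s q 0 - aw_eig s q 1) * aw_eig s q i
        = (1 - s * q) * \<omega> * (q - 1 / q)"
begin

abbreviation "x \<equiv> aw_node s q"
abbreviation "\<theta> \<equiv> aw_eig s q"
definition "a i = \<theta> 0 - b i - c i"
lemmas sum_relation = sum_rule[folded a_def]
lemmas x_def = aw_node_def[of s q]
lemmas \<theta>_def = aw_eig_def[of s q]

definition "k = q ^ 2 - 1 / q ^ 2"
definition "g = (q - 1 / q) * (s + q) * \<omega>"
definition "\<xi> = (1 - s * q) * \<omega> * (q - 1 / q)"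
text \<open>Here \<open>opX\<close> is the tridiagonal operator itself and \<open>opZ\<close> is its conjugate by a diagonal
  operator with entries \<open>\<tau>\<^sub>i\<close>, where \<open>\<tau>\<^sub>i = - x\<^sub>i q \<tau>\<^sub>i\<^sub>+\<^sub>1\<close>. The truncated index \<open>i - 1\<close> at \<open>i = 0\<close> is
  harmless because \<open>c\<^sub>0 = 0\<close>.\<close>

definition opX :: "(nat \<Rightarrow> complex) \<Rightarrow> nat \<Rightarrow> complex"
  where "opX f i = c i * f (i - 1) + a i * f i + b i * f (i + 1)"
definition opZ :: "(nat \<Rightarrow> complex) \<Rightarrow> nat \<Rightarrow> complex"
  where "opZ f i = c i * (- (x (i - 1) * q)) * f (i - 1) + a i * f i + b i * (- 1 / (x i * q)) * f (i + 1)"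

lemma x_neq0: "x i \<noteq> 0" using s q by (simp add: x_def)
lemma x_Suc: "x (Suc i) = x i * q ^ 2" by (simp add: x_def power_add power2_eq_square)
lemma k_neq0: "k \<noteq> 0" using q4 q by (simp add: k_def field_simps)

lemma opX_cong: "(\<And>i. i \<le> d \<Longrightarrow> f i = f' i) \<Longrightarrow> i \<le> d \<Longrightarrow> opX f i = opX f' i"
  unfolding opX_def using b_d by (cases "i = d") auto
lemma opZ_cong: "(\<And>i. i \<le> d \<Longrightarrow> f i = f' i) \<Longrightarrow> i \<le> d \<Longrightarrow> opZ f i = opZ f' i"
  unfolding opZ_def using b_d by (cases "i = d") auto

lemma theta_Suc: "q * \<theta> (Suc i) - \<theta> i / q = k * (x i * q)"  "q * \<theta> i - \<theta> (Suc i) / q = k / (x i * q)"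
  using q x_neq0[of i] by (simp_all add: \<theta>_def x_Suc k_def field_simps power2_eq_square)

lemma a_diag: "i \<le> d \<Longrightarrow> ((q - 1 / q) * \<theta> i + k) * a i = g"
proof -
  assume i: "i \<le> d"
  have "((q - 1 / q) * \<theta> i + k) * (x i * q) = (q - 1 / q) * ((x i + q) * (x i * q + 1))"
    using q x_neq0[of i] by (simp add: \<theta>_def k_def field_simps power2_eq_square)
  then have "((q - 1 / q) * \<theta> i + k) * a i * (x i * q) = (q - 1 / q) * (a i * ((x i + q) * (x i * q + 1)))"
    by (metis mult.commute mult.left_commute)
  also have "\<dots> = g * (x i * q)" unfolding sum_relation[OF i] g_def by (simp only: mult.assoc)
  finally show ?thesis using q x_neq0[of i] by (metis mult_eq_0_iff mult_right_cancel)
qed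

text \<open>The off-diagonal coefficients cancel because \<open>q \<theta>\<^sub>i\<^sub>+\<^sub>1 - q\<^sup>-\<^sup>1 \<theta>\<^sub>i\<close> is a multiple of \<open>x\<^sub>i\<close>, and the diagonal
  is the relation for \<open>a\<^sub>i\<close>.\<close>

lemma askey_wilson_first:
  assumes i: "i \<le> d"
  shows "q * (\<theta> i * opX f i) - 1 / q * opX (\<lambda>i. \<theta> i * f i) i + k * opZ f i = g * f i"
proof -
  have cc: "c i * (q * \<theta> i - 1 / q * \<theta> (i - 1) - k * (x (i - 1) * q)) = 0"
    using c_0 theta_Suc(1)[of "i - 1"] by (cases i) auto
  have bb: "q * \<theta> i - 1 / q * \<theta> (i + 1) + k * (- 1 / (x i * q)) = 0"
    using theta_Suc(2)[of i] by simp
  have "q * (\<theta> i * opX f i) - 1 / q * opX (\<lambda>i. \<theta> i * f i) i + k * opZ f i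
    = (c i * (q * \<theta> i - 1 / q * \<theta> (i - 1) - k * (x (i - 1) * q))) * f (i - 1)
      + (((q - 1 / q) * \<theta> i + k) * a i) * f i
      + b i * (q * \<theta> i - 1 / q * \<theta> (i + 1) + k * (- 1 / (x i * q))) * f (i + 1)"
    unfolding opX_def opZ_def by (simp only: ring_distribs) (simp add: mult_ac)
  then show ?thesis unfolding cc bb a_diag[OF i] by simp
qed

lemma a_adj: "i < d \<Longrightarrow> (q + x i) * a i = (q ^ 2 * x i + 1 / q) * a (Suc i)"
proof -
  assume i: "i < d"
  have nz: "x i * q + 1 \<noteq> 0" using node_nz[OF i] by (simp add: x_def)
  have "(q + x i) * a i * (x i * q + 1) = (s + q) * \<omega> * (x i * q)"
    using sum_relation[of i] i by (simp add: ac_simps)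
  moreover have "(q ^ 2 * x i + 1 / q) * a (Suc i) * (x i * q + 1) = (s + q) * \<omega> * (x i * q)"
  proof -
    have e: "(q ^ 2 * x i + 1 / q) * (x i * q + 1) * q ^ 2 = (x (Suc i) + q) * (x (Suc i) * q + 1)"
      using q by (simp add: x_Suc field_simps power2_eq_square)
    have "(q ^ 2 * x i + 1 / q) * a (Suc i) * (x i * q + 1) * q ^ 2
        = a (Suc i) * ((q ^ 2 * x i + 1 / q) * (x i * q + 1) * q ^ 2)"
      by (simp only: mult_ac)
    also have "\<dots> = (s + q) * \<omega> * (x (Suc i) * q)"
      unfolding e using sum_relation[of "Suc i"] i by simp
    also have "\<dots> = (s + q) * \<omega> * (x i * q) * q ^ 2" by (simp add: x_Suc)
    finally show ?thesis using q by simp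
  qed
  ultimately show ?thesis using nz by (metis mult_right_cancel)
qed

definition "diagonal_entry i = q * (c i * b (i - 1) * (- 1 / (x (i - 1) * q)) + a i ^ 2 + b i * c (i + 1) * (- (x i * q)))
   - 1 / q * (c i * (- (x (i - 1) * q)) * b (i - 1) + a i ^ 2 + b i * (- 1 / (x i * q)) * c (i + 1))"

text \<open>The operator \<open>q X Z - q\<^sup>-\<^sup>1 Z X\<close> has five diagonals. The outer two vanish by the ratio of
  consecutive \<open>x\<^sub>i\<close>, the adjacent ones by the relation between consecutive \<open>a\<^sub>i\<close>.\<close>

lemma second_relation_is_diagonal:
  assumes i: "i \<le> d"
  shows "q * opX (opZ f) i - 1 / q * opZ (opX f) i = diagonal_entry i * f i"
proof -
  have c2: "c i * c (i - 1) * (q * (- (x (i - 1 - 1) * q)) + 1 / q * (x (i - 1) * q)) = 0"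
    using c_0 q by (cases i; cases "i - 1") (auto simp: x_Suc power2_eq_square)
  have c1: "c i * ((q + x (i - 1)) * a (i - 1) - (q ^ 2 * x (i - 1) + 1 / q) * a i) = 0"
    using c_0 a_adj[of "i - 1"] i by (cases i) auto
  have b1: "b i * ((q + x i) * a i - (q ^ 2 * x i + 1 / q) * a (i + 1)) = 0"
    using b_d a_adj[of i] i by (cases "i = d") auto
  have b2: "q * (- 1 / (x (i + 1) * q)) + 1 / q * (1 / (x i * q)) = 0"
    using q x_neq0[of i] by (simp add: x_Suc field_simps power2_eq_square)
  have cs: "c i * opZ f (i - 1) = c i * (c (i - 1) * (- (x (i - 1 - 1) * q)) * f (i - 1 - 1)
     + a (i - 1) * f (i - 1) + b (i - 1) * (- 1 / (x (i - 1) * q)) * f i)"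
     "c i * opX f (i - 1) = c i * (c (i - 1) * f (i - 1 - 1) + a (i - 1) * f (i - 1) + b (i - 1) * f i)"
    using c_0 by (cases i; simp add: opZ_def opX_def)+
  have "q * opX (opZ f) i - 1 / q * opZ (opX f) i
    = (c i * c (i - 1) * (q * (- (x (i - 1 - 1) * q)) + 1 / q * (x (i - 1) * q))) * f (i - 1 - 1)
    + (c i * ((q + x (i - 1)) * a (i - 1) - (q ^ 2 * x (i - 1) + 1 / q) * a i)) * f (i - 1)
    + diagonal_entry i * f i
    + (b i * ((q + x i) * a i - (q ^ 2 * x i + 1 / q) * a (i + 1))) * (- 1 / (x i * q)) * f (i + 1)
    + b i * b (i + 1) * (q * (- 1 / (x (i + 1) * q)) + 1 / q * (1 / (x i * q))) * f (i + 2)"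
  proof -
    have e1: "opX (opZ f) i = c i * opZ f (i - 1) + a i * opZ f i + b i * opZ f (i + 1)"
      by (simp add: opX_def)
    have e2: "opZ (opX f) i = (- (x (i - 1) * q)) * (c i * opX f (i - 1)) + a i * opX f i + b i * (- 1 / (x i * q)) * opX f (i + 1)"
      by (simp add: opZ_def)
    define w w0 w2 v where "w = - 1 / (x i * q)" and "w0 = - 1 / (x (i - 1) * q)"
      and "w2 = - 1 / (x (i + 1) * q)" and "v = 1 / q"
    have "q * (c i * (c (i - 1) * (- (x (i - 1 - 1) * q)) * f (i - 1 - 1)
           + a (i - 1) * f (i - 1) + b (i - 1) * w0 * f i)
         + a i * (c i * (- (x (i - 1) * q)) * f (i - 1) + a i * f i + b i * w * f (i + 1))
         + b i * (c (i + 1) * (- (x i * q)) * f i + a (i + 1) * f (i + 1) + b (i + 1) * w2 * f (i + 2)))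
       - v * ((- (x (i - 1) * q)) * (c i * (c (i - 1) * f (i - 1 - 1) + a (i - 1) * f (i - 1) + b (i - 1) * f i))
         + a i * (c i * f (i - 1) + a i * f i + b i * f (i + 1))
         + b i * w * (c (i + 1) * f i + a (i + 1) * f (i + 1) + b (i + 1) * f (i + 2)))
     = (c i * c (i - 1) * (q * (- (x (i - 1 - 1) * q)) + v * (x (i - 1) * q))) * f (i - 1 - 1)
      + (c i * (q * a (i - 1) - q * (x (i - 1) * q) * a i + v * (x (i - 1) * q) * a (i - 1) - v * a i)) * f (i - 1)
      + (q * (c i * b (i - 1) * w0 + a i ^ 2 + b i * c (i + 1) * (- (x i * q)))
        - v * (c i * (- (x (i - 1) * q)) * b (i - 1) + a i ^ 2 + b i * w * c (i + 1))) * f i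
      + (b i * (q * w * a i + q * a (i + 1) - v * a i - v * w * a (i + 1))) * f (i + 1)
      + b i * b (i + 1) * (q * w2 - v * w) * f (i + 2)"
      by (simp add: algebra_simps power2_eq_square)
    moreover have "q * a (i - 1) - q * (x (i - 1) * q) * a i + v * (x (i - 1) * q) * a (i - 1) - v * a i
      = (q + x (i - 1)) * a (i - 1) - (q ^ 2 * x (i - 1) + 1 / q) * a i"
      using q by (simp add: v_def field_simps power2_eq_square)
    moreover have "q * w * a i + q * a (i + 1) - v * a i - v * w * a (i + 1)
      = ((q + x i) * a i - (q ^ 2 * x i + 1 / q) * a (i + 1)) * w"
      using q x_neq0[of i] by (simp add: v_def w_def field_simps power2_eq_square)
    ultimately show ?thesis
      unfolding e1 e2 cs opZ_def[of f i] opX_def[of f i] opZ_def[of f "i + 1"] opX_def[of f "i + 1"] diagonal_entry_def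
      by (simp add: w_def w0_def w2_def v_def mult.assoc)
  qed
  then show ?thesis unfolding c2 c1 b1 b2 by simp
qed

lemma opX_one: "i \<le> d \<Longrightarrow> opX (\<lambda>_. 1) i = \<theta> 0"
  by (simp add: opX_def a_def)

lemma opX_theta: "i \<le> d \<Longrightarrow> opX \<theta> i = \<xi> + \<theta> 1 * \<theta> i"
  using shift_relation[of i] unfolding opX_def a_def \<xi>_def by (simp add: algebra_simps)

lemma opZ_one:
  assumes "i \<le> d" shows "opZ (\<lambda>_. 1) i = (g + \<xi> / q) / k - (q * \<theta> 0 - \<theta> 1 / q) / k * \<theta> i"
proof -
  have "k * opZ (\<lambda>_. 1) i = g - q * \<theta> i * \<theta> 0 + 1 / q * (\<xi> + \<theta> 1 * \<theta> i)"
    using askey_wilson_first[OF assms, of "\<lambda>_. 1"] opX_one[OF assms] opX_theta[OF assms] by (simp add: algebra_simps)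
  then have "opZ (\<lambda>_. 1) i = (g - q * \<theta> i * \<theta> 0 + 1 / q * (\<xi> + \<theta> 1 * \<theta> i)) / k"
    using k_neq0 by (simp add: nonzero_eq_divide_eq mult.commute)
  then show ?thesis by (simp add: diff_divide_distrib add_divide_distrib algebra_simps)
qed

lemma opX_affine: "opX (\<lambda>i. A - B * h i) i = A * opX (\<lambda>_. 1) i - B * opX h i"
  by (simp add: opX_def algebra_simps)

lemma theta_rel:
  "(q * \<theta> 0 - \<theta> 1 / q) * (q * \<theta> 1 - \<theta> 0 / q) = k ^ 2"
  "((q - 1 / q) * \<theta> 0 + k) * \<xi> = g * (\<theta> 0 - \<theta> 1)"
  "(g + \<xi> / q) * \<theta> 0 * (q - 1 / q) - q * \<xi> * (q * \<theta> 0 - \<theta> 1 / q) = g * k"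
proof -
  show "(q * \<theta> 0 - \<theta> 1 / q) * (q * \<theta> 1 - \<theta> 0 / q) = k ^ 2"
    using theta_Suc[of 0] x_neq0[of 0] q by (simp add: power2_eq_square)
  show "((q - 1 / q) * \<theta> 0 + k) * \<xi> = g * (\<theta> 0 - \<theta> 1)"
    using s q by (simp add: k_def \<xi>_def g_def \<theta>_def x_def field_simps power2_eq_square)
  show "(g + \<xi> / q) * \<theta> 0 * (q - 1 / q) - q * \<xi> * (q * \<theta> 0 - \<theta> 1 / q) = g * k"
    using s q by (simp add: k_def \<xi>_def g_def \<theta>_def x_def field_simps power2_eq_square)
qed

text \<open>A diagonal operator is determined by its value at the constant \<open>1\<close>, so no product \<open>b\<^sub>i c\<^sub>i\<^sub>+\<^sub>1\<close> has to be
  computed: \<open>X\<close> and \<open>Z\<close> map \<open>1\<close> and \<open>\<theta>\<close> to affine functions of \<open>\<theta>\<close> as far as needed.\<close>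

lemma askey_wilson_second:
  assumes i: "i \<le> d"
  shows "q * opX (opZ f) i - 1 / q * opZ (opX f) i + k * (\<theta> i * f i) = g * f i"
proof -
  let ?A = "(g + \<xi> / q) / k" and ?B = "(q * \<theta> 0 - \<theta> 1 / q) / k"
  have "opX (opZ (\<lambda>_. 1)) i = opX (\<lambda>i. ?A - ?B * \<theta> i) i"
    by (rule opX_cong[OF opZ_one i])
  also have "\<dots> = ?A * opX (\<lambda>_. 1) i - ?B * opX \<theta> i"
    by (rule opX_affine)
  finally have e1: "opX (opZ (\<lambda>_. 1)) i = ?A * \<theta> 0 - ?B * (\<xi> + \<theta> 1 * \<theta> i)"
    by (simp add: opX_one opX_theta i)
  have "opZ (opX (\<lambda>_. 1)) i = opZ (\<lambda>_. \<theta> 0) i"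
    by (rule opZ_cong[OF opX_one i])
  also have "\<dots> = \<theta> 0 * opZ (\<lambda>_. 1) i" by (simp add: opZ_def algebra_simps)
  finally have e2: "opZ (opX (\<lambda>_. 1)) i = \<theta> 0 * (?A - ?B * \<theta> i)"
    by (simp add: opZ_one i)
  have "diagonal_entry i = q * (?A * \<theta> 0 - ?B * (\<xi> + \<theta> 1 * \<theta> i)) - 1 / q * (\<theta> 0 * (?A - ?B * \<theta> i))"
    using second_relation_is_diagonal[OF i, of "\<lambda>_. 1"] e1 e2 by simp
  also have "\<dots> = (((g + \<xi> / q) * \<theta> 0 * (q - 1 / q) - q * \<xi> * (q * \<theta> 0 - \<theta> 1 / q))
     - (q * \<theta> 0 - \<theta> 1 / q) * (q * \<theta> 1 - \<theta> 0 / q) * \<theta> i) / k"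
    using k_neq0 q by (simp add: field_simps)
  also have "\<dots> = g - k * \<theta> i"
    unfolding theta_rel using k_neq0 by (simp add: field_simps power2_eq_square)
  finally have "diagonal_entry i = g - k * \<theta> i" .
  then have "diagonal_entry i + k * \<theta> i = g" by simp
  then have "diagonal_entry i * f i + k * (\<theta> i * f i) = g * f i"
    by (simp only: flip: distrib_right mult.assoc)
  then show ?thesis by (simp only: second_relation_is_diagonal[OF i])
qed

end

lemma boundary_first:
  fixes s q \<delta> :: complex
  assumes "s \<noteq> 0" "q \<noteq> 0" "\<delta> \<noteq> 0" "s * q + 1 \<noteq> 0"
    "b = coeff_b_first s q \<delta>"
  shows "s + 1 / s - b = (1 + \<delta> * s * q) * (1 + \<delta> * s ^ 2) / (s * \<delta> * (s * q + 1))"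
proof -
  have "(s + 1 / s) * (s * \<delta> * (s * q + 1)) = (s ^ 2 + 1) * \<delta> * (s * q + 1)"
    using assms(1) by (simp add: field_simps power2_eq_square)
  moreover have "b * (s * \<delta> * (s * q + 1)) = (1 - \<delta>) * (s ^ 3 * \<delta> * q - 1)"
    unfolding assms(5) using assms(1-4) by simp
  moreover have "(s ^ 2 + 1) * \<delta> * (s * q + 1) - (1 - \<delta>) * (s ^ 3 * \<delta> * q - 1) = (1 + \<delta> * s * q) * (1 + \<delta> * s ^ 2)"
    by algebra
  ultimately have "(s + 1 / s - b) * (s * \<delta> * (s * q + 1)) = (1 + \<delta> * s * q) * (1 + \<delta> * s ^ 2)"
    by (simp only: left_diff_distrib)
  then show ?thesis using assms(1-4) by (simp add: nonzero_eq_divide_eq)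
qed

lemma boundary_last:
  fixes s q \<delta> :: complex
  assumes "s \<noteq> 0" "q \<noteq> 0" "\<delta> \<noteq> 0" "s * \<delta> + q \<noteq> 0"
    "c = coeff_c_last s q \<delta>"
  shows "(s + 1 / s - c) * (s * (s * \<delta> + q)) = (s + q) * (1 + \<delta> * s ^ 2)"
proof -
  have "(s + 1 / s) * (s * (s * \<delta> + q)) = (s ^ 2 + 1) * (s * \<delta> + q)"
    using assms(1) by (simp add: field_simps power2_eq_square)
  moreover have "c * (s * (s * \<delta> + q)) = s * ((1 - \<delta>) * (s * q - 1))"
    unfolding assms(5) using assms(1-4) by simp
  moreover have "(s ^ 2 + 1) * (s * \<delta> + q) - s * ((1 - \<delta>) * (s * q - 1)) = (s + q) * (1 + \<delta> * s ^ 2)"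
    by algebra
  ultimately show ?thesis
    by (simp only: left_diff_distrib)
qed

text \<open>The three cases are the two boundary indices and the generic ones in between. The condition
  \<open>x\<^sub>i q + 1 \<noteq> 0\<close> for \<open>i < d\<close> also gives \<open>x\<^sub>i + q \<noteq> 0\<close> for \<open>1 \<le> i \<le> d\<close>, since
  \<open>x\<^sub>i = x\<^sub>i\<^sub>-\<^sub>1 q\<^sup>2\<close>.\<close>

lemma explicit_askey_wilson_sequence:
  fixes s q :: complex and d :: nat
  defines "\<delta> \<equiv> q ^ (2 * d)"
  assumes s: "s \<noteq> 0" and q: "q \<noteq> 0" and q4: "q ^ 4 \<noteq> 1" and d: "d \<ge> 1"
    and node_nz: "\<And>i. i < d \<Longrightarrow> s * q ^ (2 * i) * q + 1 \<noteq> 0"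
    and x_sq: "\<And>i. 1 \<le> i \<Longrightarrow> i < d \<Longrightarrow> s ^ 2 * (q ^ (2 * i)) ^ 2 \<noteq> 1"
    and b_0: "b 0 = coeff_b_first s q \<delta>" and b_d: "b d = 0"
    and c_0: "c 0 = 0" and c_d: "c d = coeff_c_last s q \<delta>"
    and b_i: "\<And>i \<eta>. 1 \<le> i \<Longrightarrow> i < d \<Longrightarrow> \<eta> = q ^ (2 * i) \<Longrightarrow>
      b i = coeff_b s q \<delta> \<eta>"
    and c_i: "\<And>i \<eta>. 1 \<le> i \<Longrightarrow> i < d \<Longrightarrow> \<eta> = q ^ (2 * i) \<Longrightarrow>
      c i = coeff_c s q \<delta> \<eta>"
  shows "askey_wilson_sequence s q (relation_scale s q \<delta>) d b c"
proof -
  let ?x = "\<lambda>i. s * q ^ (2 * i)" and ?\<omega> = "relation_scale s q \<delta>"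
  let ?\<theta> = "\<lambda>i. ?x i + 1 / ?x i"
  have \<delta>: "\<delta> \<noteq> 0" using q by (simp add: \<delta>_def)
  have sq1: "s * q + 1 \<noteq> 0" using node_nz[of 0] d by simp
  have xq: "?x i + q \<noteq> 0" if "1 \<le> i" "i \<le> d" for i
  proof
    assume "?x i + q = 0"
    moreover have "?x i + q = (s * q ^ (2 * (i - 1)) * q + 1) * q"
      using that by (cases i) (auto simp: algebra_simps)
    moreover have "i - 1 < d" using that by linarith
    ultimately show False using node_nz[of "i - 1"] q by auto
  qed
  have sdq: "s * \<delta> + q \<noteq> 0" using xq[of d] d by (simp add: \<delta>_def)
  have th_next: "?\<theta> (i + 1) = s * \<eta> * q ^ 2 + 1 / (s * \<eta> * q ^ 2)" if "\<eta> = q ^ (2 * i)" for i \<eta>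
    by (simp add: that power2_eq_square power_add algebra_simps)
  have th_prev: "?\<theta> (i - 1) = s * \<eta> / q ^ 2 + q ^ 2 / (s * \<eta>)" if "\<eta> = q ^ (2 * i)" "1 \<le> i" for i \<eta>
  proof -
    obtain j where "i = Suc j" using \<open>1 \<le> i\<close> by (cases i) auto
    then show ?thesis using that(1) q by (simp add: power2_eq_square)
  qed
  have A: "(?\<theta> 0 - b i - c i) * ((?x i + q) * (?x i * q + 1)) = (s + q) * ?\<omega> * (?x i * q)" if i: "i \<le> d" for i
  proof -
    consider "i = 0" | "i = d" "i \<noteq> 0" | "1 \<le> i" "i < d" using i by linarith
    then show ?thesis
    proof cases
      case 1
      have "(?\<theta> 0 - b 0 - c 0) = (1 + \<delta> * s * q) * (1 + \<delta> * s ^ 2) / (s * \<delta> * (s * q + 1))"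
        using boundary_first[OF s q \<delta> sq1 b_0] c_0 by simp
      then show ?thesis unfolding 1 using s q \<delta> sq1 by (simp add: power2_eq_square)
    next
      case 2
      have e: "(s + 1 / s - c d) * (s * (s * \<delta> + q)) = (s + q) * (1 + \<delta> * s ^ 2)"
        by (rule boundary_last[OF s q \<delta> sdq c_d])
      have w: "?\<omega> * (s ^ 2 * \<delta> * q) = (1 + \<delta> * s * q) * (1 + \<delta> * s ^ 2)"
        using s q \<delta> by simp
      have "(s + 1 / s - c d) * ((s * \<delta> + q) * (s * \<delta> * q + 1)) * s
          = (s + 1 / s - c d) * (s * (s * \<delta> + q)) * (s * \<delta> * q + 1)" by (simp only: mult_ac)
      also have "\<dots> = (s + q) * (?\<omega> * (s ^ 2 * \<delta> * q))"
        unfolding e w by (simp add: algebra_simps)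
      also have "\<dots> = (s + q) * ?\<omega> * (s * \<delta> * q) * s"
        by (simp only: power2_eq_square mult_ac)
      finally have "(s + 1 / s - c d) * ((s * \<delta> + q) * (s * \<delta> * q + 1)) = (s + q) * ?\<omega> * (s * \<delta> * q)"
        using s by simp
      then show ?thesis using 2 b_d by (simp add: \<delta>_def)
    next
      case 3
      then show ?thesis
        using coefficients_sum_relation[OF s q \<delta> x_sq[OF 3] _ _ b_i[OF 3 refl] c_i[OF 3 refl]] node_nz[of i] xq[of i]
        by (simp add: mult_ac)
    qed
  qed
  have B: "c i * (?\<theta> (i - 1) - ?\<theta> i) + b i * (?\<theta> (i + 1) - ?\<theta> i) + (?\<theta> 0 - ?\<theta> 1) * ?\<theta> i
    = (1 - s * q) * ?\<omega> * (q - 1 / q)" if i: "i \<le> d" for i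
  proof -
    have th01: "s + 1 / s - (s * q ^ 2 + 1 / (s * q ^ 2)) = (q - 1 / q) * (1 - s * q) * (s * q + 1) / (s * q)"
      using s q by (simp add: field_simps power2_eq_square)
    consider "i = 0" | "i = d" "i \<noteq> 0" | "1 \<le> i" "i < d" using i by linarith
    then show ?thesis
    proof cases
      case 1
      have "b 0 * (?\<theta> 1 - ?\<theta> 0) + (?\<theta> 0 - ?\<theta> 1) * ?\<theta> 0 = (?\<theta> 0 - ?\<theta> 1) * (?\<theta> 0 - b 0)"
        by (simp add: algebra_simps)
      also have "\<dots> = (q - 1 / q) * (1 - s * q) * (s * q + 1) / (s * q)
          * ((1 + \<delta> * s * q) * (1 + \<delta> * s ^ 2) / (s * \<delta> * (s * q + 1)))"
        using boundary_first[OF s q \<delta> sq1 b_0] th01 by simp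
      also have "\<dots> = (1 - s * q) * ?\<omega> * (q - 1 / q)"
        using s q \<delta> sq1 by (simp add: power2_eq_square mult_ac)
      finally show ?thesis using 1 c_0 by simp
    next
      case 2
      have d1: "?\<theta> (d - 1) - ?\<theta> d = (q - 1 / q) * (q - s * \<delta>) * (s * \<delta> + q) / (s * \<delta> * q)"
        unfolding th_prev[OF refl d] unfolding \<delta>_def using s q by (simp add: field_simps power2_eq_square)
      have cd: "c d * (s * \<delta> + q) = (1 - \<delta>) * (s * q - 1)" unfolding c_d using sdq by simp
      have "(c d * (?\<theta> (d - 1) - ?\<theta> d) + (?\<theta> 0 - ?\<theta> 1) * ?\<theta> d) * (s ^ 2 * \<delta> * q)
        = (q - 1 / q) * ((q - s * \<delta>) * (c d * (s * \<delta> + q)) * s + (1 - s * q) * (s * q + 1) * (s ^ 2 * \<delta> ^ 2 + 1))"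
      proof -
        have T1: "(?\<theta> (d - 1) - ?\<theta> d) * (s * \<delta> * q) = (q - 1 / q) * (q - s * \<delta>) * (s * \<delta> + q)"
          unfolding d1 using s q \<delta> by simp
        have T0: "(?\<theta> 0 - ?\<theta> 1) * (s * q) = (q - 1 / q) * (1 - s * q) * (s * q + 1)"
          using th01 s q by simp
        have T: "?\<theta> d * (s * \<delta>) = s ^ 2 * \<delta> ^ 2 + 1"
          using s q unfolding \<delta>_def by (simp add: field_simps power2_eq_square)
        have "(C * T1 + T0 * T) * (s ^ 2 * \<delta> * q) = C * (T1 * (s * \<delta> * q)) * s + (T0 * (s * q)) * (T * (s * \<delta>))" for C T1 T0 T
          by (simp add: algebra_simps power2_eq_square)
        moreover have "C * (K * A * B) * s + (K * A' * B') * T = K * (A * (C * B) * s + A' * B' * T)" for C K A B A' B' T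
          by (simp add: algebra_simps)
        ultimately show ?thesis by (simp only: T1 T0 T)
      qed
      also have "\<dots> = (q - 1 / q) * ((1 - s * q) * (1 + \<delta> * s * q) * (1 + \<delta> * s ^ 2))"
        unfolding cd by (rule arg_cong[where f = "\<lambda>z. (q - 1 / q) * z"]) algebra
      also have "\<dots> = (1 - s * q) * ?\<omega> * (q - 1 / q) * (s ^ 2 * \<delta> * q)"
        using s q \<delta> by simp
      finally have "c d * (?\<theta> (d - 1) - ?\<theta> d) + (?\<theta> 0 - ?\<theta> 1) * ?\<theta> d = (1 - s * q) * ?\<omega> * (q - 1 / q)"
        by (rule mult_right_cancel[THEN iffD1, rotated]) (use s q \<delta> in simp)
      then show ?thesis using 2 b_d by simp
    next
      case 3
      have nz: "q ^ (2 * i) \<noteq> 0" using q by simp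
      have "s + 1 / s - (s * q ^ 2 + 1 / (s * q ^ 2)) = ?\<theta> 0 - ?\<theta> 1" by simp
      moreover have "(q ^ 2 - 1) / q = q - 1 / q" using q by (simp add: field_simps power2_eq_square)
      ultimately show ?thesis
        using coefficients_shift_relation[OF s q \<delta> nz x_sq[OF 3] _ _ b_i[OF 3 refl] c_i[OF 3 refl]] node_nz[of i] xq[of i] 3
        unfolding th_next[OF refl] th_prev[OF refl 3(1)]
        by (simp add: mult_ac)
    qed
  qed
  show ?thesis
    by unfold_locales (use s q q4 c_0 b_d node_nz A B in \<open>auto simp: aw_eig_def aw_node_def\<close>)
qed

section \<open>The intertwining relation on one module\<close>

text \<open>The function \<open>z + 1/z\<close> takes equal values only at \<open>z\<close> and \<open>1/z\<close>.\<close>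

lemma eigenvalue_inj:
  fixes t :: "nat \<Rightarrow> complex"
  assumes theta: "\<And>i. i \<le> D \<Longrightarrow> \<theta> i = \<alpha> * (t i + 1 / t i) + \<beta>" and "\<alpha> \<noteq> 0" "\<And>i. t i \<noteq> 0"
    and t: "\<And>i j. i \<le> D \<Longrightarrow> j \<le> D \<Longrightarrow> i \<noteq> j \<Longrightarrow> t i \<noteq> t j"
      "\<And>i j. i \<le> D \<Longrightarrow> j \<le> D \<Longrightarrow> i \<noteq> j \<Longrightarrow> t i * t j \<noteq> 1"
  shows "inj_on \<theta> {..D}"
proof (rule inj_onI)
  fix i j assume ij: "i \<in> {..D}" "j \<in> {..D}" "\<theta> i = \<theta> j"
  then have "t i + 1 / t i = t j + 1 / t j" using theta assms(2) by simp
  moreover have "(t i + 1 / t i - (t j + 1 / t j)) * (t i * t j) = (t i - t j) * (t i * t j - 1)"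
    using assms(3)[of i] assms(3)[of j] by (simp add: field_simps)
  ultimately have "t i = t j \<or> t i * t j = 1" by simp
  then show "i = j" using t[of i j] ij by auto
qed

text \<open>The vectors \<open>u\<^sub>i\<close> span the module, and their sum \<open>u\<^sub>0 + \<cdots> + u\<^sub>d\<close> spans its component in \<open>E\<^sub>r\<close>.
  A function \<open>f\<close> stands for the vector \<open>\<Sum>\<^sub>i f\<^sub>i u\<^sub>i\<close>; the action of \<open>X\<close> on it is the operator of
  the coefficient sequence.\<close>

locale askey_wilson_module = askey_wilson_sequence s q \<omega> d b c
  for s q \<omega> :: complex and d :: nat and b c :: "nat \<Rightarrow> complex" +
  fixes D r :: nat and E F :: "nat \<Rightarrow> complex^'x::finite^'x" and t \<tau> th :: "nat \<Rightarrow> complex"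
    and u :: "nat \<Rightarrow> complex^'x"
  assumes E: "idempotent_resolution D E" and F: "idempotent_resolution D F"
    and t_0: "t r = s" and t_Suc: "\<And>i. t (Suc i) = t i * q ^ 2"
    and t_nz: "\<And>i. t i \<noteq> 0"
    and t_inj: "\<And>i j. i \<le> D \<Longrightarrow> j \<le> D \<Longrightarrow> i \<noteq> j \<Longrightarrow> t i \<noteq> t j"
    and t_prod: "\<And>i j. i \<le> D \<Longrightarrow> j \<le> D \<Longrightarrow> i \<noteq> j \<Longrightarrow> t i * t j \<noteq> 1"
    and th: "\<And>i. th i = t i + 1 / t i"
    and tau_nz: "\<And>i. i \<le> D \<Longrightarrow> \<tau> i \<noteq> 0"
    and tau_Suc: "\<And>i. i < D \<Longrightarrow> \<tau> (Suc i) * (t i * q) = - \<tau> i"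
    and d_pos: "1 \<le> d" and rd: "r + d \<le> D"
    and F_u: "\<And>i j. i \<le> d \<Longrightarrow> j \<le> D \<Longrightarrow> F j *v u i = (if j = r + i then u i else 0)"
    and X_u: "\<And>f. spectral_sum D E th *v (\<Sum>i\<le>d. f i *s u i)
        = (\<Sum>i\<le>d. (c i * f (i - 1) + (s + 1 / s - b i - c i) * f i + b i * f (i + 1)) *s u i)"
    and E_r: "\<And>f. \<exists>m. E r *v (\<Sum>i\<le>d. f i *s u i) = m *s (\<Sum>i\<le>d. 1 *s u i)"
    and tridiagonal: "\<And>i j v. i \<le> D \<Longrightarrow> j \<le> D \<Longrightarrow> j + 1 < i \<or> i + 1 < j \<Longrightarrow>
        E i *v (spectral_sum D F th *v (E j *v v)) = 0"
    and E_low: "\<And>i j. i \<le> d \<Longrightarrow> j < r \<Longrightarrow> E j *v u i = 0"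
begin

abbreviation "X \<equiv> spectral_sum D E th"
abbreviation "Y \<equiv> spectral_sum D F th"
abbreviation "T \<equiv> spectral_sum D E \<tau>"
abbreviation "Ts \<equiv> spectral_sum D F \<tau>"
abbreviation "Ti \<equiv> spectral_sum D F (\<lambda>i. 1 / \<tau> i)"

definition "lin f = (\<Sum>i\<le>d. f i *s u i)"
definition "U = range lin"
definition "conjX v = Ti *v (X *v (Ts *v v))"

lemma t_r: "t (r + i) = s * q ^ (2 * i)"
  by (induction i) (simp_all add: t_0 t_Suc power2_eq_square)

lemma th_r: "th (r + i) = s * q ^ (2 * i) + 1 / (s * q ^ (2 * i))"
  by (simp add: th t_r)

lemma th_inj: "inj_on th {..D}"
  by (rule eigenvalue_inj[of D th 1 t 0]) (use th t_nz t_inj t_prod in auto)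

lemma lin_add: "lin f + lin h = lin (\<lambda>i. f i + h i)"
  by (simp add: lin_def sum.distrib vec.scale_left_distrib)
lemma lin_diff: "lin f - lin h = lin (\<lambda>i. f i - h i)"
  by (simp add: lin_def sum_subtractf vec.scale_left_diff_distrib)
lemma lin_scale: "m *s lin f = lin (\<lambda>i. m * f i)"
  by (simp add: lin_def vec.scale_sum_right)
lemma lin_cong: "(\<And>i. i \<le> d \<Longrightarrow> f i = h i) \<Longrightarrow> lin f = lin h"
  by (simp add: lin_def)

lemma subspace_U: "vec.subspace U"
  unfolding vec.subspace_def U_def
proof (intro conjI ballI allI)
  show "0 \<in> range lin" by (rule image_eqI[of _ _ "\<lambda>_. 0"]) (simp_all add: lin_def)
qed (auto simp: lin_add lin_scale)

lemma F_lin: "j \<le> D \<Longrightarrow> F j *v lin f = (if r \<le> j \<and> j \<le> r + d then f (j - r) *s u (j - r) else 0)"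
proof -
  assume j: "j \<le> D"
  have "F j *v lin f = (\<Sum>i\<le>d. if j = r + i then f i *s u i else 0)"
    unfolding lin_def matrix_vec_sum matrix_vec_scale using j
    by (intro sum.cong refl) (simp add: F_u)
  also have "\<dots> = (if r \<le> j \<and> j \<le> r + d then f (j - r) *s u (j - r) else 0)"
  proof (cases "r \<le> j \<and> j \<le> r + d")
    case True
    then have "(\<Sum>i\<le>d. if j = r + i then f i *s u i else 0) = (\<Sum>i\<in>{j - r}. f i *s u i)"
      by (intro sum.mono_neutral_cong_right) auto
    then show ?thesis using True by simp
  qed (auto intro!: sum.neutral)
  finally show ?thesis .
qed

lemma spectral_F_lin: "spectral_sum D F \<phi> *v lin f = lin (\<lambda>i. \<phi> (r + i) * f i)"
proof (rule resolution_ext[OF F])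
  fix j assume "j \<le> D"
  then show "F j *v (spectral_sum D F \<phi> *v lin f) = F j *v lin (\<lambda>i. \<phi> (r + i) * f i)"
    by (simp add: resolution_spectral[OF F] F_lin)
qed

lemma Y_lin: "Y *v lin f = lin (\<lambda>i. \<theta> i * f i)"
  by (simp add: spectral_F_lin th_r \<theta>_def x_def)

lemma X_lin: "X *v lin f = lin (opX f)"
  using X_u[of f] by (simp add: lin_def opX_def a_def \<theta>_def x_def)

text \<open>Along the module the weights \<open>\<tau>\<^sub>r\<^sub>+\<^sub>i\<close> have exactly the ratios that define \<open>opZ\<close>, so conjugating
  \<open>X\<close> by \<open>T\<^sup>*\<close> realizes \<open>opZ\<close>.\<close>

lemma tau_r: "i < d \<Longrightarrow> \<tau> (r + i) = - (x i * q) * \<tau> (r + Suc i)"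
  using tau_Suc[of "r + i"] rd by (simp add: t_r x_def mult_ac)

lemma conjX_lin: "conjX (lin f) = lin (opZ f)"
proof -
  have "conjX (lin f) = lin (\<lambda>i. 1 / \<tau> (r + i) * opX (\<lambda>i. \<tau> (r + i) * f i) i)"
    by (simp add: conjX_def spectral_F_lin X_lin)
  also have "\<dots> = lin (opZ f)"
  proof (rule lin_cong)
    fix i assume i: "i \<le> d"
    have nz: "\<tau> (r + i) \<noteq> 0" using tau_nz rd i by simp
    have "c i * (\<tau> (r + (i - 1)) * f (i - 1)) = \<tau> (r + i) * (c i * (- (x (i - 1) * q)) * f (i - 1))"
    proof (cases i)
      case (Suc j)
      then show ?thesis using tau_r[of j] i by simp
    qed (simp add: c_0)
    moreover have "b i * (\<tau> (r + (i + 1)) * f (i + 1)) = \<tau> (r + i) * (b i * (- 1 / (x i * q)) * f (i + 1))"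
    proof (cases "i = d")
      case False
      then show ?thesis using tau_r[of i] i x_neq0[of i] q by simp
    qed (simp add: b_d)
    ultimately have "opX (\<lambda>i. \<tau> (r + i) * f i) i = \<tau> (r + i) * opZ f i"
      unfolding opX_def opZ_def by (simp add: algebra_simps)
    then show "1 / \<tau> (r + i) * opX (\<lambda>i. \<tau> (r + i) * f i) i = opZ f i" using nz by simp
  qed
  finally show ?thesis .
qed

lemma U_closed: "v \<in> U \<Longrightarrow> X *v v \<in> U" "v \<in> U \<Longrightarrow> Y *v v \<in> U" "v \<in> U \<Longrightarrow> conjX v \<in> U"
  by (auto simp: U_def X_lin Y_lin conjX_lin)

lemma E_U: "j \<le> D \<Longrightarrow> v \<in> U \<Longrightarrow> E j *v v \<in> U"
  using resolution_invariant[OF E th_inj subspace_U] U_closed(1) by blast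

lemma first_relation:
  assumes "v \<in> U"
  shows "q *s (Y *v (X *v v)) - (1 / q) *s (X *v (Y *v v)) + k *s conjX v = g *s v"
proof -
  obtain f where v: "v = lin f" using assms by (auto simp: U_def)
  show ?thesis unfolding v X_lin Y_lin conjX_lin lin_scale lin_diff lin_add
    by (rule lin_cong) (rule askey_wilson_first)
qed

lemma second_relation:
  assumes "v \<in> U"
  shows "q *s (X *v conjX v) - (1 / q) *s conjX (X *v v) + k *s (Y *v v) = g *s v"
proof -
  obtain f where v: "v = lin f" using assms by (auto simp: U_def)
  show ?thesis unfolding v X_lin Y_lin conjX_lin lin_scale lin_diff lin_add
    by (rule lin_cong) (rule askey_wilson_second)
qed

lemma conjX_scale: "conjX (m *s v) = m *s conjX v"
  by (simp add: conjX_def matrix_vec_scale)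
lemma conjX_sum: "conjX (\<Sum>i\<in>I. h i) = (\<Sum>i\<in>I. conjX (h i))"
  by (simp add: conjX_def matrix_vec_sum)

text \<open>Between \<open>E\<^sub>i\<close> and \<open>E\<^sub>j\<close> the matrix \<open>X\<close> is a scalar on either side, which turns the
  Askey-Wilson relations into linear equations between the blocks of \<open>Y\<close> and of \<open>Z\<close>.\<close>

lemma first_relation_block:
  assumes "i \<le> D" "j \<le> D" "w \<in> U"
  shows "(q * th j - th i / q) *s (E i *v (Y *v (E j *v w))) + k *s (E i *v conjX (E j *v w))
    = g *s (E i *v (E j *v w))"
proof -
  have "E i *v (q *s (Y *v (X *v (E j *v w))) - (1 / q) *s (X *v (Y *v (E j *v w))) + k *s conjX (E j *v w))
     = E i *v (g *s (E j *v w))"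
    by (simp only: first_relation[OF E_U[OF assms(2,3)]])
  then show ?thesis
    by (simp add: matrix_vector_right_distrib matrix_vector_mult_diff_distrib matrix_vec_scale
      spectral_resolution[OF E assms(2)] resolution_spectral[OF E assms(1)] vec.scale_left_diff_distrib)
qed

lemma second_relation_block:
  assumes "i \<le> D" "j \<le> D" "w \<in> U"
  shows "(q * th i - th j / q) *s (E i *v conjX (E j *v w)) + k *s (E i *v (Y *v (E j *v w)))
    = g *s (E i *v (E j *v w))"
proof -
  have "E i *v (q *s (X *v conjX (E j *v w)) - (1 / q) *s conjX (X *v (E j *v w)) + k *s (Y *v (E j *v w)))
     = E i *v (g *s (E j *v w))"
    by (simp only: second_relation[OF E_U[OF assms(2,3)]])
  then show ?thesis
    by (simp add: matrix_vector_right_distrib matrix_vector_mult_diff_distrib matrix_vec_scale conjX_scale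
      spectral_resolution[OF E assms(2)] resolution_spectral[OF E assms(1)] vec.scale_left_diff_distrib)
qed

lemma th_next: "q * th (Suc i) - th i / q = k * (t i * q)" "q * th i - th (Suc i) / q = k / (t i * q)"
  using q t_nz[of i] by (simp_all add: th t_Suc k_def field_simps power2_eq_square)

text \<open>For \<open>|i - j| = 1\<close> the scalar in the first relation is \<open>k\<close> times the ratio of \<open>\<tau>\<^sub>i\<close>
  and \<open>\<tau>\<^sub>j\<close>, up to sign; for \<open>|i - j| > 1\<close> both blocks vanish.\<close>

lemma off_diagonal:
  assumes ij: "i \<le> D" "j \<le> D" "i \<noteq> j" and w: "w \<in> U"
  shows "\<tau> i *s (E i *v (Y *v (E j *v w))) = \<tau> j *s (E i *v conjX (E j *v w))"
proof -
  let ?y = "E i *v (Y *v (E j *v w))" and ?z = "E i *v conjX (E j *v w)"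
  have b: "(q * th j - th i / q) *s ?y + k *s ?z = 0"
    using first_relation_block[OF ij(1,2) w] ij by (simp add: resolution_idem[OF E])
  have solve: "?z = m *s ?y" if "q * th j - th i / q = - m * k" for m
  proof -
    have "k *s ?z = - ((- m * k) *s ?y)"
      using b unfolding that by (simp only: eq_neg_iff_add_eq_0 add.commute)
    also have "\<dots> = k *s (m *s ?y)" by (simp add: mult.commute)
    finally show ?thesis using k_neq0 by (simp only: vector_mul_lcancel) simp
  qed
  consider "i = Suc j" | "j = Suc i" | "j + 1 < i \<or> i + 1 < j" using ij by linarith
  then show ?thesis
  proof cases
    case 1
    have z: "?z = (- 1 / (t j * q)) *s ?y"
      by (rule solve) (use 1 th_next(2)[of j] in simp)
    have "\<tau> j = - (\<tau> i * (t j * q))" using tau_Suc[of j] 1 ij by simp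
    then have "\<tau> j * (- 1 / (t j * q)) = \<tau> i" using t_nz[of j] q by simp
    then show ?thesis unfolding z by (simp only: vector_smult_assoc)
  next
    case 2
    have z: "?z = (- (t i * q)) *s ?y"
      by (rule solve) (use 2 th_next(1)[of i] in simp)
    have "\<tau> i = \<tau> j * (- (t i * q))" using tau_Suc[of i] 2 ij by simp
    then show ?thesis unfolding z by (simp only: vector_smult_assoc)
  next
    case 3
    then have y: "?y = 0" using tridiagonal ij by blast
    then have "?z = 0" using b k_neq0 by simp
    then show ?thesis using y by simp
  qed
qed

text \<open>With \<open>m = (q - q\<^sup>-\<^sup>1) \<theta>\<^sub>i\<close>, the relations for the blocks \<open>y\<close> of \<open>Y\<close> and \<open>z\<close> of \<open>Z\<close> read \<open>m y + k z = g\<close>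
  and \<open>m z + k y = g\<close>. Their difference is \<open>(m - k) (y - z) = 0\<close>.\<close>

lemma diagonal:
  assumes i: "i \<le> D" and w: "w \<in> U" and ne: "th i \<noteq> q + 1 / q"
  shows "E i *v (Y *v (E i *v w)) = E i *v conjX (E i *v w)"
proof -
  let ?y = "E i *v (Y *v (E i *v w))" and ?z = "E i *v conjX (E i *v w)"
  let ?m = "q * th i - th i / q"
  have "?m *s ?y + k *s ?z = ?m *s ?z + k *s ?y"
    using first_relation_block[OF i i w] second_relation_block[OF i i w] by simp
  then have "(?m - k) *s (?y - ?z) = 0"
    by (simp add: vec.scale_right_diff_distrib vec.scale_left_diff_distrib algebra_simps)
  moreover have "?m - k = (q - 1 / q) * (th i - (q + 1 / q))"
    using q by (simp add: k_def field_simps power2_eq_square)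
  moreover have "q - 1 / q \<noteq> 0"
    using q4 q by (auto simp: field_simps power2_eq_square eval_nat_numeral)
  ultimately show ?thesis using ne by simp
qed

text \<open>If \<open>t\<^sub>i\<close> is \<open>q\<close> or \<open>q\<^sup>-\<^sup>1\<close>, then its product with the neighbour \<open>t\<^sub>i\<^sub>-\<^sub>1\<close> or \<open>t\<^sub>i\<^sub>+\<^sub>1\<close> is \<open>1\<close>, so
  this neighbour is not among the indices.\<close>

lemma exceptional:
  assumes i: "i \<le> D" and e: "th i = q + 1 / q"
  shows "i = 0 \<or> i = D"
proof (rule ccontr)
  assume "\<not> (i = 0 \<or> i = D)"
  then obtain j where j: "i = Suc j" "Suc i \<le> D" using i by (cases i) auto
  have "(t i - q) * (t i - 1 / q) = (th i - (q + 1 / q)) * t i"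
    using q t_nz[of i] by (simp add: th field_simps)
  then have "t i = q \<or> t i = 1 / q" using e by simp
  then show False
  proof
    assume "t i = q"
    then have "t j * q = 1" using t_Suc[of j] j q by (simp add: power2_eq_square)
    moreover have "t j * t i = (t j * q) * (t j * q)" using t_Suc[of j] j by (simp add: power2_eq_square)
    ultimately have "t j * t i = 1" by simp
    then show False using t_prod[of j i] j by simp
  next
    assume "t i = 1 / q"
    then have "t (Suc i) * t i = 1" using t_Suc[of i] q by (simp add: power2_eq_square)
    then show False using t_prod[of "Suc i" i] j by simp
  qed
qed

definition "u0 = lin (\<lambda>_. 1)"

lemma u0_U: "u0 \<in> U" by (simp add: U_def u0_def)

lemma th_eq_theta: "th (r + i) = \<theta> i"
  by (simp add: th_r \<theta>_def x_def)

lemma X_u0: "X *v u0 = th r *s u0"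
  unfolding u0_def X_lin lin_scale using th_eq_theta[of 0] by (intro lin_cong) (simp add: opX_one)

lemma E_u0: "j \<le> D \<Longrightarrow> E j *v u0 = (if j = r then u0 else 0)"
proof -
  have *: "E j *v u0 = 0" if "j \<le> D" "j \<noteq> r" for j
  proof -
    have "th j *s (E j *v u0) = E j *v (X *v u0)"
      by (simp only: resolution_spectral[OF E that(1)])
    also have "\<dots> = th r *s (E j *v u0)" by (simp only: X_u0 matrix_vec_scale)
    finally have "th j = th r \<or> E j *v u0 = 0" by (simp only: vector_mul_rcancel)
    then show ?thesis using inj_onD[OF th_inj, of j r] that rd by auto
  qed
  have "u0 = (\<Sum>j\<le>D. E j *v u0)" by (simp add: resolution_sum[OF E])
  also have "\<dots> = (\<Sum>j\<le>D. if j = r then E r *v u0 else 0)"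
    using * by (intro sum.cong) auto
  finally have "u0 = E r *v u0" using rd by simp
  then show "j \<le> D \<Longrightarrow> ?thesis" using * by auto
qed

text \<open>The block at \<open>r\<close> is one-dimensional, and \<open>X Y u = \<xi> u + \<theta>\<^sub>1 Y u\<close> yields the \<open>E\<^sub>r\<close>-component
  of \<open>Y u\<close> explicitly. The first Askey-Wilson relation then yields that of \<open>Z u\<close>.\<close>

lemma diagonal_first:
  assumes w: "w \<in> U"
  shows "E r *v (Y *v (E r *v w)) = E r *v conjX (E r *v w)"
proof -
  let ?y = "E r *v (Y *v u0)" and ?z = "E r *v conjX u0"
  have rD: "r \<le> D" "Suc r \<le> D" using rd d_pos by auto
  have "X *v (Y *v u0) = \<xi> *s u0 + th (r + 1) *s (Y *v u0)"
    unfolding u0_def X_lin Y_lin lin_scale lin_add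
    by (rule lin_cong) (simp add: opX_theta th_eq_theta[of 1, simplified])
  then have "E r *v (X *v (Y *v u0)) = \<xi> *s u0 + th (r + 1) *s ?y"
    by (simp add: matrix_vector_right_distrib matrix_vec_scale E_u0 rD)
  then have "th r *s ?y = \<xi> *s u0 + th (r + 1) *s ?y"
    by (simp only: resolution_spectral[OF E rD(1)])
  then have y: "(\<theta> 0 - \<theta> 1) *s ?y = \<xi> *s u0"
    using th_eq_theta[of 0] th_eq_theta[of 1] by (simp add: vec.scale_left_diff_distrib)
  have ne: "\<theta> 0 - \<theta> 1 \<noteq> 0"
    using inj_onD[OF th_inj, of r "Suc r"] rD th_eq_theta[of 0] th_eq_theta[of 1] by auto
  have z: "((q - 1 / q) * \<theta> 0) *s ?y + k *s ?z = g *s u0"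
    using first_relation_block[OF rD(1) rD(1) u0_U] th_eq_theta[of 0] by (simp add: E_u0 rD algebra_simps)
  have "(\<theta> 0 - \<theta> 1) *s (k *s (?y - ?z))
      = (((q - 1 / q) * \<theta> 0 + k)) *s ((\<theta> 0 - \<theta> 1) *s ?y)
        - (\<theta> 0 - \<theta> 1) *s (((q - 1 / q) * \<theta> 0) *s ?y + k *s ?z)"
    by (simp add: vec_eq_iff algebra_simps)
  also have "\<dots> = (((q - 1 / q) * \<theta> 0 + k) * \<xi> - g * (\<theta> 0 - \<theta> 1)) *s u0"
    unfolding y z by (simp add: vec.scale_left_diff_distrib mult.commute)
  also have "\<dots> = 0" using theta_rel(2) by simp
  finally have yz: "?y = ?z" using ne k_neq0 by simp
  obtain f where "w = lin f" using w by (auto simp: U_def)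
  then obtain m where "E r *v w = m *s u0"
    using E_r[of f] unfolding u0_def lin_def by blast
  then show ?thesis using yz by (simp add: matrix_vec_scale conjX_scale)
qed

definition "defect v = X *v (Ts *v (T *v v)) - Ts *v (T *v (Y *v v))"

lemma defect_add: "defect (v + w) = defect v + defect w"
  by (simp add: defect_def matrix_vector_right_distrib)
lemma defect_scale: "defect (m *s v) = m *s defect v"
  by (simp add: defect_def matrix_vec_scale vec.scale_right_diff_distrib)

lemma Ts_Ti: "Ts *v (Ti *v v) = v"
  using spectral_inverse[OF F, of \<tau> "\<lambda>i. 1 / \<tau> i"] tau_nz by simp

text \<open>The blockwise relation sums up to \<open>T Y = Z T\<close>, that is \<open>T\<^sup>* T Y = X T\<^sup>* T\<close>. The only block that can
  be missing is the diagonal one at \<open>D\<close>, hence the condition on \<open>v\<close>. The exceptional block at \<open>0\<close> is either the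
  first block of the module or does not meet it.\<close>

lemma defect_zero:
  assumes v: "v \<in> U" and D: "E D *v v = 0"
  shows "defect v = 0"
proof -
  have blk: "\<tau> i *s (E i *v (Y *v (E j *v v))) = \<tau> j *s (E i *v conjX (E j *v v))" if "i \<le> D" "j \<le> D" for i j
  proof (cases "i = j")
    case False
    then show ?thesis using off_diagonal that v by blast
  next
    case True
    have "E i *v (Y *v (E i *v v)) = E i *v conjX (E i *v v)"
    proof (cases "th i = q + 1 / q")
      case False
      then show ?thesis using diagonal that v by blast
    next
      case exc: True
      have "i = 0 \<or> i = D" by (rule exceptional[OF that(1) exc])
      then consider "i = D" | "i = 0" "r = 0" | "i = 0" "0 < r" by linarith
      then show ?thesis
      proof cases
        case 1
        then show ?thesis using D by (simp add: conjX_def)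
      next
        case 2
        then show ?thesis using diagonal_first[OF v] by simp
      next
        case 3
        then have "E 0 *v v = 0"
          using v E_low by (auto simp: U_def lin_def matrix_vec_sum matrix_vec_scale)
        then show ?thesis using 3 by (simp add: conjX_def)
      qed
    qed
    then show ?thesis using True by simp
  qed
  have "T *v (Y *v v) = conjX (T *v v)"
  proof (rule resolution_ext[OF E])
    fix i assume i: "i \<le> D"
    have "E i *v (T *v (Y *v v)) = \<tau> i *s (E i *v (Y *v (\<Sum>j\<le>D. E j *v v)))"
      by (simp add: resolution_spectral[OF E i] resolution_sum[OF E])
    also have "\<dots> = (\<Sum>j\<le>D. \<tau> i *s (E i *v (Y *v (E j *v v))))"
      by (simp add: matrix_vec_sum vec.scale_sum_right)
    also have "\<dots> = (\<Sum>j\<le>D. \<tau> j *s (E i *v conjX (E j *v v)))"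
      using blk i by (intro sum.cong) auto
    also have "\<dots> = E i *v conjX (\<Sum>j\<le>D. \<tau> j *s (E j *v v))"
      by (simp add: matrix_vec_sum conjX_sum conjX_scale matrix_vec_scale)
    finally show "E i *v (T *v (Y *v v)) = E i *v conjX (T *v v)"
      by (simp add: spectral_sum_vec)
  qed
  then show ?thesis by (simp add: defect_def conjX_def Ts_Ti)
qed

text \<open>These vectors climb in both filtrations: each step enlarges the range of \<open>E\<close>-components by at most
  one level, because \<open>Y\<close> is tridiagonal there, and removes the lowest remaining \<open>F\<close>-component.\<close>

primrec krylov :: "nat \<Rightarrow> complex^'x" where
  "krylov 0 = u0"
| "krylov (Suc m) = Y *v krylov m - th (r + m) *s krylov m"

lemma krylov_U: "krylov m \<in> U"
  by (induction m) (simp_all add: u0_U U_closed vec.subspace_diff vec.subspace_scale subspace_U)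

lemma E_krylov: "i \<le> D \<Longrightarrow> r + m < i \<Longrightarrow> E i *v krylov m = 0"
proof (induction m arbitrary: i)
  case 0
  then show ?case by (simp add: E_u0)
next
  case (Suc m)
  have "E i *v (Y *v krylov m) = E i *v (Y *v (\<Sum>j\<le>D. E j *v krylov m))"
    by (simp add: resolution_sum[OF E])
  also have "\<dots> = (\<Sum>j\<le>D. E i *v (Y *v (E j *v krylov m)))"
    by (simp add: matrix_vec_sum)
  also have "\<dots> = 0"
  proof (rule sum.neutral, intro ballI)
    fix j assume "j \<in> {..D}"
    then show "E i *v (Y *v (E j *v krylov m)) = 0"
      using Suc.IH[of j] Suc.prems tridiagonal[of i j] by (cases "r + m < j") auto
  qed
  finally show ?case using Suc by (simp add: matrix_vector_mult_diff_distrib matrix_vec_scale)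
qed

lemma krylov_lin: "krylov m = lin (\<lambda>i. \<Prod>l<m. \<theta> i - \<theta> l)"
proof (induction m)
  case (Suc m)
  show ?case unfolding krylov.simps Suc Y_lin lin_scale lin_diff th_eq_theta
    by (rule lin_cong) (simp add: algebra_simps)
qed (simp add: u0_def)

lemma Y_krylov_d: "Y *v krylov d = th (r + d) *s krylov d"
  unfolding krylov_lin Y_lin lin_scale th_eq_theta
proof (rule lin_cong)
  fix i assume "i \<le> d"
  show "\<theta> i * (\<Prod>l<d. \<theta> i - \<theta> l) = \<theta> d * (\<Prod>l<d. \<theta> i - \<theta> l)"
  proof (cases "i = d")
    case False
    then have "(\<Prod>l<d. \<theta> i - \<theta> l) = 0" using \<open>i \<le> d\<close> by (intro prod_zero) auto
    then show ?thesis by simp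
  qed simp
qed

text \<open>Only the last vector, and only when \<open>r + d = D\<close>, can have an \<open>E\<^sub>D\<close>-component. The relation for the
  previous vectors shows that \<open>T\<^sup>* T\<close> maps it into \<open>E\<^sub>D\<close>, so both sides of the relation multiply this image
  by \<open>\<theta>\<^sub>D\<close>.\<close>

lemma defect_krylov: "m \<le> d \<Longrightarrow> defect (krylov m) = 0"
proof -
  have low: "defect (krylov m) = 0" if "r + m < D" for m
    by (rule defect_zero[OF krylov_U E_krylov]) (use that in auto)
  \<comment> \<open>Dually to \<open>E_krylov\<close>, the image of a Krylov vector has no components below level \<open>r +
    m\<close>: by the relation itself, multiplication by \<open>Y - \<theta>\<^sub>r\<^sub>+\<^sub>m\<close> becomes
    multiplication by \<open>X - \<theta>\<^sub>r\<^sub>+\<^sub>m\<close> on the image.\<close>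
  have E_M: "E j *v (Ts *v (T *v krylov m)) = 0" if "m \<le> d" "j < r + m" for j m
    using that
  proof (induction m arbitrary: j)
    case 0
    have inv: "Ts *v v \<in> U" "T *v v \<in> U" if "v \<in> U" for v
    proof -
      show "Ts *v v \<in> U" using that by (auto simp: U_def spectral_F_lin)
      show "T *v v \<in> U" unfolding spectral_sum_vec
        using that by (intro vec.subspace_sum[OF subspace_U] vec.subspace_scale[OF subspace_U] E_U) auto
    qed
    have "Ts *v (T *v u0) \<in> U" using inv u0_U by blast
    then show ?case using 0 E_low by (auto simp: U_def lin_def matrix_vec_sum matrix_vec_scale)
  next
    case (Suc m)
    have jD: "j \<le> D" using Suc.prems rd by simp
    have "defect (krylov m) = 0" by (rule low) (use Suc.prems rd in simp)
    then have "Ts *v (T *v krylov (Suc m)) = X *v (Ts *v (T *v krylov m)) - th (r + m) *s (Ts *v (T *v krylov m))"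
      by (simp add: defect_def matrix_vector_mult_diff_distrib matrix_vec_scale)
    then have "E j *v (Ts *v (T *v krylov (Suc m))) = (th j - th (r + m)) *s (E j *v (Ts *v (T *v krylov m)))"
      by (simp add: matrix_vector_mult_diff_distrib matrix_vec_scale resolution_spectral[OF E jD]
          vec.scale_left_diff_distrib)
    then show ?case using Suc by (cases "j = r + m") auto
  qed
  assume m: "m \<le> d"
  show ?thesis
  proof (cases "r + m < D")
    case False
    then have D: "m = d" "r + d = D" using m rd by auto
    \<comment> \<open>All components of the image except the one in \<open>E\<^sub>D\<close> vanish.\<close>
    let ?v = "Ts *v (T *v krylov d)"
    have "X *v ?v = th D *s ?v"
    proof (rule resolution_ext[OF E])
      fix j assume j: "j \<le> D"
      show "E j *v (X *v ?v) = E j *v (th D *s ?v)"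
        using E_M[of d j] j D by (cases "j = D") (simp_all add: resolution_spectral[OF E] matrix_vec_scale)
    qed
    then show ?thesis unfolding defect_def D(1) Y_krylov_d D(2) by (simp add: matrix_vec_scale)
  qed (rule low)
qed

text \<open>The Krylov space of the vector \<open>u\<^sub>0 + \<cdots> + u\<^sub>d\<close> under \<open>Y\<close> contains each \<open>u\<^sub>i\<close>, as the \<open>F\<close>-components of
  a vector are polynomials in \<open>Y\<close> applied to it.\<close>

theorem intertwining:
  assumes i: "i \<le> d"
  shows "X *v (Ts *v (T *v u i)) = Ts *v (T *v (Y *v u i))"
proof -
  let ?W = "vec.span (krylov ` {..d})"
  have "Y *v v \<in> ?W" if "v \<in> ?W" for v
    using that
  proof (rule vec.span_induct)
    show "vec.subspace {v. Y *v v \<in> ?W}"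
      by (auto simp: vec.subspace_def matrix_vector_right_distrib matrix_vec_scale
          vec.span_zero vec.span_add vec.span_scale)
  next
    fix v assume "v \<in> krylov ` {..d}"
    then obtain m where m: "m \<le> d" "v = krylov m" by auto
    have base: "krylov l \<in> ?W" if "l \<le> d" for l using that by (intro vec.span_base) auto
    show "Y *v v \<in> ?W"
    proof (cases "m = d")
      case True
      then show ?thesis using m base by (simp add: Y_krylov_d vec.span_scale)
    next
      case False
      have "Y *v v = krylov (Suc m) + th (r + m) *s krylov m" using m by simp
      then show ?thesis using base[of m] base[of "Suc m"] False m
        by (simp only: vec.span_add vec.span_scale Suc_leI le_neq_implies_less)
    qed
  qed
  moreover have "u0 \<in> ?W" by (rule vec.span_base) (auto intro!: image_eqI[of _ _ 0])
  ultimately have "F (r + i) *v u0 \<in> ?W"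
    using i rd by (intro resolution_invariant[OF F th_inj vec.subspace_span]) auto
  moreover have "F (r + i) *v u0 = u i" using i rd by (simp add: u0_def F_lin)
  ultimately have "u i \<in> ?W" by simp
  then have "defect (u i) = 0"
  proof (rule vec.span_induct)
    show "vec.subspace {v. defect v = 0}"
      by (auto simp: vec.subspace_def defect_add defect_scale) (simp add: defect_def)
  qed (auto simp: defect_krylov)
  then show ?thesis by (simp add: defect_def)
qed

end

section \<open>Distances\<close>

context
  fixes R :: "('x::finite \<times> 'x) set"
  assumes conn: "connected_simple_graph R"
begin

lemma relpow_graph_dist: "(x, y) \<in> R ^^ graph_dist R x y"
proof -
  have "\<exists>n. (x, y) \<in> R ^^ n"
    using conn by (simp add: connected_simple_graph_def rtrancl_power)
  then show ?thesis unfolding graph_dist_def by (rule LeastI_ex)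
qed

lemma graph_dist_le: "(x, y) \<in> R ^^ n \<Longrightarrow> graph_dist R x y \<le> n"
  unfolding graph_dist_def by (rule Least_le)

lemma graph_dist_commute: "graph_dist R x y = graph_dist R y x"
proof -
  have "(x, y) \<in> R ^^ n \<Longrightarrow> (y, x) \<in> R ^^ n" for x y n
  proof (induction n arbitrary: y)
    case (Suc n)
    then obtain z where "(x, z) \<in> R ^^ n" "(z, y) \<in> R" by auto
    then show ?case
      using Suc.IH conn by (auto simp: connected_simple_graph_def dest: symD intro: relpow_Suc_I2 simp del: relpow.simps)
  qed auto
  then show ?thesis by (metis antisym graph_dist_le relpow_graph_dist)
qed

lemma graph_dist_triangle: "graph_dist R x z \<le> graph_dist R x y + graph_dist R y z"
  by (rule graph_dist_le) (rule relpow_trans[OF relpow_graph_dist relpow_graph_dist])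

lemma graph_dist_eq_0: "graph_dist R x y = 0 \<longleftrightarrow> x = y"
  using relpow_graph_dist[of x y] graph_dist_le[of x x 0] by auto

lemma graph_dist_le_diameter: "graph_dist R x y \<le> graph_diameter R"
proof -
  have "{graph_dist R x y | x y. True} = (\<lambda>(x, y). graph_dist R x y) ` UNIV" by auto
  then have "finite {graph_dist R x y | x y. True}" by simp
  then show ?thesis unfolding graph_diameter_def by (intro Max_ge) auto
qed

end

section \<open>Formally self-dual graphs\<close>

lemma dual_idempotent_vec: "(dual_idempotent R x i *v v) $ y = (if graph_dist R x y = i then v $ y else 0)"
proof -
  have "(dual_idempotent R x i *v v) $ y
      = (\<Sum>z\<in>UNIV. if z = y then (if graph_dist R x y = i then v $ y else 0) else 0)"
    unfolding matrix_vector_mult_def dual_idempotent_def vec_lambda_beta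
    by (intro sum.cong refl) auto
  then show ?thesis by simp
qed

locale self_dual_graph =
  fixes R :: "('x::finite \<times> 'x) set" and E :: "nat \<Rightarrow> complex^'x^'x" and D :: nat
    and \<theta> :: "nat \<Rightarrow> complex"
  assumes dr: "distance_regular R" and D_def: "D = graph_diameter R" and D_pos: "1 \<le> D"
    and idem: "primitive_idempotents R E" and self_dual: "formally_self_dual R E"
    and theta: "\<And>i. i \<le> D \<Longrightarrow> eigenmatrix_P R E i 1 = \<theta> i"
    and inj: "inj_on \<theta> {..D}"
begin

abbreviation "P \<equiv> eigenmatrix_P R E"
abbreviation "dst \<equiv> graph_dist R"
abbreviation "F \<equiv> dual_idempotent R"

lemma conn: "connected_simple_graph R" using dr by (simp add: distance_regular_def)

lemma dst_le: "dst x y \<le> D" using graph_dist_le_diameter[OF conn] by (simp add: D_def)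

lemma Q_eq_P: "i \<le> D \<Longrightarrow> j \<le> D \<Longrightarrow> eigenmatrix_Q R E i j = P i j"
  using self_dual by (simp add: formally_self_dual_def D_def)

lemma E_res: "idempotent_resolution D E"
  using idem by (auto simp: idempotent_resolution_def primitive_idempotents_def Let_def D_def)

lemma E_nz: "i \<le> D \<Longrightarrow> E i \<noteq> 0"
proof
  assume "i \<le> D" "E i = 0"
  then have "(0 :: complex^'x^'x) \<in> E ` {..graph_diameter R}" by (auto simp: D_def image_iff)
  then have "cmat.dependent (E ` {..graph_diameter R})" by (rule cmat.dependent_zero)
  then show False using idem by (simp add: primitive_idempotents_def Let_def)
qed

lemma dist_matrix_spectral: "j \<le> D \<Longrightarrow> dist_matrix R j = spectral_sum D E (\<lambda>i. P i j)"
  using sum_eigenmatrix_P[OF idem, of j] by (simp add: spectral_sum_def D_def)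

lemma adjacency_spectral: "dist_matrix R 1 = spectral_sum D E \<theta>"
  unfolding dist_matrix_spectral[OF D_pos] by (rule spectral_sum_cong) (rule theta)

lemma sum_dist_matrix: "(\<Sum>i\<le>D. g i *\<^sub>M dist_matrix R i) $ x $ y = g (dst x y)"
proof -
  have "(\<Sum>i\<le>D. g i *\<^sub>M dist_matrix R i) $ x $ y = (\<Sum>i\<le>D. if i = dst x y then g i else 0)"
    unfolding sum_component by (intro sum.cong refl) (auto simp: cmat_scale_def dist_matrix_def)
  then show ?thesis using dst_le by simp
qed

text \<open>By \<open>Q = P\<close> the entries of the idempotents are, up to \<open>|X|\<close>, eigenvalues of the distance
  matrices. Self-duality enters the proof through this formula.\<close>

lemma E_entry: "j \<le> D \<Longrightarrow> E j $ x $ y = P (dst x y) j / of_nat CARD('x)"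
proof -
  assume j: "j \<le> D"
  have "E j $ x $ y = 1 / of_nat CARD('x) * (\<Sum>i\<le>D. eigenmatrix_Q R E i j *\<^sub>M dist_matrix R i) $ x $ y"
    using arg_cong[OF sum_eigenmatrix_Q[OF conn idem, of j], of "\<lambda>M. M $ x $ y"] j
    by (simp add: cmat_scale_def D_def)
  also have "\<dots> = P (dst x y) j / of_nat CARD('x)"
    unfolding sum_dist_matrix by (simp add: Q_eq_P dst_le j)
  finally show ?thesis .
qed

lemma E_sym: "j \<le> D \<Longrightarrow> transpose (E j) = E j"
  by (simp add: vec_eq_iff transpose_def E_entry graph_dist_commute[OF conn])

lemma dist_matrix_sym: "transpose (dist_matrix R j) = dist_matrix R j"
  by (simp add: vec_eq_iff transpose_def dist_matrix_def graph_dist_commute[OF conn])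

lemma dist_matrix_selfadjoint: "selfadjoint (dist_matrix R j)"
  by (rule selfadjoint_real_symmetric[OF dist_matrix_sym]) (simp add: dist_matrix_def)

lemma E_selfadjoint: "i \<le> D \<Longrightarrow> selfadjoint (E i)"
  by (rule selfadjoint_resolution[OF E_res inj dist_matrix_selfadjoint[of 1, unfolded adjacency_spectral]])

lemma E_real: "i \<le> D \<Longrightarrow> Im (E i $ x $ y) = 0"
  using selfadjoint_symmetric_real[OF E_selfadjoint E_sym] by blast

lemma F_res: "idempotent_resolution D (F x)"
proof -
  have "F x i ** F x j = (if i = j then F x i else 0)" for i j
    by (rule matrix_eq_vecI) (auto simp: vec_eq_iff dual_idempotent_vec simp flip: matrix_vector_mul_assoc)
  moreover have "(\<Sum>i\<le>D. F x i) = mat 1"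
    by (rule matrix_eq_vecI) (simp add: vec_eq_iff sum_matrix_vec dual_idempotent_vec dst_le)
  ultimately show ?thesis by (simp add: idempotent_resolution_def)
qed

lemma F_selfadjoint: "selfadjoint (F x i)"
  by (rule selfadjoint_real_symmetric) (auto simp: vec_eq_iff transpose_def dual_idempotent_def)

lemma spectral_F_vec: "(spectral_sum D (F x) g *v v) $ y = g (dst x y) * v $ y"
proof -
  have "(spectral_sum D (F x) g *v v) $ y = (\<Sum>i\<le>D. if i = dst x y then g i * v $ y else 0)"
    unfolding spectral_sum_vec sum_component by (intro sum.cong refl) (auto simp: dual_idempotent_vec)
  then show ?thesis using dst_le by simp
qed

lemma theta_entry: "\<theta> (dst x y) = of_nat CARD('x) * E 1 $ x $ y"
  unfolding E_entry[OF D_pos] theta[OF dst_le] by simp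

lemma tri_F:
  assumes "j + 1 < i \<or> i + 1 < j"
  shows "F x i *v (spectral_sum D E \<theta> *v (F x j *v v)) = 0"
proof -
  define w where "w = F x j *v v"
  have w: "w $ z = 0" if "dst x z \<noteq> j" for z using that by (simp add: w_def dual_idempotent_vec)
  have "(F x i *v (dist_matrix R 1 *v w)) $ y = 0" for y
  proof -
    have "dist_matrix R 1 $ y $ z * w $ z = 0" if "dst x y = i" for z
      using that w[of z] assms graph_dist_triangle[OF conn, of x y z] graph_dist_triangle[OF conn, of x z y]
        graph_dist_commute[OF conn, of y z]
      by (auto simp: dist_matrix_def)
    then have "(\<Sum>z\<in>UNIV. dist_matrix R 1 $ y $ z * w $ z) = 0" if "dst x y = i"
      using that by (intro sum.neutral) blast
    then show ?thesis unfolding dual_idempotent_vec[of R x i]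
      by (simp add: matrix_vector_mult_def)
  qed
  then show ?thesis unfolding w_def by (simp add: vec_eq_iff flip: adjacency_spectral)
qed

text \<open>Since \<open>P = Q\<close>, the intersection numbers \<open>p\<^sup>h\<^sub>i\<^sub>j\<close> are at the same time the Krein parameters.
  In particular they vanish at \<open>h = 1\<close> for \<open>|i - j| > 1\<close>, by the triangle inequality.\<close>

lemma krein:
  assumes ij: "i \<le> D" "j \<le> D"
  shows "\<exists>p. (\<forall>l\<le>D. P l i * P l j = (\<Sum>h\<le>D. p h * P l h))
    \<and> (j + 1 < i \<or> i + 1 < j \<longrightarrow> p 1 = 0)"
proof -
  have "\<forall>h. \<exists>m. h \<le> D \<longrightarrow> (\<forall>x y. dst x y = h \<longrightarrow> card {z. dst x z = i \<and> dst y z = j} = m)"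
    using dr ij unfolding distance_regular_def D_def by blast
  from choice[OF this] obtain n where
    "\<forall>h. h \<le> D \<longrightarrow> (\<forall>x y. dst x y = h \<longrightarrow> card {z. dst x z = i \<and> dst y z = j} = n h)" ..
  then have n: "card {z. dst x z = i \<and> dst y z = j} = n (dst x y)" for x y
    using dst_le by simp
  let ?p = "\<lambda>h. of_nat (n h) :: complex"
  have "dist_matrix R i ** dist_matrix R j = (\<Sum>h\<le>D. ?p h *\<^sub>M dist_matrix R h)"
  proof -
    have "(dist_matrix R i ** dist_matrix R j) $ x $ y = ?p (dst x y)" for x y
    proof -
      have "(dist_matrix R i ** dist_matrix R j) $ x $ y
          = (\<Sum>z\<in>UNIV. if dst x z = i \<and> dst y z = j then 1 else 0)"
        unfolding matrix_matrix_mult_def vec_lambda_beta dist_matrix_def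
        by (intro sum.cong refl) (auto simp: graph_dist_commute[OF conn, of y])
      also have "\<dots> = of_nat (card {z. dst x z = i \<and> dst y z = j})"
        by (simp add: sum.If_cases)
      finally show ?thesis by (simp add: n)
    qed
    then show ?thesis by (simp only: vec_eq_iff sum_dist_matrix) simp
  qed
  then have mult: "dist_matrix R i *v (dist_matrix R j *v v) = (\<Sum>h\<le>D. ?p h *s (dist_matrix R h *v v))" for v
    by (simp add: matrix_vector_mul_assoc sum_matrix_vec cmat_scale_vec)
  have eig: "dist_matrix R h *v (E l *v v) = P l h *s (E l *v v)" if "h \<le> D" "l \<le> D" for h l v
    using that by (simp add: dist_matrix_spectral spectral_resolution[OF E_res])
  have main: "P l i * P l j = (\<Sum>h\<le>D. ?p h * P l h)" if l: "l \<le> D" for l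
  proof -
    obtain v where v: "E l *v v \<noteq> 0" using E_nz[OF l] matrix_eq_vecI[of "E l" 0] by auto
    have "(P l j * P l i) *s (E l *v v) = (\<Sum>h\<le>D. ?p h * P l h) *s (E l *v v)"
      using mult[of "E l *v v"] eig ij l by (simp add: matrix_vec_scale vec.scale_sum_left)
    then show ?thesis using v by (simp only: vector_mul_rcancel) (simp add: mult.commute)
  qed
  have vanish: "?p 1 = 0" if "j + 1 < i \<or> i + 1 < j"
  proof -
    obtain x y where xy: "dst x y = 1" using ex_graph_dist_eq[OF conn, of 1] D_pos by (auto simp: D_def)
    have empty: "{z. dst x z = i \<and> dst y z = j} = {}"
    proof (intro equalityI subsetI)
      fix z assume "z \<in> {z. dst x z = i \<and> dst y z = j}"
      then show "z \<in> {}"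
        using that xy graph_dist_triangle[OF conn, of x z y] graph_dist_triangle[OF conn, of y z x]
          graph_dist_commute[OF conn, of y x] by auto
    qed simp
    then show ?thesis using n[of x y, unfolded empty xy] by simp
  qed
  show ?thesis by (rule exI[of _ ?p]) (use main vanish in blast)
qed

text \<open>The \<open>Q\<close>-polynomial property. The squared Frobenius norm of \<open>E\<^sub>i S E\<^sub>j\<close> is a sum over pairs of
  vertices in which the entrywise product of \<open>E\<^sub>i\<close> and \<open>E\<^sub>j\<close> occurs. Expanding that product by Krein
  parameters leaves \<open>|X| p\<^sup>1\<^sub>i\<^sub>j E\<^sub>1(x,x)\<close>, because \<open>E\<^sub>1 E\<^sub>h = 0\<close> for \<open>h \<noteq> 1\<close>.\<close>

lemma tri_E:
  assumes ij: "i \<le> D" "j \<le> D" and far: "j + 1 < i \<or> i + 1 < j"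
  shows "E i *v (spectral_sum D (F x) \<theta> *v (E j *v v)) = 0"
proof -
  define S where "S = spectral_sum D (F x) \<theta>"
  define B where "B = E i ** S ** E j"
  obtain p where p: "\<And>l. l \<le> D \<Longrightarrow> P l i * P l j = (\<Sum>h\<le>D. p h * P l h)" and p1: "p 1 = 0"
    using krein[OF ij] far by blast
  have S_entry: "S $ y $ z = (if y = z then of_nat CARD('x) * E 1 $ x $ y else 0)" for y z
  proof -
    have "S $ y $ z = (S *v axis z 1) $ y"
      by (simp add: matrix_vector_mult_def axis_def if_distrib cong: if_cong)
    then show ?thesis unfolding S_def spectral_F_vec by (simp add: axis_def theta_entry)
  qed
  have S_sym: "transpose S = S" by (simp add: vec_eq_iff transpose_def S_entry)
  have mid: "(M ** S ** M') $ y $ z = (\<Sum>w\<in>UNIV. M $ y $ w * (of_nat CARD('x) * E 1 $ x $ w) * M' $ w $ z)"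
    for M M' :: "complex^'x^'x" and y z
    unfolding matrix_matrix_mult_def vec_lambda_beta S_entry
    by (simp add: if_distrib cong: if_cong)
  \<comment> \<open>As \<open>B\<close> turns out to be real, \<open>trace (B B\<^sup>T)\<close> is its squared Frobenius
    norm.\<close>
  have "trace (B ** transpose B) = trace (E i ** S ** E j ** S)"
  proof -
    have "transpose B = E j ** S ** E i"
      by (simp add: B_def matrix_transpose_mul S_sym E_sym ij matrix_mul_assoc)
    then have "B ** transpose B = E i ** (S ** (E j ** E j) ** S ** E i)"
      by (simp only: B_def matrix_mul_assoc)
    then have "B ** transpose B = E i ** (S ** E j ** S ** E i)"
      using E_res ij by (simp add: idempotent_resolution_def)
    then have "trace (B ** transpose B) = trace ((S ** E j ** S ** E i) ** E i)"
      using trace_mul_sym[of "E i" "S ** E j ** S ** E i"] by simp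
    also have "(S ** E j ** S ** E i) ** E i = (S ** E j ** S) ** (E i ** E i)"
      by (simp only: matrix_mul_assoc)
    also have "\<dots> = (S ** E j ** S) ** E i"
      using E_res ij by (simp add: idempotent_resolution_def)
    also have "trace ((S ** E j ** S) ** E i) = trace (E i ** (S ** E j ** S))" by (rule trace_mul_sym)
    finally show ?thesis by (simp only: matrix_mul_assoc)
  qed
  also have "\<dots> = (\<Sum>y\<in>UNIV. \<Sum>z\<in>UNIV. of_nat CARD('x) ^ 2 * (E 1 $ x $ y * (E i $ y $ z * E j $ z $ y) * E 1 $ x $ z))"
    unfolding trace_def
  proof (rule sum.cong[OF refl])
    fix y
    have e: "(E i ** S ** E j ** S) $ y $ y = (E i ** S ** E j) $ y $ y * (of_nat CARD('x) * E 1 $ x $ y)"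
      unfolding matrix_matrix_mult_def[of "E i ** S ** E j"] vec_lambda_beta S_entry
      by (simp add: if_distrib cong: if_cong)
    show "(E i ** S ** E j ** S) $ y $ y
        = (\<Sum>z\<in>UNIV. of_nat CARD('x) ^ 2 * (E 1 $ x $ y * (E i $ y $ z * E j $ z $ y) * E 1 $ x $ z))"
      unfolding e mid sum_distrib_right
      by (rule sum.cong[OF refl]) (simp add: power2_eq_square mult_ac)
  qed
  also have "\<dots> = (\<Sum>y\<in>UNIV. \<Sum>z\<in>UNIV. \<Sum>h\<le>D. of_nat CARD('x) * (p h * (E 1 $ x $ y * E h $ y $ z * E 1 $ x $ z)))"
  proof (intro sum.cong refl)
    fix y z
    have "E i $ y $ z * E j $ z $ y = P (dst y z) i * P (dst y z) j / of_nat CARD('x) ^ 2"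
      using ij by (simp add: E_entry graph_dist_commute[OF conn, of z y] power2_eq_square)
    also have "\<dots> = (\<Sum>h\<le>D. p h * P (dst y z) h / of_nat CARD('x) ^ 2)"
      unfolding p[OF dst_le] by (simp add: sum_divide_distrib)
    also have "\<dots> = (\<Sum>h\<le>D. p h * E h $ y $ z / of_nat CARD('x))"
      by (intro sum.cong) (auto simp: E_entry power2_eq_square)
    finally have e: "E i $ y $ z * E j $ z $ y = (\<Sum>h\<le>D. p h * E h $ y $ z / of_nat CARD('x))" .
    show "of_nat CARD('x) ^ 2 * (E 1 $ x $ y * (E i $ y $ z * E j $ z $ y) * E 1 $ x $ z)
       = (\<Sum>h\<le>D. of_nat CARD('x) * (p h * (E 1 $ x $ y * E h $ y $ z * E 1 $ x $ z)))"
      unfolding e sum_distrib_left sum_distrib_right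
      by (intro sum.cong refl) (simp add: power2_eq_square)
  qed
  also have "\<dots> = (\<Sum>h\<le>D. of_nat CARD('x) * (p h * (\<Sum>y\<in>UNIV. \<Sum>z\<in>UNIV. E 1 $ x $ y * E h $ y $ z * E 1 $ x $ z)))"
    by (simp add: sum_distrib_left sum.swap[of _ "{..D}"])
  also have "\<dots> = 0"
  proof (rule sum.neutral, intro ballI)
    fix h assume h: "h \<in> {..D}"
    show "of_nat CARD('x) * (p h * (\<Sum>y\<in>UNIV. \<Sum>z\<in>UNIV. E 1 $ x $ y * E h $ y $ z * E 1 $ x $ z)) = 0"
    proof (cases "h = 1")
      case False
      have "E 1 ** E h = 0" using E_res h D_pos False by (simp add: idempotent_resolution_def)
      have "(\<Sum>y\<in>UNIV. \<Sum>z\<in>UNIV. E 1 $ x $ y * E h $ y $ z * E 1 $ x $ z)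
          = (\<Sum>z\<in>UNIV. (\<Sum>y\<in>UNIV. E 1 $ x $ y * E h $ y $ z) * E 1 $ x $ z)"
        unfolding sum_distrib_right by (rule sum.swap)
      also have "\<dots> = (\<Sum>z\<in>UNIV. (E 1 ** E h) $ x $ z * E 1 $ x $ z)"
        by (simp add: matrix_matrix_mult_def)
      finally show ?thesis using \<open>E 1 ** E h = 0\<close> by simp
    qed (use p1 in simp)
  qed
  finally have tr: "trace (B ** transpose B) = 0" .
  have B_real: "Im (B $ y $ z) = 0" for y z
    unfolding B_def mid using E_real[OF ij(1)] E_real[OF ij(2)] E_real[OF D_pos] by simp
  have "(\<Sum>y\<in>UNIV. \<Sum>z\<in>UNIV. (Re (B $ y $ z)) ^ 2) = Re (trace (B ** transpose B))"
    by (simp add: trace_def matrix_matrix_mult_def transpose_def B_real power2_eq_square)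
  then have "(\<Sum>y\<in>UNIV. \<Sum>z\<in>UNIV. (Re (B $ y $ z)) ^ 2) = 0" using tr by simp
  then have "Re (B $ y $ z) = 0" for y z
    by (simp add: sum_nonneg_eq_0_iff sum_nonneg)
  then have "B = 0" using B_real by (simp add: vec_eq_iff complex_eq_iff)
  then have "B *v v = 0" by simp
  then show ?thesis by (simp add: B_def S_def matrix_vector_mul_assoc matrix_mul_assoc)
qed

end

section \<open>Terwilliger modules\<close>

lemma thin_scalar:
  assumes U: "vec.subspace U" and dim: "vec.dim ((*v) B ` U) \<le> 1"
  shows "\<exists>w. \<forall>v\<in>U. \<exists>m. (B :: complex^'x::finite^'x) *v v = m *s w"
proof -
  obtain C where C: "C \<subseteq> (*v) B ` U" "vec.independent C" "(*v) B ` U \<subseteq> vec.span C"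
      "card C = vec.dim ((*v) B ` U)"
    by (rule vec.basis_exists)
  have fin: "finite C" using C(2) vec.finiteI_independent by blast
  have "\<forall>a\<in>C. \<forall>b\<in>C. a = b" using dim C(4) card_le_Suc0_iff_eq[OF fin] by simp
  then obtain w where "C \<subseteq> {w}" by blast
  then have "vec.span C \<subseteq> vec.span {w}" by (rule vec.span_mono)
  then have "B *v v \<in> vec.span {w}" if "v \<in> U" for v using that C(3) by blast
  then have "\<exists>m. B *v v = m *s w" if "v \<in> U" for v
    using that unfolding vec.span_singleton by blast
  then show ?thesis by blast
qed

lemma sum_shift_up: "(\<Sum>i\<le>d. if i < d then g (Suc i) else 0) = (\<Sum>i\<le>d. if i = 0 then 0 else g i)"
  for g :: "nat \<Rightarrow> 'a :: comm_monoid_add"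
proof -
  have "(\<Sum>i\<le>d. if i < d then g (Suc i) else 0) = (\<Sum>i<d. g (Suc i))"
    by (simp add: lessThan_Suc_atMost[symmetric])
  also have "\<dots> = (\<Sum>i\<le>d. if i = 0 then 0 else g i)"
    by (simp add: sum.atMost_shift)
  finally show ?thesis .
qed

context self_dual_graph
begin

abbreviation "A \<equiv> spectral_sum D E \<theta>"
abbreviation "S x \<equiv> spectral_sum D (F x) \<theta>"

text \<open>Invariance under the two matrices \<open>A\<close> and \<open>S\<close> suffices: both have simple spectrum, so their
  idempotents, which generate the Terwilliger algebra, are polynomials in them.\<close>

lemma T_module_iff: "T_module R x U \<longleftrightarrow> invariant_subspace A (S x) U"
proof
  assume U: "T_module R x U"
  have gen: "bose_mesner R \<union> F x ` {..D} \<subseteq> terwilliger_algebra R x"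
    unfolding terwilliger_algebra_def D_def by (rule hull_subset)
  have "dist_matrix R 1 \<in> bose_mesner R"
    unfolding bose_mesner_def using D_pos by (intro cmat.span_base) (auto simp: D_def)
  then have "A \<in> terwilliger_algebra R x" using gen adjacency_spectral by auto
  moreover have "S x *v v \<in> U" if "v \<in> U" for v
    unfolding spectral_sum_vec
    using U gen that by (intro vec.subspace_sum vec.subspace_scale) (auto simp: T_module_def)
  ultimately show "invariant_subspace A (S x) U"
    using U by (auto simp: T_module_def invariant_subspace_def)
next
  assume U: "invariant_subspace A (S x) U"
  then have sub: "vec.subspace U" by (simp add: invariant_subspace_def)
  let ?B = "{B. \<forall>v\<in>U. B *v v \<in> U}"
  have subsp: "cmat.subspace ?B"
    using sub by (auto simp: cmat.subspace_def vec.subspace_def matrix_vector_mult_add_rdistrib cmat_scale_vec)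
  then have alg: "cmat_subalgebra ?B"
    by (auto simp: cmat_subalgebra_def simp flip: matrix_vector_mul_assoc)
  have E_in: "E i \<in> ?B" if "i \<le> D" for i
    using resolution_invariant[OF E_res inj sub _ that] U by (auto simp: invariant_subspace_def)
  have F_in: "F x i \<in> ?B" if "i \<le> D" for i
    using resolution_invariant[OF F_res inj sub _ that] U by (auto simp: invariant_subspace_def)
  have "dist_matrix R j \<in> ?B" if "j \<le> D" for j
    unfolding dist_matrix_spectral[OF that] spectral_sum_def
    using E_in by (intro cmat.subspace_sum[OF subsp] cmat.subspace_scale[OF subsp]) auto
  then have "bose_mesner R \<subseteq> ?B"
    unfolding bose_mesner_def using subsp by (intro cmat.span_minimal) (auto simp: D_def)
  then have "terwilliger_algebra R x \<subseteq> ?B"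
    unfolding terwilliger_algebra_def using F_in alg by (intro hull_minimal) (auto simp: D_def)
  then show "T_module R x U" using sub by (auto simp: T_module_def)
qed

lemma irreducible_T_module_iff: "irreducible_T_module R x U \<longleftrightarrow> irreducible_subspace A (S x) U"
  by (auto simp: irreducible_T_module_def irreducible_subspace_def T_module_iff)

lemma image_nonzero:
  assumes "vec.subspace U" shows "(*v) B ` U \<noteq> {0} \<longleftrightarrow> (\<exists>v\<in>U. B *v v \<noteq> 0)"
  using vec.subspace_0[OF assms] by (auto simp: image_iff)

text \<open>The components of the three-term relation recover its coefficients within the range \<open>0..d\<close>, so
  any two solutions agree there. This identifies the coefficients obtained by choice with the actual
  ones.\<close>

lemma module_three_term_components:
  assumes tt: "module_three_term R E x U c a b"
    and u: "u \<in> (*v) (E (dual_endpoint R E U)) ` U" "u \<noteq> 0"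
    and r: "r = endpoint R x U" and d: "d = module_diameter R x U" and rd: "r + d \<le> D"
  shows "i < d \<Longrightarrow> F x (r + i + 1) *v (A *v (F x (r + i) *v u)) = c (i + 1) *s (F x (r + i + 1) *v u)"
    and "i < d \<Longrightarrow> F x (r + i) *v (A *v (F x (r + i + 1) *v u)) = b i *s (F x (r + i) *v u)"
proof -
  have tt': "A *v (F x (r + i) *v u) =
         (if i < d then c (i + 1) *s (F x (r + i + 1) *v u) else 0)
         + a i *s (F x (r + i) *v u)
         + (if 0 < i then b (i - 1) *s (F x (r + i - 1) *v u) else 0)" if "i \<le> d" for i
    using tt u that unfolding module_three_term_def Let_def r d adjacency_spectral by blast
  show "i < d \<Longrightarrow> F x (r + i + 1) *v (A *v (F x (r + i) *v u)) = c (i + 1) *s (F x (r + i + 1) *v u)"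
    using rd by (subst tt') (auto simp: matrix_vector_right_distrib matrix_vec_scale resolution_idem[OF F_res])
  show "i < d \<Longrightarrow> F x (r + i) *v (A *v (F x (r + i + 1) *v u)) = b i *s (F x (r + i) *v u)"
    using rd tt'[of "i + 1"] by (auto simp: matrix_vector_right_distrib matrix_vec_scale resolution_idem[OF F_res])
qed

text \<open>In the basis \<open>E\<^sup>*\<^sub>r\<^sub>+\<^sub>iu\<close> only the numbers \<open>c\<^sub>i(U)\<close> and \<open>b\<^sub>i(U)\<close> are needed, because \<open>u\<close> is an
  eigenvector: \<open>A u = \<theta>\<^sub>r u\<close> and \<open>u = \<Sum>\<^sub>i E\<^sup>*\<^sub>r\<^sub>+\<^sub>iu\<close> force \<open>a\<^sub>i(U) = \<theta>\<^sub>r - b\<^sub>i(U) - c\<^sub>i(U)\<close>.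
  The numbers \<open>c\<^sub>0(U)\<close> and \<open>b\<^sub>d(U)\<close> are unconstrained and are replaced by \<open>0\<close>.\<close>

theorem module_action:
  assumes irr: "irreducible_T_module R x U" and thin: "thin_module R x U"
    and r: "r = endpoint R x U" "r = dual_endpoint R E U" and d: "d = module_diameter R x U"
  obtains u where "u \<in> U" and "r + d \<le> D"
    and "\<And>v. v \<in> U \<Longrightarrow> \<exists>f. v = (\<Sum>i\<le>d. f i *s (F x (r + i) *v u))"
    and "\<And>j v. j < r \<Longrightarrow> v \<in> U \<Longrightarrow> E j *v v = 0"
    and "\<And>v. v \<in> U \<Longrightarrow> \<exists>m. E r *v v = m *s u"
    and "\<And>f. A *v (\<Sum>i\<le>d. f i *s (F x (r + i) *v u)) =
      (\<Sum>i\<le>d. ((if i = 0 then 0 else module_c R E x U i) * f (i - 1)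
        + (\<theta> r - (if i < d then module_b R E x U i else 0) - (if i = 0 then 0 else module_c R E x U i)) * f i
        + (if i < d then module_b R E x U i else 0) * f (i + 1)) *s (F x (r + i) *v u))"
    and "(\<Sum>i\<le>d. F x (r + i) *v u) = u"
proof -
  have irr': "irreducible_subspace A (S x) U" using irr by (simp add: irreducible_T_module_iff)
  then have sub: "vec.subspace U" by (simp add: irreducible_subspace_def invariant_subspace_def)
  interpret tm: thin_tridiagonal_module D E "F x" \<theta> U
  proof unfold_locales
    fix i assume i: "i \<le> D"
    then show "\<exists>w. \<forall>v\<in>U. \<exists>m. F x i *v v = m *s w"
      using thin by (intro thin_scalar[OF sub]) (simp add: thin_module_def D_def)
  qed (use E_res F_res inj E_selfadjoint F_selfadjoint irr' tri_F tri_E in auto)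
  interpret dual: thin_tridiagonal_module D "F x" E \<theta> U by (rule tm.dual_thin)
  have supp: "module_support R x U = tm.supp"
    by (simp add: module_support_def eigen_support_def D_def image_nonzero[OF sub])
  have r_F: "r = Min tm.supp" using r(1) by (simp add: endpoint_def supp)
  have d_F: "d = card tm.supp - 1" using d by (simp add: module_diameter_def supp)
  have r_E: "r = Min (eigen_support D E U)"
    using r(2) by (simp add: dual_endpoint_def eigen_support_def D_def image_nonzero[OF sub])
  have supp_eq: "tm.supp = {r..r + d}" using tm.supp_interval r_F d_F by simp
  have "r + d \<in> tm.supp" using supp_eq by simp
  then have rd: "r + d \<le> D" by (simp add: eigen_support_def)
  have "r \<in> eigen_support D E U"
    unfolding r_E by (rule Min_in[OF finite_eigen_support dual.supp_nonempty])
  then obtain v0 where v0: "v0 \<in> U" "E r *v v0 \<noteq> 0" by (auto simp: eigen_support_def)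
  define u where "u = E r *v v0"
  have u_U: "u \<in> U" using dual.F_U[of r v0] v0 rd by (simp add: u_def)
  have u_nz: "u \<noteq> 0" using v0 by (simp add: u_def)
  have Eu: "E r *v u = u" using rd by (simp add: u_def resolution_idem[OF E_res])
  note u = u_U u_nz Eu[unfolded r_E]
  have u_nz': "F x (r + i) *v u \<noteq> 0" if "i \<le> d" for i
    using tm.seed_component[OF u, of "r + i"] supp_eq that by simp
  have coord: "\<exists>f. v = (\<Sum>i\<le>d. f i *s (F x (r + i) *v u))" if "v \<in> U" for v
    using tm.coordinates[OF u that] unfolding r_F[symmetric] d_F[symmetric] .
  have low: "E j *v v = 0" if "j < r" "v \<in> U" for j v
  proof (rule ccontr)
    assume "E j *v v \<noteq> 0"
    then have "j \<in> eigen_support D E U" using that rd by (auto simp: eigen_support_def)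
    then have "r \<le> j" unfolding r_E by (rule Min_le[OF finite_eigen_support])
    then show False using that by simp
  qed
  have mult: "\<exists>m. E r *v v = m *s u" if "v \<in> U" for v
  proof -
    have "r \<le> D" using rd by simp
    from tm.thin_E[OF this] obtain w where w: "\<forall>v\<in>U. \<exists>m. E r *v v = m *s w" ..
    from bspec[OF w that] obtain m1 where m1: "E r *v v = m1 *s w" ..
    from bspec[OF w u_U] obtain m2 where m2: "E r *v u = m2 *s w" ..
    note m = m1 m2
    have um: "u = m2 *s w" using m(2) by (simp only: Eu)
    have m2_nz: "m2 \<noteq> 0"
    proof
      assume "m2 = 0"
      then show False using um u_nz by simp
    qed
    have "E r *v v = (m1 * inverse m2) *s u"
      unfolding m(1) um vector_smult_assoc using m2_nz by simp
    then show ?thesis by blast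
  qed
  obtain c a b where tt: "\<And>i. i \<le> d \<Longrightarrow> A *v (F x (r + i) *v u) =
      (if i < d then c (i + 1) *s (F x (r + i + 1) *v u) else 0) + a i *s (F x (r + i) *v u)
      + (if 0 < i then b (i - 1) *s (F x (r + i - 1) *v u) else 0)"
    using tm.three_term[OF u] unfolding r_F[symmetric] d_F[symmetric] by blast
  \<comment> \<open>The relation for \<open>u\<close> holds for every vector of \<open>E\<^sub>rU\<close>, as these are
    multiples of \<open>u\<close>.\<close>
  have mtt: "module_three_term R E x U c a b"
    unfolding module_three_term_def Let_def r(1)[symmetric] r(2)[symmetric] d[symmetric] adjacency_spectral
  proof (intro ballI impI allI)
    fix u' i assume "u' \<in> (*v) (E r) ` U" and "i \<le> d"
    then obtain m where m: "u' = m *s u" using mult by auto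
    show "A *v (F x (r + i) *v u') =
         (if i < d then c (i + 1) *s (F x (r + i + 1) *v u') else 0)
         + a i *s (F x (r + i) *v u')
         + (if 0 < i then b (i - 1) *s (F x (r + i - 1) *v u') else 0)"
      unfolding m matrix_vec_scale tt[OF \<open>i \<le> d\<close>]
      by (simp add: vec.scale_right_distrib mult.commute)
  qed
  have u_in: "u \<in> (*v) (E (dual_endpoint R E U)) ` U" using v0 by (simp add: u_def flip: r(2))
  note comps = module_three_term_components[OF _ u_in u_nz r(1) d rd]
  have "\<exists>a b. module_three_term R E x U (module_c R E x U) a b"
    unfolding module_c_def
    using someI_ex[of "\<lambda>c. \<exists>a b. module_three_term R E x U c a b"] mtt by blast
  then obtain a1 b1 where mc: "module_three_term R E x U (module_c R E x U) a1 b1" by blast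
  have "\<exists>c a. module_three_term R E x U c a (module_b R E x U)"
    unfolding module_b_def
    using someI_ex[of "\<lambda>b. \<exists>c a. module_three_term R E x U c a b"] mtt by blast
  then obtain c2 a2 where mb: "module_three_term R E x U c2 a2 (module_b R E x U)" by blast
  have c_eq: "c (i + 1) = module_c R E x U (i + 1)" if "i < d" for i
    using comps(1)[OF mtt that] comps(1)[OF mc that] u_nz'[of "i + 1"] that
    by (simp add: add.assoc)
  have b_eq: "b i = module_b R E x U i" if "i < d" for i
    using comps(2)[OF mtt that] comps(2)[OF mb that] u_nz'[of i] that by simp
  let ?c = "\<lambda>i. if i = 0 then 0 else module_c R E x U i"
  let ?b = "\<lambda>i. if i < d then module_b R E x U i else 0"
  let ?u = "\<lambda>i. F x (r + i) *v u"
  have act: "A *v (\<Sum>i\<le>d. f i *s ?u i) = (\<Sum>i\<le>d. (?c i * f (i - 1) + a i * f i + ?b i * f (i + 1)) *s ?u i)" for f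
  proof -
    have "A *v (\<Sum>i\<le>d. f i *s ?u i) = (\<Sum>i\<le>d. f i *s (A *v ?u i))"
      by (simp add: matrix_vec_sum matrix_vec_scale)
    also have "\<dots> = (\<Sum>i\<le>d. (if i < d then (c (Suc i) * f (Suc i - 1)) *s ?u (Suc i) else 0)
        + (a i * f i) *s ?u i + (if i = 0 then 0 else (b (i - 1) * f (Suc (i - 1))) *s ?u (i - 1)))"
      by (intro sum.cong refl)
        (auto simp: tt vec.scale_right_distrib mult.commute)
    also have "\<dots> = (\<Sum>i\<le>d. if i < d then (c (Suc i) * f (Suc i - 1)) *s ?u (Suc i) else 0)
        + (\<Sum>i\<le>d. (a i * f i) *s ?u i)
        + (\<Sum>i\<le>d. if i = 0 then 0 else (b (i - 1) * f (Suc (i - 1))) *s ?u (i - 1))"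
      by (simp only: sum.distrib)
    also have "(\<Sum>i\<le>d. if i < d then (c (Suc i) * f (Suc i - 1)) *s ?u (Suc i) else 0)
        = (\<Sum>i\<le>d. if i = 0 then 0 else (c i * f (i - 1)) *s ?u i)"
      by (rule sum_shift_up)
    also have "(\<Sum>i\<le>d. if i = 0 then 0 else (b (i - 1) * f (Suc (i - 1))) *s ?u (i - 1))
        = (\<Sum>i\<le>d. if i < d then (b i * f (Suc i)) *s ?u i else 0)"
      using sum_shift_up[of d "\<lambda>i. (b (i - 1) * f (Suc (i - 1))) *s ?u (i - 1)", symmetric]
      by (simp only: diff_Suc_1)
    also have "(\<Sum>i\<le>d. if i = 0 then 0 else (c i * f (i - 1)) *s ?u i) + (\<Sum>i\<le>d. (a i * f i) *s ?u i)
        + (\<Sum>i\<le>d. if i < d then (b i * f (Suc i)) *s ?u i else 0)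
        = (\<Sum>i\<le>d. (?c i * f (i - 1) + a i * f i + ?b i * f (i + 1)) *s ?u i)"
      unfolding sum.distrib[symmetric]
    proof (intro sum.cong refl)
      fix i assume "i \<in> {..d}"
      then show "(if i = 0 then 0 else (c i * f (i - 1)) *s ?u i) + (a i * f i) *s ?u i
          + (if i < d then (b i * f (Suc i)) *s ?u i else 0)
          = (?c i * f (i - 1) + a i * f i + ?b i * f (i + 1)) *s ?u i"
        using c_eq[of "i - 1"] b_eq[of i] by (auto simp: vec.scale_left_distrib)
    qed
    finally show ?thesis .
  qed
  have u_sum: "(\<Sum>i\<le>d. ?u i) = u"
  proof -
    obtain f where f: "u = (\<Sum>i\<le>d. f i *s ?u i)" using coord[OF u_U] by blast
    have "u = (\<Sum>j\<le>D. F x j *v u)" by (simp add: resolution_sum[OF F_res])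
    also have "\<dots> = (\<Sum>j\<in>{r..r + d}. F x j *v u)"
      using u_U rd supp_eq by (intro sum.mono_neutral_right) (auto simp: eigen_support_def)
    also have "\<dots> = (\<Sum>i\<le>d. ?u i)"
      by (rule sum.reindex_bij_witness[of _ "\<lambda>i. r + i" "\<lambda>j. j - r"]) auto
    finally show ?thesis by simp
  qed
  have a_eq: "a i = \<theta> r - ?b i - ?c i" if i: "i \<le> d" for i
  proof -
    have "(\<Sum>j\<le>d. (?c j + a j + ?b j) *s ?u j) = A *v u"
      using act[of "\<lambda>_. 1"] u_sum by simp
    also have "\<dots> = \<theta> r *s u" using spectral_resolution[OF E_res, of r \<theta> u] rd Eu by simp
    finally have "F x (r + i) *v (\<Sum>j\<le>d. (?c j + a j + ?b j) *s ?u j) = \<theta> r *s ?u i"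
      by (simp only: matrix_vec_scale)
    moreover have "F x (r + i) *v (\<Sum>j\<le>d. (?c j + a j + ?b j) *s ?u j)
        = (\<Sum>j\<le>d. if j = i then (?c i + a i + ?b i) *s ?u i else 0)"
      unfolding matrix_vec_sum matrix_vec_scale
      using rd i by (intro sum.cong refl) (auto simp: resolution_idem[OF F_res])
    ultimately have "(?c i + a i + ?b i) *s ?u i = \<theta> r *s ?u i" using i by simp
    then have "?c i + a i + ?b i = \<theta> r" using u_nz'[OF i] by (simp only: vector_mul_rcancel) simp
    then show ?thesis by (simp add: algebra_simps)
  qed
  show ?thesis
  proof (rule that[OF u_U rd coord low mult _ u_sum])
    fix f
    show "A *v (\<Sum>i\<le>d. f i *s ?u i) =
      (\<Sum>i\<le>d. (?c i * f (i - 1) + (\<theta> r - ?b i - ?c i) * f i + ?b i * f (i + 1)) *s ?u i)"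
      unfolding act by (intro sum.cong refl) (simp only: a_eq atMost_iff)
  qed
qed

end

section \<open>Spin models from the intertwining relation\<close>

text \<open>The nodes \<open>t\<^sub>i\<close> stand for \<open>a q\<^sup>2\<^sup>i\<^sup>-\<^sup>D\<close>. Keeping \<open>t\<close>, \<open>q\<close> and \<open>\<alpha>\<close> abstract
  allows a different choice of \<open>q\<close> for graphs of diameter one. The condition on \<open>q\<^sup>4\<close>
  makes the coefficient \<open>k\<close> of the Askey-Wilson relations nonzero.\<close>

locale spin_graph = self_dual_graph R E D \<theta>
  for R :: "('x::finite \<times> 'x) set" and E :: "nat \<Rightarrow> complex^'x^'x" and D :: nat
    and \<theta> :: "nat \<Rightarrow> complex" +
  fixes q \<alpha> \<beta> :: complex and t \<tau> :: "nat \<Rightarrow> complex"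
  assumes q: "q \<noteq> 0" and q4: "q ^ 4 \<noteq> 1" and alpha: "\<alpha> \<noteq> 0"
    and theta_eq: "\<And>i. i \<le> D \<Longrightarrow> \<theta> i = \<alpha> * (t i + 1 / t i) + \<beta>"
    and t_Suc: "\<And>i. t (Suc i) = t i * q ^ 2" and t_nz: "\<And>i. t i \<noteq> 0"
    and t_inj: "\<And>i j. i \<le> D \<Longrightarrow> j \<le> D \<Longrightarrow> i \<noteq> j \<Longrightarrow> t i \<noteq> t j"
    and t_prod: "\<And>i j. i \<le> D \<Longrightarrow> j \<le> D \<Longrightarrow> i \<noteq> j \<Longrightarrow> t i * t j \<noteq> 1"
    and t_sq: "\<And>i. 1 \<le> i \<Longrightarrow> i < D \<Longrightarrow> t i ^ 2 \<noteq> 1"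
    and tq_sq: "\<And>i. i < D \<Longrightarrow> (t i * q) ^ 2 \<noteq> 1"
    and tau_0: "\<tau> 0 = 1" and tau_Suc: "\<And>i. i < D \<Longrightarrow> \<tau> (Suc i) * (t i * q) = - \<tau> i"
    and thin: "\<And>x U. irreducible_T_module R x U \<Longrightarrow> thin_module R x U"
    and endpoints: "\<And>x U. irreducible_T_module R x U \<Longrightarrow> endpoint R x U = dual_endpoint R E U"
    and module_b_0: "\<And>x U r d s \<delta>. irreducible_T_module R x U \<Longrightarrow> r = endpoint R x U \<Longrightarrow>
        d = module_diameter R x U \<Longrightarrow> 1 \<le> d \<Longrightarrow> r + d \<le> D \<Longrightarrow> s = t r \<Longrightarrow> \<delta> = q ^ (2 * d) \<Longrightarrow>
        module_b R E x U 0 = \<alpha> * (coeff_b_first s q \<delta>)"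
    and module_c_d: "\<And>x U r d s \<delta>. irreducible_T_module R x U \<Longrightarrow> r = endpoint R x U \<Longrightarrow>
        d = module_diameter R x U \<Longrightarrow> 1 \<le> d \<Longrightarrow> r + d \<le> D \<Longrightarrow> s = t r \<Longrightarrow> \<delta> = q ^ (2 * d) \<Longrightarrow>
        module_c R E x U d = \<alpha> * (coeff_c_last s q \<delta>)"
    and module_b_i: "\<And>x U r d s \<delta> i \<eta>. irreducible_T_module R x U \<Longrightarrow> r = endpoint R x U \<Longrightarrow>
        d = module_diameter R x U \<Longrightarrow> 1 \<le> i \<Longrightarrow> i < d \<Longrightarrow> r + d \<le> D \<Longrightarrow> s = t r \<Longrightarrow> \<delta> = q ^ (2 * d) \<Longrightarrow>
        \<eta> = q ^ (2 * i) \<Longrightarrow>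
        module_b R E x U i = \<alpha> * (coeff_b s q \<delta> \<eta>)"
    and module_c_i: "\<And>x U r d s \<delta> i \<eta>. irreducible_T_module R x U \<Longrightarrow> r = endpoint R x U \<Longrightarrow>
        d = module_diameter R x U \<Longrightarrow> 1 \<le> i \<Longrightarrow> i < d \<Longrightarrow> r + d \<le> D \<Longrightarrow> s = t r \<Longrightarrow> \<delta> = q ^ (2 * d) \<Longrightarrow>
        \<eta> = q ^ (2 * i) \<Longrightarrow>
        module_c R E x U i = \<alpha> * (coeff_c s q \<delta> \<eta>)"
begin

abbreviation "T \<equiv> spectral_sum D E \<tau>"
abbreviation "Ts x \<equiv> spectral_sum D (F x) \<tau>"

definition "th i = t i + 1 / t i"

lemma tau_nz: "i \<le> D \<Longrightarrow> \<tau> i \<noteq> 0"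
proof (induction i)
  case (Suc i)
  then show ?case using tau_Suc[of i] by auto
qed (simp add: tau_0)

lemma t_add: "t (r + i) = t r * q ^ (2 * i)"
  by (induction i) (simp_all add: t_Suc power2_eq_square)

lemma theta_th: "i \<le> D \<Longrightarrow> \<theta> i = \<alpha> * th i + \<beta>"
  by (simp add: theta_eq th_def)

lemma spectral_theta:
  assumes G: "idempotent_resolution D G"
  shows "spectral_sum D G \<theta> *v v = \<alpha> *s (spectral_sum D G th *v v) + \<beta> *s v"
  by (rule resolution_ext[OF G])
    (simp add: resolution_spectral[OF G] matrix_vector_right_distrib matrix_vec_scale theta_th
      vec.scale_left_distrib)

lemma eigenspace:
  assumes G: "idempotent_resolution D G" and v: "spectral_sum D G \<theta> *v v = \<theta> i *s v" and i: "i \<le> D"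
  shows "G i *v v = v"
proof (cases "v = 0")
  case False
  obtain j where "j \<le> D" "\<theta> i = \<theta> j" "G j *v v = v"
    by (rule spectral_eigenvector[OF G inj v False])
  then show ?thesis using inj_onD[OF inj, of i j] i by simp
qed simp

text \<open>For \<open>d = 0\<close> the module is spanned by a common eigenvector of \<open>A\<close> and \<open>S\<close> with index \<open>r\<close> in
  both, and the relation is immediate. Otherwise the normalized intersection numbers form an
  Askey-Wilson sequence.\<close>

lemma intertwining_on_modules:
  assumes irr: "irreducible_T_module R x U" and v: "v \<in> U"
  shows "A *v (Ts x *v (T *v v)) = Ts x *v (T *v (S x *v v))"
proof -
  define r where "r = endpoint R x U"
  define d where "d = module_diameter R x U"
  have r2: "r = dual_endpoint R E U" using endpoints[OF irr] by (simp add: r_def)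
  let ?b = "\<lambda>i. if i < d then module_b R E x U i else 0"
  let ?c = "\<lambda>i. if i = 0 then 0 else module_c R E x U i"
  show ?thesis
  proof (rule module_action[OF irr thin[OF irr] r_def r2 d_def])
    fix u assume u_U: "u \<in> U" and rd: "r + d \<le> D"
      and coord: "\<And>v. v \<in> U \<Longrightarrow> \<exists>f. v = (\<Sum>i\<le>d. f i *s (F x (r + i) *v u))"
      and low: "\<And>j v. j < r \<Longrightarrow> v \<in> U \<Longrightarrow> E j *v v = 0"
      and mult: "\<And>v. v \<in> U \<Longrightarrow> \<exists>m. E r *v v = m *s u"
      and act: "\<And>f. A *v (\<Sum>i\<le>d. f i *s (F x (r + i) *v u)) =
        (\<Sum>i\<le>d. (?c i * f (i - 1) + (\<theta> r - ?b i - ?c i) * f i + ?b i * f (i + 1)) *s (F x (r + i) *v u))"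
      and u_sum: "(\<Sum>i\<le>d. F x (r + i) *v u) = u"
    let ?u = "\<lambda>i. F x (r + i) *v u"
    obtain f where vf: "v = (\<Sum>i\<le>d. f i *s ?u i)" using coord[OF v] by blast
    have "A *v (Ts x *v (T *v ?u i)) = Ts x *v (T *v (S x *v ?u i))" if i: "i \<le> d" for i
    proof (cases "d = 0")
      case True
      have rD: "r \<le> D" using rd by simp
      have Fu: "F x r *v u = u" using u_sum True by simp
      have "A *v u = \<theta> r *s u" using act[of "\<lambda>_. 1"] u_sum True by simp
      then have "E r *v u = u" by (rule eigenspace[OF E_res _ rD])
      then have "spectral_sum D E \<phi> *v u = \<phi> r *s u" "spectral_sum D (F x) \<phi> *v u = \<phi> r *s u" for \<phi>
        using spectral_resolution[OF E_res rD, of \<phi> u] spectral_resolution[OF F_res rD, of x \<phi> u] Fu by simp_all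
      then show ?thesis using i True Fu by (simp add: matrix_vec_scale mult.commute mult.left_commute)
    next
      case False
      then have d1: "1 \<le> d" by simp
      define s where "s = t r"
      define \<delta> where "\<delta> = q ^ (2 * d)"
      let ?\<omega> = "relation_scale s q \<delta>"
      have t_r: "t (r + i) = s * q ^ (2 * i)" for i by (simp add: s_def t_add)
      have aws: "askey_wilson_sequence s q ?\<omega> d (\<lambda>i. ?b i / \<alpha>) (\<lambda>i. ?c i / \<alpha>)"
        unfolding \<delta>_def
      proof (rule explicit_askey_wilson_sequence, fold \<delta>_def)
        show "s * q ^ (2 * i) * q + 1 \<noteq> 0" if "i < d" for i
        proof
          assume "s * q ^ (2 * i) * q + 1 = 0"
          then have "t (r + i) * q = - 1" by (simp add: t_r eq_neg_iff_add_eq_0)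
          then show False using tq_sq[of "r + i"] rd that by simp
        qed
        show "s ^ 2 * (q ^ (2 * i)) ^ 2 \<noteq> 1" if "1 \<le> i" "i < d" for i
          using t_sq[of "r + i"] rd that by (simp add: t_r power_mult_distrib)
        show "?b 0 / \<alpha> = coeff_b_first s q \<delta>"
          using module_b_0[OF irr r_def d_def d1 rd s_def \<delta>_def] alpha d1 by simp
        show "?c d / \<alpha> = coeff_c_last s q \<delta>"
          using module_c_d[OF irr r_def d_def d1 rd s_def \<delta>_def] alpha d1 by simp
        show "?b i / \<alpha> = coeff_b s q \<delta> \<eta>"
          if "1 \<le> i" "i < d" "\<eta> = q ^ (2 * i)" for i \<eta>
          using module_b_i[OF irr r_def d_def that(1,2) rd s_def \<delta>_def that(3)] alpha that by simp
        show "?c i / \<alpha> = coeff_c s q \<delta> \<eta>"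
          if "1 \<le> i" "i < d" "\<eta> = q ^ (2 * i)" for i \<eta>
          using module_c_i[OF irr r_def d_def that(1,2) rd s_def \<delta>_def that(3)] alpha that by simp
      qed (use q q4 d1 in \<open>simp_all add: s_def t_nz\<close>)
      interpret aw: askey_wilson_module s q ?\<omega> d "\<lambda>i. ?b i / \<alpha>" "\<lambda>i. ?c i / \<alpha>" D r E "F x" t \<tau> th ?u
      proof (intro askey_wilson_module.intro aws askey_wilson_module_axioms.intro)
        show "F x j *v ?u i = (if j = r + i then ?u i else 0)" if "i \<le> d" "j \<le> D" for i j
          using that rd by (auto simp: resolution_idem[OF F_res])
        have u_in: "?u i \<in> U" if "i \<le> d" for i
        proof -
          have "vec.subspace U" "\<And>v. v \<in> U \<Longrightarrow> S x *v v \<in> U"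
            using irr by (auto simp: irreducible_T_module_def T_module_iff invariant_subspace_def)
          then show ?thesis
            using resolution_invariant[OF F_res inj _ _ _ u_U, of x "r + i"] rd that by simp
        qed
        show "E j *v ?u i = 0" if "i \<le> d" "j < r" for i j by (rule low[OF that(2) u_in[OF that(1)]])
        show "\<exists>m. E r *v (\<Sum>i\<le>d. f i *s ?u i) = m *s (\<Sum>i\<le>d. 1 *s ?u i)" for f
        proof -
          have "vec.subspace U"
            using irr by (auto simp: irreducible_T_module_def T_module_def)
          then have "(\<Sum>i\<le>d. f i *s ?u i) \<in> U"
            using u_in by (intro vec.subspace_sum vec.subspace_scale) auto
          then show ?thesis using mult u_sum by simp
        qed
        show "E i *v (spectral_sum D (F x) th *v (E j *v v)) = 0"
          if ij: "i \<le> D" "j \<le> D" "j + 1 < i \<or> i + 1 < j" for i j v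
        proof -
          have "i \<noteq> j" using ij by auto
          have "0 = E i *v (S x *v (E j *v v))" using tri_E[OF ij] by simp
          also have "\<dots> = \<alpha> *s (E i *v (spectral_sum D (F x) th *v (E j *v v)))"
            unfolding spectral_theta[OF F_res] using ij \<open>i \<noteq> j\<close>
            by (simp add: matrix_vector_right_distrib matrix_vec_scale resolution_idem[OF E_res])
          finally show ?thesis using alpha by simp
        qed
        show "spectral_sum D E th *v (\<Sum>i\<le>d. f i *s ?u i)
          = (\<Sum>i\<le>d. (?c i / \<alpha> * f (i - 1) + (s + 1 / s - ?b i / \<alpha> - ?c i / \<alpha>) * f i
              + ?b i / \<alpha> * f (i + 1)) *s ?u i)" for f
        proof -
          let ?w = "\<Sum>i\<le>d. f i *s ?u i"
          have "r \<le> D" using rd by simp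
          have "\<alpha> *s (spectral_sum D E th *v ?w) = A *v ?w - \<beta> *s ?w"
            by (simp add: spectral_theta[OF E_res])
          also have "\<dots> = (\<Sum>i\<le>d. (?c i * f (i - 1) + (\<theta> r - ?b i - ?c i) * f i + ?b i * f (i + 1)
              - \<beta> * f i) *s ?u i)"
            unfolding act by (simp only: vec.scale_sum_right vector_smult_assoc vec.scale_left_diff_distrib
                flip: sum_subtractf)
          also have "\<dots> = (\<Sum>i\<le>d. \<alpha> *s ((?c i / \<alpha> * f (i - 1) + (s + 1 / s - ?b i / \<alpha> - ?c i / \<alpha>) * f i
              + ?b i / \<alpha> * f (i + 1)) *s ?u i))"
            unfolding vector_smult_assoc
          proof (rule sum.cong[OF refl], rule arg_cong[where f = "\<lambda>m. m *s _"])
            fix i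
            show "?c i * f (i - 1) + (\<theta> r - ?b i - ?c i) * f i + ?b i * f (i + 1) - \<beta> * f i
              = \<alpha> * (?c i / \<alpha> * f (i - 1) + (s + 1 / s - ?b i / \<alpha> - ?c i / \<alpha>) * f i + ?b i / \<alpha> * f (i + 1))"
              using alpha theta_eq[OF \<open>r \<le> D\<close>] unfolding s_def
              by (simp only: ring_distribs times_divide_eq_left times_divide_eq_right nonzero_mult_div_cancel_left)
                (simp add: algebra_simps)
          qed
          also have "\<dots> = \<alpha> *s (\<Sum>i\<le>d. (?c i / \<alpha> * f (i - 1) + (s + 1 / s - ?b i / \<alpha> - ?c i / \<alpha>) * f i
              + ?b i / \<alpha> * f (i + 1)) *s ?u i)"
            by (simp only: vec.scale_sum_right)
          finally show ?thesis using alpha by (simp only: vector_mul_lcancel) simp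
        qed
      qed (use E_res F_res t_Suc t_nz t_inj t_prod th_def tau_nz tau_Suc d1 rd s_def in auto)
      show ?thesis
        using aw.intertwining[OF i]
        by (simp add: spectral_theta[OF E_res] spectral_theta[OF F_res] matrix_vector_right_distrib matrix_vec_scale)
    qed
    then show ?thesis unfolding vf by (simp add: matrix_vec_sum matrix_vec_scale)
  qed
qed

lemma matrix_axis: "B *v axis y (1::complex) = (\<chi> z. B $ z $ y)"
  by (simp add: vec_eq_iff matrix_vector_mult_def axis_def if_distrib cong: if_cong)

lemma spectral_F_matrix: "spectral_sum D (F x) \<phi> = (\<chi> y z. if y = z then \<phi> (dst x y) else 0)"
proof -
  have "spectral_sum D (F x) \<phi> $ y $ z = (spectral_sum D (F x) \<phi> *v axis z 1) $ y" for y z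
    by (simp only: matrix_axis vec_lambda_beta)
  then show ?thesis by (auto simp: vec_eq_iff spectral_F_vec axis_def)
qed

lemma intertwining:
  "A *v (Ts x *v (T *v v)) = Ts x *v (T *v (S x *v v))"
proof -
  let ?B = "A ** Ts x ** T - Ts x ** T ** S x"
  have "?B *v v = 0"
  proof (rule vanishes_if_vanishes_on_irreducibles[of A "S x"])
    show "selfadjoint A" using dist_matrix_selfadjoint[of 1] by (simp only: adjacency_spectral)
    show "selfadjoint (S x)"
      using E_real[OF D_pos]
      by (intro selfadjoint_real_symmetric) (auto simp: spectral_F_matrix vec_eq_iff transpose_def theta_entry)
  next
    fix U v assume "irreducible_subspace A (S x) U" "v \<in> U"
    then show "?B *v v = 0"
      using intertwining_on_modules[of x U v] unfolding irreducible_T_module_iff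
      by (simp add: matrix_vector_mult_diff_rdistrib flip: matrix_vector_mul_assoc)
  qed
  then show ?thesis
    by (simp add: matrix_vector_mult_diff_rdistrib flip: matrix_vector_mul_assoc)
qed

lemma braid: "T *v (Ts x *v (T *v v)) = Ts x *v (T *v (Ts x *v v))"
  using intertwine_spectral[OF E_res F_res[of x] inj, of "Ts x ** T" \<tau> v] intertwining[of x]
  by (simp flip: matrix_vector_mul_assoc)

lemma transpose_spectral_E: "transpose (spectral_sum D E \<phi>) = spectral_sum D E \<phi>"
  using E_sym unfolding spectral_sum_def
  by (simp add: vec_eq_iff transpose_def cmat_scale_def)

lemma transpose_spectral_F: "transpose (spectral_sum D (F x) \<phi>) = spectral_sum D (F x) \<phi>"
  by (auto simp: spectral_F_matrix vec_eq_iff transpose_def)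

text \<open>The transpose of the intertwining relation; all four matrices are symmetric.\<close>

lemma intertwining_dual: "S x *v (T *v (Ts x *v v)) = T *v (Ts x *v (A *v v))"
proof -
  have "A ** Ts x ** T = Ts x ** T ** S x"
    by (rule matrix_eq_vecI) (simp add: intertwining flip: matrix_vector_mul_assoc)
  then have "transpose (A ** Ts x ** T) = transpose (Ts x ** T ** S x)" by simp
  then have "T ** (Ts x ** A) = S x ** (T ** Ts x)"
    by (simp add: matrix_transpose_mul transpose_spectral_E transpose_spectral_F)
  then have "(T ** (Ts x ** A)) *v v = (S x ** (T ** Ts x)) *v v" by simp
  then show ?thesis by (simp flip: matrix_vector_mul_assoc)
qed

definition "one = ((\<chi> y. 1) :: complex^'x)"

lemma E0_vec: "E 0 *v v = ((\<Sum>y\<in>UNIV. v $ y) / of_nat CARD('x)) *s one"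
  using idem
  by (simp add: primitive_idempotents_def Let_def vec_eq_iff matrix_vector_mult_def cmat_scale_def
      one_def sum_divide_distrib)

lemma spectral_one_vec: "spectral_sum D E \<phi> *v one = \<phi> 0 *s one"
proof -
  have "E 0 *v one = one" by (simp add: E0_vec one_def)
  then show ?thesis using spectral_resolution[OF E_res, of 0 \<phi> one] by simp
qed

definition "\<kappa> = (\<Sum>i\<le>D. \<tau> i * P 0 i / of_nat CARD('x))"

lemma T_entry: "T $ y $ z = (\<Sum>i\<le>D. \<tau> i * P (dst y z) i / of_nat CARD('x))"
  unfolding spectral_sum_def sum_component
  by (intro sum.cong refl) (simp add: cmat_scale_def E_entry)

lemma dst_0: "dst x y = 0 \<longleftrightarrow> x = y" and dst_self: "dst x x = 0"
  using graph_dist_eq_0[OF conn] by auto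

text \<open>The unit vector at \<open>x\<close> is an eigenvector of \<open>S\<close> for \<open>\<theta>\<^sub>0\<close>. By the intertwining relation \<open>T\<^sup>* T\<close> maps it to
  an eigenvector of \<open>A\<close> for \<open>\<theta>\<^sub>0\<close>, which is constant. Its value is read off at \<open>x\<close>, where
  \<open>\<tau>\<^sub>0 = 1\<close>.\<close>

lemma tau_T: "\<tau> (dst x y) * T $ y $ x = \<kappa>"
proof -
  let ?w = "Ts x *v (T *v axis x 1)"
  have "S x *v axis x 1 = \<theta> 0 *s axis x 1"
    by (simp add: vec_eq_iff spectral_F_vec axis_def dst_self)
  then have "A *v ?w = \<theta> 0 *s ?w" by (simp add: intertwining matrix_vec_scale)
  then have "E 0 *v ?w = ?w" by (rule eigenspace[OF E_res]) simp
  then obtain k where "?w = k *s one" unfolding E0_vec by metis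
  then have k: "\<tau> (dst x y) * T $ y $ x = k" for y
    by (simp add: vec_eq_iff spectral_F_vec matrix_axis one_def)
  have "k = \<kappa>" using k[of x] dst_0[of x x] by (simp add: tau_0 T_entry \<kappa>_def)
  then show ?thesis using k by simp
qed

lemma kappa_nz: "\<kappa> \<noteq> 0"
proof
  assume 0: "\<kappa> = 0"
  fix x :: 'x
  have "T *v axis x 1 = 0"
    using tau_T[of x] tau_nz[OF dst_le] by (simp add: vec_eq_iff matrix_axis 0)
  moreover have "spectral_sum D E (\<lambda>i. 1 / \<tau> i) *v (T *v axis x 1) = axis x 1"
    by (rule spectral_inverse[OF E_res]) (simp add: tau_nz)
  ultimately show False by (simp add: axis_eq_0_iff)
qed

lemma T_eq: "T $ y $ x = \<kappa> / \<tau> (dst x y)"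
  using tau_T[of x y] tau_nz[OF dst_le] by (simp add: field_simps)

text \<open>Dually, \<open>T T\<^sup>*\<close> maps the all-ones vector into the eigenspace of \<open>S\<close> for \<open>\<theta>\<^sub>0\<close>, the
  multiples of the unit vector at \<open>x\<close>. Entrywise this is the type II equation.\<close>

lemma T_Ts_one: "T *v (Ts x *v one) = (of_nat CARD('x) * \<kappa>) *s axis x 1"
proof -
  let ?w = "T *v (Ts x *v one)"
  have "S x *v ?w = \<theta> 0 *s ?w"
    by (simp add: intertwining_dual spectral_one_vec matrix_vec_scale)
  then have "F x 0 *v ?w = ?w" by (rule eigenspace[OF F_res]) simp
  then have off: "?w $ y = 0" if "y \<noteq> x" for y
    using that dual_idempotent_vec[of R x 0 ?w y] dst_0[of x y] by auto
  have "?w $ x = (\<Sum>y\<in>UNIV. T $ x $ y * \<tau> (dst x y))"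
    by (simp add: matrix_vector_mult_def[of T] spectral_F_vec one_def)
  also have "\<dots> = of_nat CARD('x) * \<kappa>"
    using tau_nz[OF dst_le] by (simp add: T_eq graph_dist_commute[OF conn, of _ x])
  finally have on: "?w $ x = of_nat CARD('x) * \<kappa>" .
  show ?thesis using on off by (auto simp: vec_eq_iff axis_def)
qed

lemma tau_ratio_sum:
  "(\<Sum>y\<in>UNIV. \<tau> (dst b y) / \<tau> (dst a y)) = (if a = b then of_nat CARD('x) else 0)"
proof -
  have "\<kappa> * (\<Sum>y\<in>UNIV. \<tau> (dst b y) / \<tau> (dst a y)) = (T *v (Ts b *v one)) $ a"
    by (simp add: matrix_vector_mult_def[of T] spectral_F_vec one_def T_eq sum_distrib_left mult.commute
        graph_dist_commute[OF conn, of _ a])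
  also have "\<dots> = \<kappa> * (if a = b then of_nat CARD('x) else 0)"
    by (simp add: T_Ts_one axis_def)
  finally show ?thesis using kappa_nz by simp
qed

text \<open>With the entries of \<open>T\<close> known, the three parts are readings of the previous lemmas: type II of
  \<open>T_Ts_one\<close>, the spin equation of \<open>braid\<close>, and \<open>M \<subseteq> N(W)\<close> of the
  intertwining relation applied to the unit vector at \<open>b\<close> with base vertex \<open>c\<close>.\<close>

theorem spin_model_afforded:
  assumes f: "f ^ 2 * \<kappa> = complex_of_real (sqrt (real CARD('x)))"
    and W: "W = f *\<^sub>M T"
  shows "spin_model W \<and> affords R W"
proof -
  have f_nz: "f \<noteq> 0" using f by auto
  have W_entry: "W $ a $ b = f * \<kappa> / \<tau> (dst a b)" for a b
    by (simp add: W cmat_scale_def T_eq graph_dist_commute[OF conn, of b])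
  note nz = tau_nz[OF dst_le] kappa_nz f_nz
  have typeII: "type_II W"
    unfolding type_II_def
  proof (intro conjI allI)
    show "transpose W = W"
      by (simp add: vec_eq_iff transpose_def W_entry graph_dist_commute[OF conn])
    show "W $ a $ b \<noteq> 0" for a b using nz by (simp add: W_entry)
    show "(\<Sum>y\<in>UNIV. W $ a $ y / W $ b $ y) = (if a = b then of_nat CARD('x) else 0)" for a b
      using tau_ratio_sum[of b a] nz by (simp add: W_entry)
  qed
  have braid_entry: "(\<Sum>y\<in>UNIV. T $ a $ y * \<tau> (dst c y) * T $ b $ y) = \<tau> (dst c a) * T $ a $ b * \<tau> (dst c b)" for a b c
  proof -
    have sym: "T $ y $ b = T $ b $ y" for y
      by (simp add: T_eq graph_dist_commute[OF conn])
    have "(\<Sum>y\<in>UNIV. T $ a $ y * \<tau> (dst c y) * T $ b $ y) = (T *v (Ts c *v (T *v axis b 1))) $ a"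
      by (simp add: matrix_axis matrix_vector_mult_def[of T] spectral_F_vec sym mult.assoc)
    also have "\<dots> = (Ts c *v (T *v (Ts c *v axis b 1))) $ a" by (simp only: braid)
    also have "Ts c *v axis b 1 = \<tau> (dst c b) *s axis b 1"
      by (simp add: vec_eq_iff spectral_F_vec axis_def)
    finally show ?thesis by (simp add: matrix_vec_scale matrix_axis spectral_F_vec)
  qed
  have spin: "spin_model W"
    unfolding spin_model_def
  proof (intro conjI allI typeII)
    fix a b c
    have "(\<Sum>y\<in>UNIV. W $ a $ y * W $ b $ y / W $ c $ y) = (\<Sum>y\<in>UNIV. f / \<kappa> * (T $ a $ y * \<tau> (dst c y) * T $ b $ y))"
      using nz by (intro sum.cong refl)
        (simp add: W_entry T_eq graph_dist_commute[OF conn, of _ a] graph_dist_commute[OF conn, of _ b] field_simps)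
    also have "\<dots> = f / \<kappa> * (\<tau> (dst c a) * T $ a $ b * \<tau> (dst c b))"
      by (simp only: braid_entry flip: sum_distrib_left)
    also have "\<dots> = (f ^ 2 * \<kappa>) * (W $ a $ b / (W $ a $ c * W $ b $ c))"
      using nz by (simp add: W_entry T_eq graph_dist_commute[OF conn, of _ c] graph_dist_commute[OF conn, of b a]
          field_simps power2_eq_square)
    finally show "(\<Sum>y\<in>UNIV. W $ a $ y * W $ b $ y / W $ c $ y)
      = complex_of_real (sqrt (real CARD('x))) * (W $ a $ b / (W $ a $ c * W $ b $ c))"
      by (simp only: f)
  qed
  have BM: "bose_mesner R = cmat.span (E ` {..D})"
    using idem by (simp add: primitive_idempotents_def Let_def D_def)
  have "W \<in> bose_mesner R"
    unfolding BM W spectral_sum_def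
    by (intro cmat.span_scale cmat.span_sum) (auto intro: cmat.span_base)
  moreover have "bose_mesner R \<subseteq> nomura_algebra W"
    unfolding BM
  proof (rule cmat.span_minimal)
    show "cmat.subspace (nomura_algebra W)"
    proof -
      have sym_add: "transpose (B + C) = transpose B + transpose C" for B C :: "complex^'x^'x"
        by (simp add: vec_eq_iff transpose_def)
      have sym_scale: "transpose (k *\<^sub>M B) = k *\<^sub>M transpose B" for k and B :: "complex^'x^'x"
        by (simp add: vec_eq_iff transpose_def cmat_scale_def)
      let ?NW = "{B. transpose B = B \<and>
          (\<forall>b c. \<exists>k. B *v spin_vector W b c = k *s spin_vector W b c)}"
      show ?thesis
        unfolding cmat.subspace_def nomura_algebra_def mem_Collect_eq
      proof (intro conjI ballI allI)
        show "transpose (0 :: complex^'x^'x) = 0" by (simp add: vec_eq_iff transpose_def)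
        show "\<exists>k. 0 *v spin_vector W b c = k *s spin_vector W b c" for b c
          by (intro exI[of _ 0]) simp
      next
        fix B C assume B: "B \<in> ?NW"
          and C: "C \<in> ?NW"
        show "transpose (B + C) = B + C" using B C by (simp add: sym_add)
        fix b c
        obtain k l where "B *v spin_vector W b c = k *s spin_vector W b c"
            "C *v spin_vector W b c = l *s spin_vector W b c" using B C by blast
        then have "(B + C) *v spin_vector W b c = (k + l) *s spin_vector W b c"
          by (simp add: matrix_vector_mult_add_rdistrib vec.scale_left_distrib)
        then show "\<exists>k. (B + C) *v spin_vector W b c = k *s spin_vector W b c" by blast
      next
        fix m B assume B: "B \<in> ?NW"
        show "transpose (m *\<^sub>M B) = m *\<^sub>M B" using B by (simp add: sym_scale)
        fix b c
        obtain k where "B *v spin_vector W b c = k *s spin_vector W b c" using B by blast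
        then have "(m *\<^sub>M B) *v spin_vector W b c = (m * k) *s spin_vector W b c"
          by (simp add: cmat_scale_vec)
        then show "\<exists>k. (m *\<^sub>M B) *v spin_vector W b c = k *s spin_vector W b c" by blast
      qed
    qed
    show "E ` {..D} \<subseteq> nomura_algebra W"
    proof
      fix B assume "B \<in> E ` {..D}"
      then obtain i where i: "i \<le> D" "B = E i" by auto
      have "\<exists>k. E i *v spin_vector W b c = k *s spin_vector W b c" for b c
      proof -
        let ?v = "spin_vector W b c"
        have "?v = (1 / \<kappa>) *s (Ts c *v (T *v axis b 1))"
          using nz by (simp add: vec_eq_iff spin_vector_def W_entry matrix_axis spectral_F_vec T_eq)
        moreover have "S c *v axis b 1 = \<theta> (dst c b) *s axis b 1"
          by (simp add: vec_eq_iff spectral_F_vec axis_def)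
        ultimately have eig: "A *v ?v = \<theta> (dst c b) *s ?v"
          by (simp add: matrix_vec_scale intertwining mult.commute)
        have "?v \<noteq> 0" using nz by (auto simp: vec_eq_iff spin_vector_def W_entry)
        then obtain j where "j \<le> D" "E j *v ?v = ?v"
          using spectral_eigenvector[OF E_res inj eig] by metis
        then have "E i *v ?v = (if i = j then 1 else 0) *s ?v"
          using resolution_idem[OF E_res i(1), of j ?v] by auto
        then show ?thesis by blast
      qed
      then show "B \<in> nomura_algebra W" using i E_sym by (simp add: nomura_algebra_def)
    qed
  qed
  ultimately show ?thesis using spin by (simp add: affords_def)
qed

end

section \<open>The normalizing scalar\<close>

text \<open>Newton interpolation for divided differences given by their recursion. Replacing the lower
  endpoint \<open>i\<close> by \<open>i + 1\<close> changes the expansion by a telescoping sum, which is the induction step.\<close>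

lemma newton_interpolation:
  fixes F :: "nat \<Rightarrow> nat \<Rightarrow> complex" and y :: "nat \<Rightarrow> complex"
  assumes rec: "\<And>i h. i + h < D \<Longrightarrow> F i (Suc h) * (y (i + Suc h) - y i) = F (Suc i) h - F i h"
  shows "i + n \<le> D \<Longrightarrow> (\<Sum>h\<le>n. F i h * (\<Prod>l<h. y (i + n) - y (i + l))) = F (i + n) 0"
proof (induction n arbitrary: i)
  case (Suc n)
  define z where "z = y (i + Suc n)"
  define R where "R h = (\<Prod>l<h. z - y (Suc i + l))" for h
  define Q where "Q h = (\<Prod>l<h. z - y (i + l))" for h
  have Q_Suc: "Q (Suc h) = (z - y i) * R h" for h
    unfolding Q_def R_def by (subst prod.lessThan_Suc_shift) simp
  have R_Suc: "R (Suc h) = R h * (z - y (i + Suc h))" for h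
    by (simp add: R_def)
  have step: "F i (Suc h) * Q (Suc h) = F (Suc i) h * R h + (F i (Suc h) * R (Suc h) - F i h * R h)" if "h \<le> n" for h
  proof -
    have "F i (Suc h) * Q (Suc h) = F i (Suc h) * (y (i + Suc h) - y i) * R h + F i (Suc h) * R (Suc h)"
      unfolding Q_Suc R_Suc by (simp add: algebra_simps)
    also have "F i (Suc h) * (y (i + Suc h) - y i) = F (Suc i) h - F i h"
      by (rule rec) (use Suc.prems that in simp)
    finally show ?thesis by (simp add: algebra_simps)
  qed
  have tel: "(\<Sum>h\<le>m. g (Suc h) - g h) = g (Suc m) - g 0" for g :: "nat \<Rightarrow> complex" and m
    by (induction m) simp_all
  have "(\<Sum>h\<le>Suc n. F i h * Q h) = F i 0 * Q 0 + (\<Sum>h\<le>n. F i (Suc h) * Q (Suc h))"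
    by (rule sum.atMost_Suc_shift)
  also have "(\<Sum>h\<le>n. F i (Suc h) * Q (Suc h))
      = (\<Sum>h\<le>n. F (Suc i) h * R h) + (\<Sum>h\<le>n. F i (Suc h) * R (Suc h) - F i h * R h)"
    unfolding sum.distrib[symmetric] by (intro sum.cong refl) (simp add: step)
  also have "(\<Sum>h\<le>n. F (Suc i) h * R h) = F (i + Suc n) 0"
    using Suc.IH[of "Suc i"] Suc.prems by (simp add: R_def z_def)
  also have "(\<Sum>h\<le>n. F i (Suc h) * R (Suc h) - F i h * R h) = F i (Suc n) * R (Suc n) - F i 0 * R 0"
    by (rule tel)
  also have "R (Suc n) = 0" by (simp add: R_Suc z_def)
  finally have "(\<Sum>h\<le>Suc n. F i h * Q h) = F (i + Suc n) 0"
    by (simp add: Q_def R_def)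
  then show ?case by (simp only: Q_def z_def)
qed simp

text \<open>Multiplied by \<open>1/\<tau>\<^sub>i\<close>, this is the \<open>h\<close>-th divided difference of the values \<open>1/\<tau>\<^sub>j\<close> at the
  eigenvalues \<open>t\<^sub>j + 1/t\<^sub>j\<close>, starting at the node \<open>t = t\<^sub>i\<close>.\<close>

definition qprod :: "complex \<Rightarrow> complex \<Rightarrow> nat \<Rightarrow> complex"
  where "qprod q t h = (\<Prod>j<h. - (t * q ^ Suc j) / ((q ^ Suc j - 1 / q ^ Suc j) * (t * q ^ (2 * j + 1) - 1)))"

lemma qprod_shift:
  assumes q: "q \<noteq> 0" and nz: "\<And>j. j \<le> h \<Longrightarrow> t * q ^ (2 * j + 1) \<noteq> 1"
  shows "qprod q (t * q ^ 2) h * (t * q ^ (2 * h + 1) - 1) = q ^ (2 * h) * (t * q - 1) * qprod q t h"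
  using nz
proof (induction h)
  case (Suc h)
  define W where "W = q ^ Suc h - 1 / q ^ Suc h"
  have IH: "qprod q (t * q ^ 2) h * (t * q ^ (2 * h + 1) - 1) = q ^ (2 * h) * (t * q - 1) * qprod q t h"
    using Suc by simp
  have n1: "t * q ^ (2 * h + 1) - 1 \<noteq> 0" and n2: "t * q ^ (2 * Suc h + 1) - 1 \<noteq> 0"
    using Suc.prems[of h] Suc.prems[of "Suc h"] by auto
  have e: "t * q ^ 2 * q ^ (2 * h + 1) = t * q ^ (2 * Suc h + 1)" by (simp add: power2_eq_square)
  have "qprod q (t * q ^ 2) (Suc h) * (t * q ^ (2 * Suc h + 1) - 1)
      = qprod q (t * q ^ 2) h * (- (t * q ^ 2 * q ^ Suc h) / W)"
    unfolding qprod_def prod.lessThan_Suc e W_def[symmetric] using n2 by simp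
  also have "\<dots> = q ^ 2 * (qprod q (t * q ^ 2) h * (t * q ^ (2 * h + 1) - 1))
      * (- (t * q ^ Suc h) / (W * (t * q ^ (2 * h + 1) - 1)))"
    using n1 by (simp add: mult_ac)
  also have "\<dots> = q ^ (2 * Suc h) * (t * q - 1) * (qprod q t h * (- (t * q ^ Suc h) / (W * (t * q ^ (2 * h + 1) - 1))))"
    unfolding IH by (simp add: power2_eq_square mult_ac)
  also have "\<dots> = q ^ (2 * Suc h) * (t * q - 1) * qprod q t (Suc h)"
    by (simp only: qprod_def prod.lessThan_Suc W_def)
  finally show ?case .
qed (simp add: qprod_def)

lemma graph_c_count:
  assumes dr: "distance_regular R" and D: "1 \<le> graph_diameter R" and xy: "graph_dist R y x = Suc h"
  shows "card {z. graph_dist R y z = 1 \<and> graph_dist R x z = h} = graph_c R (Suc h)"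
proof -
  have conn: "connected_simple_graph R" using dr by (simp add: distance_regular_def)
  have "Suc h \<le> graph_diameter R" using graph_dist_le_diameter[OF conn, of y x] xy by simp
  then obtain n where n: "\<forall>x y. graph_dist R x y = Suc h \<longrightarrow>
      card {z. graph_dist R x z = 1 \<and> graph_dist R y z = h} = n"
    using dr D unfolding distance_regular_def by (meson Suc_leD)
  have "graph_c R (Suc h) = n"
    unfolding graph_c_def intersection_number_def diff_Suc_1
    by (rule the_equality) (use n xy in auto)
  then show ?thesis using n xy by simp
qed

text \<open>Both sides are the product of \<open>y\<^sub>1, \<dots>, y\<^sub>2\<^sub>n\<^sub>+\<^sub>1\<close>: once split in the middle, once into odd and even
  indices.\<close>

lemma merge_products:
  fixes y :: "nat \<Rightarrow> complex"
  shows "(\<Prod>j<Suc n. y (Suc j)) * (\<Prod>j<n. y (Suc n + Suc j))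
    = (\<Prod>j<Suc n. y (2 * j + 1)) * (\<Prod>j<n. y (2 * j + 2))"
proof -
  have "(\<Prod>j<m. y (Suc j)) * (\<Prod>j<k. y (m + Suc j)) = (\<Prod>j<m + k. y (Suc j))" for m k
    by (induction k) (simp_all add: mult.assoc[symmetric])
  moreover have "(\<Prod>j<n. y (2 * j + 1)) * (\<Prod>j<n. y (2 * j + 2)) = (\<Prod>j<2 * n. y (Suc j))"
    by (induction n) (simp_all add: mult_ac)
  then have "(\<Prod>j<Suc n. y (2 * j + 1)) * (\<Prod>j<n. y (2 * j + 2)) = (\<Prod>j<Suc (2 * n). y (Suc j))"
    by (simp add: mult_ac)
  moreover have "Suc (2 * n) = Suc n + n" by simp
  ultimately show ?thesis by (simp only:)
qed

text \<open>With \<open>y\<^sub>m = s\<^sup>2q\<^sup>2\<^sup>m - 1\<close>, all quadratic factors are values of \<open>y\<close>. The \<open>c\<^sub>j\<close> contribute the indices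
  above \<open>D\<close> and the even indices inversely, the divided difference contributes the odd indices inversely
  (together with the factors \<open>s\<eta>\<^sub>j + q\<close> of the \<open>c\<^sub>j\<close>), and the last product on the left contributes the
  indices up to \<open>D\<close>; by \<open>merge_products\<close> they cancel. What is left agrees after the reversal
  \<open>j \<mapsto> D - 1 - j\<close>.\<close>

lemma scalar_identity:
  fixes s q :: complex and D :: nat and c :: "nat \<Rightarrow> complex"
  defines "\<delta> \<equiv> q ^ (2 * D)" and "\<eta> \<equiv> \<lambda>j. q ^ (2 * Suc j)"
  assumes D: "1 \<le> D" and s: "s \<noteq> 0" and q: "q \<noteq> 0"
    and \<eta>_nz: "\<And>j. j < D \<Longrightarrow> \<eta> j \<noteq> 1"
    and s_odd: "\<And>j. j < D \<Longrightarrow> s ^ 2 * \<eta> j ^ 2 \<noteq> q ^ 2"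
    and s_even: "\<And>j. Suc j < D \<Longrightarrow> s ^ 2 * \<eta> j ^ 2 \<noteq> 1"
    and c: "\<And>j. Suc j < D \<Longrightarrow> c j = coeff_c s q \<delta> (\<eta> j)"
    and c_last: "c (D - 1) = coeff_c_last s q \<delta>"
  shows "qprod q s D * (\<Prod>j<D. c j) * (\<Prod>j<D. 1 - q ^ (2 * j) / (s ^ 2 * \<delta>))
    = (\<Prod>j<D. - q / (s * \<eta> j)) * (\<Prod>j<D. 1 - s * q ^ (2 * j + 1))"
proof -
  obtain n where n: "D = Suc n" using D by (cases D) auto
  define y where "y m = s ^ 2 * q ^ (2 * m) - 1" for m
  \<comment> \<open>At the last index the quotient \<open>y\<^sub>2\<^sub>D / y\<^sub>2\<^sub>D\<close> is cancelled in
    \<open>c\<close>, and \<open>y\<^sub>2\<^sub>D\<close> may be zero.\<close>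
  define r where "r j = (if j < n then y (D + Suc j) / y (2 * j + 2) else 1)" for j
  have \<delta>: "\<delta> \<noteq> 0" using q by (simp add: \<delta>_def)
  have \<eta>: "\<eta> j \<noteq> 0" for j using q by (simp add: \<eta>_def)
  have \<eta>2: "\<eta> j ^ 2 = q ^ (2 * (2 * j + 2))" for j
  proof -
    have "2 * Suc j * 2 = 2 * (2 * j + 2)" by simp
    then show ?thesis unfolding \<eta>_def power_mult[symmetric] by (simp only:)
  qed
  have y_even: "y (2 * j + 2) = s ^ 2 * \<eta> j ^ 2 - 1" for j by (simp add: y_def \<eta>2)
  have y_odd: "q ^ 2 * y (2 * j + 1) = s ^ 2 * \<eta> j ^ 2 - q ^ 2" for j
    unfolding y_def \<eta>2 by (simp add: algebra_simps power2_eq_square)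
  have y_far: "y (D + Suc j) = s ^ 2 * \<delta> * \<eta> j - 1" for j
    by (simp add: y_def \<delta>_def \<eta>_def power_add algebra_simps)
  have y_one: "y (Suc j) = s ^ 2 * \<eta> j - 1" for j by (simp add: y_def \<eta>_def)
  have factors: "s * \<eta> j + q \<noteq> 0" "s * \<eta> j - q \<noteq> 0" if "j < D" for j
  proof -
    have "(s * \<eta> j + q) * (s * \<eta> j - q) \<noteq> 0"
      using s_odd[OF that] by (simp add: algebra_simps power2_eq_square)
    then show "s * \<eta> j + q \<noteq> 0" "s * \<eta> j - q \<noteq> 0" by auto
  qed
  have c_r: "c j = (\<eta> j - 1) * r j * (\<eta> j - s * \<delta> * q) / (\<delta> * (s * \<eta> j + q))" if "j < D" for j
  proof (cases "j < n")
    case True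
    then have "r j = (s ^ 2 * \<delta> * \<eta> j - 1) / (s ^ 2 * \<eta> j ^ 2 - 1)"
      unfolding r_def y_even y_far by (simp only: if_True)
    moreover have "Suc j < D" using True n by simp
    ultimately show ?thesis using c[of j] by simp
  next
    case False
    then have "j = n" using that n by simp
    then have j: "j = n" "\<eta> j = \<delta>" using n by (simp_all add: \<eta>_def \<delta>_def)
    have "c j = coeff_c_last s q \<delta>" using c_last j n by simp
    also have "\<dots> = (\<delta> - 1) * (\<delta> - s * \<delta> * q) / (\<delta> * (s * \<delta> + q))"
    proof -
      have "(\<delta> - 1) * (\<delta> - s * \<delta> * q) = \<delta> * ((1 - \<delta>) * (s * q - 1))" by (simp add: algebra_simps)
      then show ?thesis using \<delta> by simp
    qed
    finally show ?thesis using j by (simp add: r_def)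
  qed
  have G: "- (s * q ^ Suc j) / ((q ^ Suc j - 1 / q ^ Suc j) * (s * q ^ (2 * j + 1) - 1))
      = - (s * \<eta> j * q) / ((\<eta> j - 1) * (s * \<eta> j - q))" if "j < D" for j
  proof -
    define p where "p = q ^ Suc j"
    have p: "p \<noteq> 0" "p ^ 2 = \<eta> j" using q by (simp_all add: p_def \<eta>_def power_mult_distrib flip: power_mult power_Suc) (simp add: mult.commute)
    have e1: "p - 1 / p = (\<eta> j - 1) / p" using p by (simp add: field_simps power2_eq_square)
    have e2: "s * q ^ (2 * j + 1) - 1 = (s * \<eta> j - q) / q" using q by (simp add: \<eta>_def field_simps)
    show ?thesis unfolding p_def[symmetric] e1 e2 using p q by (simp add: power2_eq_square mult_ac)
  qed
  have factor_eq: "- (s * q ^ Suc j) / ((q ^ Suc j - 1 / q ^ Suc j) * (s * q ^ (2 * j + 1) - 1)) * c j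
      = - q / (s * \<eta> j) * (s ^ 2 * \<eta> j ^ 2 / (\<delta> * q ^ 2)) * (r j / y (2 * j + 1)) * (\<eta> j - s * \<delta> * q)" if "j < D" for j
  proof -
    have "- (s * \<eta> j * q) / ((\<eta> j - 1) * (s * \<eta> j - q)) * c j
      = - (s * \<eta> j * q) * r j * (\<eta> j - s * \<delta> * q) / (\<delta> * ((s * \<eta> j - q) * (s * \<eta> j + q)))"
      unfolding c_r[OF that] using \<eta>_nz[OF that] by (simp add: mult_ac)
    also have "(s * \<eta> j - q) * (s * \<eta> j + q) = q ^ 2 * y (2 * j + 1)"
      unfolding y_odd by (simp add: algebra_simps power2_eq_square)
    finally show ?thesis
      unfolding G[OF that] using s q \<eta>[of j] by (simp add: power2_eq_square mult_ac)
  qed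
  have rev1: "(\<Prod>j<D. \<eta> j - s * \<delta> * q) = (\<Prod>j<D. \<eta> j) * (\<Prod>j<D. 1 - s * q ^ (2 * j + 1))"
  proof -
    have "\<eta> j - s * \<delta> * q = \<eta> j * (1 - s * q ^ (2 * (D - Suc j) + 1))" if "j < D" for j
    proof -
      have "\<delta> = \<eta> j * q ^ (2 * (D - Suc j))"
        unfolding \<delta>_def \<eta>_def power_add[symmetric] using that by (intro arg_cong[where f = "power q"]) simp
      then show ?thesis by (simp add: algebra_simps)
    qed
    then have "(\<Prod>j<D. \<eta> j - s * \<delta> * q) = (\<Prod>j<D. \<eta> j * (1 - s * q ^ (2 * (D - Suc j) + 1)))"
      by (intro prod.cong) auto
    also have "\<dots> = (\<Prod>j<D. \<eta> j) * (\<Prod>j<D. 1 - s * q ^ (2 * (D - Suc j) + 1))" by (rule prod.distrib)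
    also have "(\<Prod>j<D. 1 - s * q ^ (2 * (D - Suc j) + 1)) = (\<Prod>j<D. 1 - s * q ^ (2 * j + 1))"
      by (rule prod.nat_diff_reindex[of "\<lambda>j. 1 - s * q ^ (2 * j + 1)"])
    finally show ?thesis .
  qed
  have rev2: "(\<Prod>j<D. 1 - q ^ (2 * j) / (s ^ 2 * \<delta>)) = (\<Prod>j<D. y (Suc j) / (s ^ 2 * \<eta> j))"
  proof -
    have "(\<Prod>j<D. 1 - q ^ (2 * j) / (s ^ 2 * \<delta>)) = (\<Prod>j<D. 1 - q ^ (2 * (D - Suc j)) / (s ^ 2 * \<delta>))"
      by (rule prod.nat_diff_reindex[symmetric])
    also have "\<dots> = (\<Prod>j<D. y (Suc j) / (s ^ 2 * \<eta> j))"
    proof (rule prod.cong[OF refl])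
      fix j assume "j \<in> {..<D}"
      then have "\<delta> = \<eta> j * q ^ (2 * (D - Suc j))"
        unfolding \<delta>_def \<eta>_def power_add[symmetric] by (intro arg_cong[where f = "power q"]) simp
      then show "1 - q ^ (2 * (D - Suc j)) / (s ^ 2 * \<delta>) = y (Suc j) / (s ^ 2 * \<eta> j)"
        using s q \<eta>[of j] by (simp add: y_one diff_divide_distrib)
    qed
    finally show ?thesis .
  qed
  \<comment> \<open>Pair \<open>j\<close> with \<open>D - 1 - j\<close>: the exponents of the two factors sum to \<open>2 D +
    2\<close>.\<close>
  have rev3: "(\<Prod>j<D. \<eta> j ^ 2) = (\<Prod>j<D. \<delta> * q ^ 2)"
  proof -
    have "(\<Prod>j<D. \<eta> j) = (\<Prod>j<D. \<eta> (D - Suc j))" by (rule prod.nat_diff_reindex[symmetric])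
    then have "(\<Prod>j<D. \<eta> j ^ 2) = (\<Prod>j<D. \<eta> j * \<eta> (D - Suc j))"
      by (simp add: power2_eq_square prod.distrib)
    also have "\<dots> = (\<Prod>j<D. \<delta> * q ^ 2)"
      unfolding \<delta>_def \<eta>_def power_add[symmetric] by (intro prod.cong refl arg_cong[where f = "power q"]) auto
    finally show ?thesis .
  qed
  have ratio: "(\<Prod>j<D. r j / y (2 * j + 1)) * (\<Prod>j<D. y (Suc j)) = 1"
  proof -
    have nz: "y (2 * j + 1) \<noteq> 0" if "j < D" for j
    proof
      assume "y (2 * j + 1) = 0"
      then show False using y_odd[of j] s_odd[OF that] by simp
    qed
    have nz2: "y (2 * j + 2) \<noteq> 0" if "j < n" for j
      using s_even[of j] that n unfolding y_even by simp
    have r: "(\<Prod>j<D. r j) = (\<Prod>j<n. y (D + Suc j)) / (\<Prod>j<n. y (2 * j + 2))"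
      unfolding n prod.lessThan_Suc by (simp add: r_def n flip: prod_dividef)
    have "(\<Prod>j<D. y (Suc j)) * (\<Prod>j<n. y (D + Suc j)) = (\<Prod>j<D. y (2 * j + 1)) * (\<Prod>j<n. y (2 * j + 2))"
      unfolding n by (rule merge_products)
    moreover have "(\<Prod>j<D. y (2 * j + 1)) \<noteq> 0" "(\<Prod>j<n. y (2 * j + 2)) \<noteq> 0" using nz nz2 by auto
    ultimately show ?thesis unfolding prod_dividef r by (simp add: field_simps)
  qed
  have "qprod q s D * (\<Prod>j<D. c j) * (\<Prod>j<D. 1 - q ^ (2 * j) / (s ^ 2 * \<delta>))
     = (\<Prod>j<D. - q / (s * \<eta> j) * (s ^ 2 * \<eta> j ^ 2 / (\<delta> * q ^ 2)) * (r j / y (2 * j + 1)) * (\<eta> j - s * \<delta> * q))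
       * (\<Prod>j<D. y (Suc j) / (s ^ 2 * \<eta> j))"
    unfolding qprod_def prod.distrib[symmetric] rev2 using factor_eq by (simp add: mult.assoc)
  also have "\<dots> = (\<Prod>j<D. - q / (s * \<eta> j)) * ((\<Prod>j<D. \<eta> j ^ 2) / (\<Prod>j<D. \<delta> * q ^ 2))
      * ((\<Prod>j<D. r j / y (2 * j + 1)) * (\<Prod>j<D. y (Suc j)))
      * ((\<Prod>j<D. \<eta> j - s * \<delta> * q) / (\<Prod>j<D. \<eta> j))"
    unfolding prod_dividef[symmetric] prod.distrib[symmetric]
    by (intro prod.cong refl) (use s q \<eta> \<delta> in \<open>simp add: mult_ac\<close>)
  also have "\<dots> = (\<Prod>j<D. - q / (s * \<eta> j)) * (\<Prod>j<D. 1 - s * q ^ (2 * j + 1))"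
    unfolding ratio rev1 rev3 using \<eta> \<delta> q by simp
  finally show ?thesis .
qed

context spin_graph
begin

definition "divided_difference i h = 1 / \<tau> i * qprod q (t i) h"

lemma power_q_ne_1: "1 \<le> i \<Longrightarrow> i \<le> D \<Longrightarrow> q ^ (2 * i) \<noteq> 1"
  using t_inj[of 0 i] t_add[of 0 i] by auto

lemma th_diff: "th (i + h) - th i = (q ^ h - 1 / q ^ h) * (t i * q ^ h - 1 / (t i * q ^ h))"
proof -
  have "q ^ (2 * h) = q ^ h * q ^ h" by (simp flip: power_add add: mult_2)
  then have "t (i + h) = t i * (q ^ h * q ^ h)" by (simp add: t_add[of i h])
  then show ?thesis using t_nz[of i] q unfolding th_def by (simp add: field_simps)
qed

lemma divided_difference_rec:
  assumes ih: "i + h < D"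
  shows "divided_difference i (Suc h) * (th (i + Suc h) - th i) = divided_difference (Suc i) h - divided_difference i h"
proof -
  let ?t = "t i" and ?v = "q ^ Suc h"
  let ?W = "?v - 1 / ?v" and ?M = "?t * q ^ (2 * h + 1) - 1"
  have ne: "?t * q ^ (2 * j + 1) \<noteq> 1" if "j \<le> h" for j
  proof
    assume "?t * q ^ (2 * j + 1) = 1"
    then have "t (i + j) * q = 1" by (simp add: t_add[of i j] mult_ac)
    then show False using tq_sq[of "i + j"] ih that by simp
  qed
  then have M: "?M \<noteq> 0" by simp
  have v2: "?v ^ 2 = q ^ (2 * Suc h)" by (simp only: power_mult[symmetric] mult.commute)
  have W: "?W \<noteq> 0"
  proof
    assume "?W = 0"
    then have "?v ^ 2 = 1" using q by (simp add: field_simps power2_eq_square)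
    then show False using power_q_ne_1[of "Suc h"] ih v2 by simp
  qed
  have vt: "?v \<noteq> 0" "?t \<noteq> 0" using q t_nz by auto
  define w where "w = ?t ^ 2 * ?v ^ 2 - 1"
  have "divided_difference i (Suc h) = divided_difference i h * (- (?t * ?v) / (?W * ?M))"
    by (simp only: divided_difference_def qprod_def prod.lessThan_Suc mult.assoc)
  then have "divided_difference i (Suc h) * (th (i + Suc h) - th i)
      = divided_difference i h * (- (?t * ?v) / (?W * ?M)) * (?W * (?t * ?v - 1 / (?t * ?v)))"
    by (simp only: th_diff)
  also have "\<dots> = divided_difference i h * (- ((?t * ?v) * (?t * ?v - 1 / (?t * ?v))) / ?M)"
    using W by simp
  also have "(?t * ?v) * (?t * ?v - 1 / (?t * ?v)) = w"
    using vt by (simp add: w_def right_diff_distrib power2_eq_square mult_ac del: power_Suc)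
  finally have lhs: "divided_difference i (Suc h) * (th (i + Suc h) - th i) * ?M = - divided_difference i h * w"
    using M by simp
  have "1 / \<tau> (Suc i) = - (?t * q) / \<tau> i"
    using tau_Suc[of i] tau_nz[of i] tau_nz[of "Suc i"] ih by (simp add: field_simps)
  then have "divided_difference (Suc i) h * ?M = - (?t * q) / \<tau> i * (qprod q (?t * q ^ 2) h * ?M)"
    by (simp add: divided_difference_def t_Suc)
  also have "qprod q (?t * q ^ 2) h * ?M = q ^ (2 * h) * (?t * q - 1) * qprod q ?t h"
    by (rule qprod_shift[OF q ne])
  also have "- (?t * q) / \<tau> i * (q ^ (2 * h) * (?t * q - 1) * qprod q ?t h)
      = - (?t * q) * (q ^ (2 * h) * (?t * q - 1)) * divided_difference i h"
    by (simp add: divided_difference_def)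
  finally have "(divided_difference (Suc i) h - divided_difference i h) * ?M = - divided_difference i h * w"
    unfolding w_def v2 left_diff_distrib by (simp add: algebra_simps power2_eq_square)
  then show ?thesis using lhs M by (metis mult_right_cancel)
qed

lemma inverse_tau_newton: "n \<le> D \<Longrightarrow> 1 / \<tau> n = (\<Sum>h\<le>n. divided_difference 0 h * (\<Prod>l<h. th n - th l))"
  using newton_interpolation[of D divided_difference th 0 n] divided_difference_rec by (simp add: divided_difference_def[of n] qprod_def)

text \<open>The basis of Newton polynomials, evaluated at the normalized adjacency matrix and applied to the
  unit vector at \<open>x\<close>.\<close>

primrec path_vector :: "'x \<Rightarrow> nat \<Rightarrow> complex^'x" where
  "path_vector x 0 = axis x 1"
| "path_vector x (Suc h) = spectral_sum D E th *v path_vector x h - th h *s path_vector x h"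

lemma E_path_vector: "j \<le> D \<Longrightarrow> E j *v path_vector x h = (\<Prod>l<h. th j - th l) *s (E j *v axis x 1)"
proof (induction h)
  case (Suc h)
  then show ?case
    by (simp add: matrix_vector_mult_diff_distrib matrix_vec_scale resolution_spectral[OF E_res]
        vec.scale_left_diff_distrib algebra_simps)
qed simp

lemma inverse_T_axis:
  "spectral_sum D E (\<lambda>i. 1 / \<tau> i) *v axis x 1 = (\<Sum>h\<le>D. divided_difference 0 h *s path_vector x h)"
proof (rule resolution_ext[OF E_res])
  fix j assume j: "j \<le> D"
  have "(\<Sum>h\<le>D. divided_difference 0 h * (\<Prod>l<h. th j - th l)) = (\<Sum>h\<le>j. divided_difference 0 h * (\<Prod>l<h. th j - th l))"
  proof (rule sum.mono_neutral_right)
    show "\<forall>h\<in>{..D} - {..j}. divided_difference 0 h * (\<Prod>l<h. th j - th l) = 0"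
      by (auto intro!: prod_zero bexI[of _ j])
  qed (use j in auto)
  also have "\<dots> = 1 / \<tau> j" by (rule inverse_tau_newton[OF j, symmetric])
  finally show "E j *v (spectral_sum D E (\<lambda>i. 1 / \<tau> i) *v axis x 1)
      = E j *v (\<Sum>h\<le>D. divided_difference 0 h *s path_vector x h)"
    using j by (simp add: resolution_spectral[OF E_res] matrix_vec_sum matrix_vec_scale E_path_vector
        flip: vec.scale_sum_left)
qed

text \<open>A polynomial of degree \<open>h\<close> in the adjacency matrix reaches no further than distance \<open>h\<close>, and at
  distance \<open>h\<close> only its leading term counts: the number of shortest paths, which is
  \<open>c\<^sub>1 \<cdots> c\<^sub>h\<close>. The powers of \<open>\<alpha>\<close> come from the normalization of the eigenvalues.\<close>

lemma path_vector_entry: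
  "(h < dst x y \<longrightarrow> path_vector x h $ y = 0) \<and>
   (dst x y = h \<longrightarrow> path_vector x h $ y = (\<Prod>j<h. of_nat (graph_c R (Suc j)) / \<alpha>))"
proof (induction h arbitrary: y)
  case 0
  show ?case by (simp add: axis_def dst_0)
next
  case (Suc h)
  let ?w = "path_vector x h"
  have X: "\<alpha> * (spectral_sum D E th *v ?w) $ y = (\<Sum>z\<in>UNIV. if dst y z = 1 then ?w $ z else 0) - \<beta> * ?w $ y"
  proof -
    have "dist_matrix R 1 *v ?w = \<alpha> *s (spectral_sum D E th *v ?w) + \<beta> *s ?w"
      unfolding adjacency_spectral by (rule spectral_theta[OF E_res])
    moreover have "(dist_matrix R 1 *v ?w) $ y = (\<Sum>z\<in>UNIV. if dst y z = 1 then ?w $ z else 0)"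
      unfolding matrix_vector_mult_def dist_matrix_def vec_lambda_beta by (intro sum.cong refl) auto
    ultimately have "(\<Sum>z\<in>UNIV. if dst y z = 1 then ?w $ z else 0)
        = \<alpha> * (spectral_sum D E th *v ?w) $ y + \<beta> * ?w $ y" by simp
    then show ?thesis by (simp only: add_diff_cancel_right')
  qed
  have near: "dst x y \<le> dst x z + 1" if "dst y z = 1" for z
    using graph_dist_triangle[OF conn, of x y z] graph_dist_commute[OF conn, of z y] that by simp
  have far: "(spectral_sum D E th *v ?w) $ y = 0" if "Suc h < dst x y"
  proof -
    have "(\<Sum>z\<in>UNIV. if dst y z = 1 then ?w $ z else 0) = 0"
      using Suc.IH near that by (intro sum.neutral) fastforce
    then show ?thesis using X alpha Suc.IH[of y] that by simp
  qed
  have at: "\<alpha> * (spectral_sum D E th *v ?w) $ y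
      = of_nat (graph_c R (Suc h)) * (\<Prod>j<h. of_nat (graph_c R (Suc j)) / \<alpha>)" if xy: "dst x y = Suc h"
  proof -
    have "(\<Sum>z\<in>UNIV. if dst y z = 1 then ?w $ z else 0)
        = (\<Sum>z\<in>{z. dst y z = 1 \<and> dst x z = h}. \<Prod>j<h. of_nat (graph_c R (Suc j)) / \<alpha>)"
    proof (rule sum.mono_neutral_cong_right)
      show "\<forall>z\<in>UNIV - {z. dst y z = 1 \<and> dst x z = h}. (if dst y z = 1 then ?w $ z else 0) = 0"
      proof
        fix z assume z: "z \<in> UNIV - {z. dst y z = 1 \<and> dst x z = h}"
        show "(if dst y z = 1 then ?w $ z else 0) = 0"
          using Suc.IH[of z] near[of z] xy z by (cases "dst y z = 1") auto
      qed
      show "(if dst y z = 1 then ?w $ z else 0) = (\<Prod>j<h. of_nat (graph_c R (Suc j)) / \<alpha>)"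
        if "z \<in> {z. dst y z = 1 \<and> dst x z = h}" for z
        using that Suc.IH[of z] by auto
    qed auto
    also have "\<dots> = of_nat (graph_c R (Suc h)) * (\<Prod>j<h. of_nat (graph_c R (Suc j)) / \<alpha>)"
      using graph_c_count[OF dr, of y x h] D_pos xy graph_dist_commute[OF conn, of y x] by (simp add: D_def)
    finally show ?thesis using X Suc.IH[of y] xy by simp
  qed
  show ?case
  proof (intro conjI impI)
    assume "Suc h < dst x y"
    then show "path_vector x (Suc h) $ y = 0" using far Suc.IH[of y] by simp
  next
    assume xy: "dst x y = Suc h"
    then show "path_vector x (Suc h) $ y = (\<Prod>j<Suc h. of_nat (graph_c R (Suc j)) / \<alpha>)"
      using at[OF xy] Suc.IH[of y] alpha by (simp add: field_simps)
  qed
qed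

text \<open>The type II equation in the form \<open>T\<^sup>* 1 = |X| \<kappa> T\<^sup>-\<^sup>1 e\<^sub>x\<close>, read at a vertex at distance \<open>D\<close>
  from \<open>x\<close>. There the Newton expansion of \<open>T\<^sup>-\<^sup>1\<close> reduces to its last term.\<close>

lemma tau_last:
  "\<tau> D = of_nat CARD('x) * \<kappa> * (qprod q (t 0) D * (\<Prod>j<D. of_nat (graph_c R (Suc j)) / \<alpha>))"
proof -
  obtain x y where xy: "dst x y = D" using ex_graph_dist_eq[OF conn, of D] by (auto simp: D_def)
  let ?Ti = "spectral_sum D E (\<lambda>i. 1 / \<tau> i)"
  have "?Ti *v (T *v (Ts x *v one)) = Ts x *v one"
    by (rule spectral_inverse[OF E_res]) (simp add: tau_nz)
  then have "Ts x *v one = (of_nat CARD('x) * \<kappa>) *s (?Ti *v axis x 1)"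
    by (simp add: T_Ts_one matrix_vec_scale)
  then have "(Ts x *v one) $ y = of_nat CARD('x) * \<kappa> * (\<Sum>h\<le>D. divided_difference 0 h *s path_vector x h) $ y"
    by (simp add: inverse_T_axis)
  moreover have "(Ts x *v one) $ y = \<tau> D" by (simp add: spectral_F_vec one_def xy)
  moreover have "(\<Sum>h\<le>D. divided_difference 0 h *s path_vector x h) $ y
      = divided_difference 0 D * (\<Prod>j<D. of_nat (graph_c R (Suc j)) / \<alpha>)"
  proof -
    have "(\<Sum>h\<le>D. divided_difference 0 h *s path_vector x h) $ y
        = (\<Sum>h\<le>D. if h = D then divided_difference 0 D * (\<Prod>j<D. of_nat (graph_c R (Suc j)) / \<alpha>) else 0)"
      unfolding sum_component using path_vector_entry[of _ x y] xy
      by (intro sum.cong refl) auto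
    then show ?thesis by simp
  qed
  ultimately show ?thesis by (simp add: divided_difference_def tau_0)
qed

lemma kappa_value:
  assumes c_i: "\<And>i \<eta> \<delta>. 1 \<le> i \<Longrightarrow> i < D \<Longrightarrow> \<eta> = q ^ (2 * i) \<Longrightarrow> \<delta> = q ^ (2 * D) \<Longrightarrow>
      of_nat (graph_c R i) = \<alpha> * (coeff_c (t 0) q \<delta> \<eta>)"
    and c_D: "\<And>\<delta>. \<delta> = q ^ (2 * D) \<Longrightarrow>
      of_nat (graph_c R D) = \<alpha> * (coeff_c_last (t 0) q \<delta>)"
  shows "of_nat CARD('x) * \<kappa> * (\<Prod>j<D. 1 - t 0 * q ^ (2 * j + 1))
    = (\<Prod>j<D. 1 - q ^ (2 * j) / (t 0 ^ 2 * q ^ (2 * D)))"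
proof -
  let ?s = "t 0" and ?\<delta> = "q ^ (2 * D)" and ?c = "\<lambda>j. of_nat (graph_c R (Suc j)) / \<alpha>"
  have t_eq: "t i = ?s * q ^ (2 * i)" for i using t_add[of 0 i] by simp
  have id: "qprod q ?s D * (\<Prod>j<D. ?c j) * (\<Prod>j<D. 1 - q ^ (2 * j) / (?s ^ 2 * ?\<delta>))
    = (\<Prod>j<D. - q / (?s * q ^ (2 * Suc j))) * (\<Prod>j<D. 1 - ?s * q ^ (2 * j + 1))"
  proof (rule scalar_identity[OF D_pos t_nz q])
    show "q ^ (2 * Suc j) \<noteq> 1" if "j < D" for j using power_q_ne_1[of "Suc j"] that by simp
    show "?s ^ 2 * (q ^ (2 * Suc j)) ^ 2 \<noteq> q ^ 2" if "j < D" for j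
    proof
      assume "?s ^ 2 * (q ^ (2 * Suc j)) ^ 2 = q ^ 2"
      moreover have "?s ^ 2 * (q ^ (2 * Suc j)) ^ 2 = (t j * q) ^ 2 * q ^ 2"
        unfolding t_eq[of j] by (simp add: power_mult_distrib power2_eq_square algebra_simps)
      ultimately show False using tq_sq[OF that] q by simp
    qed
    show "?s ^ 2 * (q ^ (2 * Suc j)) ^ 2 \<noteq> 1" if "Suc j < D" for j
      using t_sq[of "Suc j"] that unfolding t_eq[of "Suc j"] by (simp add: power_mult_distrib)
    show "?c j = coeff_c ?s q ?\<delta> (q ^ (2 * Suc j))" if "Suc j < D" for j
      using c_i[OF _ that refl refl] alpha by simp
    show "?c (D - 1) = coeff_c_last ?s q ?\<delta>"
      using c_D[OF refl] alpha D_pos by simp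
  qed
  have "i \<le> D \<Longrightarrow> \<tau> i = (\<Prod>j<i. - q / (?s * q ^ (2 * Suc j)))" for i
  proof (induction i)
    case (Suc i)
    have "\<tau> (Suc i) = - \<tau> i / (t i * q)"
      using tau_Suc[of i] Suc.prems t_nz[of i] q by (simp add: field_simps)
    also have "\<dots> = \<tau> i * (- q / (?s * q ^ (2 * Suc i)))"
      unfolding t_eq[of i] using q t_nz[of 0] by (simp add: power2_eq_square)
    finally show ?case using Suc by simp
  qed (simp add: tau_0)
  then have tauD: "(\<Prod>j<D. - q / (?s * q ^ (2 * Suc j))) = \<tau> D" by simp
  let ?P = "qprod q ?s D * (\<Prod>j<D. ?c j)"
  have P: "\<tau> D = of_nat CARD('x) * \<kappa> * ?P" by (rule tau_last)
  then have "?P \<noteq> 0" using tau_nz[of D] by auto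
  have "?P * (\<Prod>j<D. 1 - q ^ (2 * j) / (?s ^ 2 * ?\<delta>))
      = ?P * (of_nat CARD('x) * \<kappa> * (\<Prod>j<D. 1 - ?s * q ^ (2 * j + 1)))"
    unfolding id tauD P by (simp only: mult_ac)
  then show ?thesis using \<open>?P \<noteq> 0\<close> by (metis mult_left_cancel)
qed

theorem spin_model_from_normalization:
  assumes c_i: "\<And>i \<eta> \<delta>. 1 \<le> i \<Longrightarrow> i < D \<Longrightarrow> \<eta> = q ^ (2 * i) \<Longrightarrow> \<delta> = q ^ (2 * D) \<Longrightarrow>
      of_nat (graph_c R i) = \<alpha> * (coeff_c (t 0) q \<delta> \<eta>)"
    and c_D: "\<And>\<delta>. \<delta> = q ^ (2 * D) \<Longrightarrow>
      of_nat (graph_c R D) = \<alpha> * (coeff_c_last (t 0) q \<delta>)"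
    and f: "f ^ 2 = complex_of_real (real CARD('x) powr (3 / 2))
      * (\<Prod>j<D. 1 - t 0 * q ^ (2 * j + 1)) / (\<Prod>j<D. 1 - q ^ (2 * j) / (t 0 ^ 2 * q ^ (2 * D)))"
    and W: "W = f *\<^sub>M T"
  shows "spin_model W \<and> affords R W"
proof (rule spin_model_afforded[OF _ W])
  let ?N = "of_nat CARD('x) :: complex"
  let ?num = "\<Prod>j<D. 1 - t 0 * q ^ (2 * j + 1)"
  have kappa: "?N * \<kappa> * ?num = (\<Prod>j<D. 1 - q ^ (2 * j) / (t 0 ^ 2 * q ^ (2 * D)))"
    by (rule kappa_value[OF c_i c_D])
  have "1 - t 0 * q ^ (2 * j + 1) \<noteq> 0" if "j < D" for j
  proof
    assume "1 - t 0 * q ^ (2 * j + 1) = 0"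
    moreover have "t j * q = t 0 * q ^ (2 * j + 1)" using t_add[of 0 j] by simp
    ultimately show False using tq_sq[OF that] by simp
  qed
  then have num: "?num \<noteq> 0" by simp
  have powr: "real CARD('x) powr (3 / 2) = real CARD('x) * sqrt (real CARD('x))"
  proof -
    have "real CARD('x) powr (1 + 1 / 2) = real CARD('x) powr 1 * real CARD('x) powr (1 / 2)"
      by (rule powr_add)
    then show ?thesis by (simp add: powr_half_sqrt)
  qed
  have "f ^ 2 * \<kappa> = ?N * complex_of_real (sqrt (real CARD('x))) * ?num / (?N * \<kappa> * ?num) * \<kappa>"
    unfolding f kappa[symmetric] powr by simp
  also have "\<dots> = complex_of_real (sqrt (real CARD('x)))"
    using num kappa_nz by simp
  finally show "f ^ 2 * \<kappa> = complex_of_real (sqrt (real CARD('x)))" .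
qed

end

lemma frac_scale: "k \<noteq> 0 \<Longrightarrow> X = k * X' \<Longrightarrow> Y = k * Y' \<Longrightarrow> X / Y = X' / (Y' :: complex)"
  by simp

text \<open>For \<open>\<alpha> = 0\<close> all eigenvalues coincide and the adjacency matrix is a multiple of the identity, which has
  zero off-diagonal entries.\<close>

lemma eigenvalue_scale_nonzero:
  fixes R :: "('x::finite \<times> 'x) set"
  assumes dr: "distance_regular R" and D: "1 \<le> graph_diameter R" and idem: "primitive_idempotents R E"
    and theta: "\<And>i. i \<le> graph_diameter R \<Longrightarrow> eigenmatrix_P R E i 1 = \<alpha> * g i + \<beta>"
  shows "\<alpha> \<noteq> 0"
proof
  assume "\<alpha> = 0"
  have conn: "connected_simple_graph R" using dr by (simp add: distance_regular_def)
  have "dist_matrix R 1 = (\<Sum>i\<le>graph_diameter R. \<beta> *\<^sub>M E i)"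
    unfolding sum_eigenmatrix_P[OF idem D] using theta \<open>\<alpha> = 0\<close> by (intro sum.cong) auto
  also have "\<dots> = \<beta> *\<^sub>M mat 1"
    using idem by (simp add: primitive_idempotents_def Let_def flip: cmat.scale_sum_right)
  finally have A: "dist_matrix R 1 = \<beta> *\<^sub>M mat 1" .
  obtain x y where xy: "graph_dist R x y = 1" using ex_graph_dist_eq[OF conn D] by blast
  then have "x \<noteq> y" using graph_dist_eq_0[OF conn, of x y] by auto
  have "dist_matrix R 1 $ x $ y = 1" using xy by (simp add: dist_matrix_def)
  then show False unfolding A using \<open>x \<noteq> y\<close> by (simp add: cmat_scale_def mat_def)
qed

section \<open>From powers to the normalized parameters\<close>

lemma power_int_numeral_mult: "(q :: complex) powi (numeral k * int n) = (q ^ n) ^ numeral k"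
proof -
  have "numeral k * int n = int (n * numeral k)" by simp
  then show ?thesis by (simp only: power_int_of_nat power_mult)
qed

lemma power_int_simps:
  assumes "(q :: complex) \<noteq> 0"
  shows "q powi (m + n) = q powi m * q powi n" "q powi (m - n) = q powi m / q powi n"
    "q powi (- m) = 1 / q powi m" "q powi int k = q ^ k"
  using assms by (simp_all add: power_int_add power_int_diff power_int_minus_divide)

context
  fixes a q s Q Z :: complex
  assumes q: "q \<noteq> 0" and s: "s \<noteq> 0" and Q: "Q \<noteq> 0" and Z: "Z \<noteq> 0" and a: "a = s * Q"
begin

text \<open>Here \<open>Q\<close>, \<open>Z\<close> and \<open>I\<close> stand for \<open>q\<^sup>D\<^sup>-\<^sup>2\<^sup>r\<close>, \<open>q\<^sup>d\<close> and \<open>q\<^sup>i\<close>; the graph itself is the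
  case \<open>r = 0\<close>, \<open>d = D\<close>. In each lemma numerator and denominator differ from the normalized ones by a common monomial, which is the argument of
  \<open>frac_scale\<close>.\<close>

lemma normalize_b_0:
  "(1 / Z - Z) * (a ^ 3 - Q ^ 3 / (Z ^ 2 * q)) / (a * (Q / Z) * (a + Q / q))
    = (1 - Z ^ 2) * (s ^ 3 * Z ^ 2 * q - 1) / (s * Z ^ 2 * (s * q + 1))"
  by (rule frac_scale[of "Q ^ 3 / (Z ^ 3 * q)"])
    (use q s Q Z in \<open>simp_all add: a field_simps power2_eq_square power3_eq_cube\<close>)

lemma normalize_c_d:
  "(1 / Z - Z) * (a - Q / q) / (Z / q * (a + Q * q / Z ^ 2))
    = (1 - Z ^ 2) * (s * q - 1) / (s * Z ^ 2 + q)"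
  by (rule frac_scale[of "Q / (Z * q)"])
    (use q s Q Z in \<open>simp_all add: a field_simps power2_eq_square power3_eq_cube\<close>)

lemma normalize_b_i:
  assumes I: "I \<noteq> 0"
  shows "(I / Z - Z / I) * (a * (I / Q) - inverse a * (Q / I)) * (a ^ 3 - Q ^ 3 / (Z ^ 2 * I ^ 2 * q))
      / (a * (Q / Z) * (a * (I ^ 2 / Q) - inverse a * (Q / I ^ 2)) * (a + Q / (I ^ 2 * q)))
    = (I ^ 2 - Z ^ 2) * (s ^ 2 * I ^ 2 - 1) * (s ^ 3 * Z ^ 2 * q * I ^ 2 - 1)
      / (s * Z ^ 2 * (s ^ 2 * (I ^ 2) ^ 2 - 1) * (s * q * I ^ 2 + 1))"
proof -
  have e: "I / Z - Z / I = (I ^ 2 - Z ^ 2) / (Z * I)"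
    "a * (I / Q) - inverse a * (Q / I) = (s ^ 2 * I ^ 2 - 1) / (s * I)"
    "a ^ 3 - Q ^ 3 / (Z ^ 2 * I ^ 2 * q) = Q ^ 3 * (s ^ 3 * Z ^ 2 * q * I ^ 2 - 1) / (Z ^ 2 * I ^ 2 * q)"
    "a * (I ^ 2 / Q) - inverse a * (Q / I ^ 2) = (s ^ 2 * (I ^ 2) ^ 2 - 1) / (s * I ^ 2)"
    "a + Q / (I ^ 2 * q) = Q * (s * q * I ^ 2 + 1) / (I ^ 2 * q)"
    using q s Q Z I by (simp_all add: a field_simps power2_eq_square power3_eq_cube)
  show ?thesis unfolding e
    by (rule frac_scale[of "Q ^ 3 / (s * Z ^ 3 * I ^ 4 * q)"])
      (use q s Q Z I in \<open>simp_all add: a power2_eq_square power3_eq_cube eval_nat_numeral mult_ac\<close>)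
qed

lemma normalize_c_i:
  assumes I: "I \<noteq> 0"
  shows "a * (I - 1 / I) * (a * (Z * I / Q) - inverse a * (Q / (Z * I))) * (inverse a - Z ^ 2 * q / (Q * I ^ 2))
      / (Z / Q * (a * (I ^ 2 / Q) - inverse a * (Q / I ^ 2)) * (a + Q * q / I ^ 2))
    = (I ^ 2 - 1) * (s ^ 2 * Z ^ 2 * I ^ 2 - 1) * (I ^ 2 - s * Z ^ 2 * q)
      / (Z ^ 2 * (s ^ 2 * (I ^ 2) ^ 2 - 1) * (s * I ^ 2 + q))"
proof -
  have e: "I - 1 / I = (I ^ 2 - 1) / I"
    "a * (Z * I / Q) - inverse a * (Q / (Z * I)) = (s ^ 2 * Z ^ 2 * I ^ 2 - 1) / (s * Z * I)"
    "inverse a - Z ^ 2 * q / (Q * I ^ 2) = (I ^ 2 - s * Z ^ 2 * q) / (s * Q * I ^ 2)"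
    "a * (I ^ 2 / Q) - inverse a * (Q / I ^ 2) = (s ^ 2 * (I ^ 2) ^ 2 - 1) / (s * I ^ 2)"
    "a + Q * q / I ^ 2 = Q * (s * I ^ 2 + q) / I ^ 2"
    using q s Q Z I by (simp_all add: a field_simps power2_eq_square power3_eq_cube)
  show ?thesis unfolding e
    by (rule frac_scale[of "1 / (s * Z * I ^ 4)"])
      (use q s Q Z I in \<open>simp_all add: a power2_eq_square power3_eq_cube eval_nat_numeral mult_ac\<close>)
qed

end

lemma module_exponents:
  fixes q :: complex and D r d i :: nat
  assumes q: "q \<noteq> 0"
  defines "Q \<equiv> q ^ D / (q ^ r) ^ 2" and "Z \<equiv> q ^ d" and "I \<equiv> q ^ i"
  shows "q powi (- int d) = 1 / Z" "q powi (int d - 1) = Z / q"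
    "q powi (3 * int D - 2 * int d - 6 * int r - 1) = Q ^ 3 / (Z ^ 2 * q)"
    "q powi (3 * int D - 2 * int d - 6 * int r - 2 * int i - 1) = Q ^ 3 / (Z ^ 2 * I ^ 2 * q)"
    "q powi (int D - int d - 2 * int r) = Q / Z" "q powi (int d - int D + 2 * int r) = Z / Q"
    "q powi (int D - 2 * int r - 1) = Q / q" "q powi (int D - 2 * int d - 2 * int r + 1) = Q * q / Z ^ 2"
    "q powi (int i - int d) = I / Z" "q powi (int d - int i) = Z / I" "q powi (- int i) = 1 / I"
    "q powi (2 * int r + int i - int D) = I / Q" "q powi (int D - 2 * int r - int i) = Q / I"
    "q powi (2 * int r + 2 * int i - int D) = I ^ 2 / Q"
    "q powi (int D - 2 * int r - 2 * int i) = Q / I ^ 2"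
    "q powi (int D - 2 * int r - 2 * int i - 1) = Q / (I ^ 2 * q)"
    "q powi (int D - 2 * int r - 2 * int i + 1) = Q * q / I ^ 2"
    "q powi (int d + 2 * int r + int i - int D) = Z * I / Q"
    "q powi (int D - int d - 2 * int r - int i) = Q / (Z * I)"
    "q powi (2 * int d - int D + 2 * int r - 2 * int i + 1) = Z ^ 2 * q / (Q * I ^ 2)"
    "q powi (2 * int r - int D) = 1 / Q"
proof -
  define A B where "A = q ^ D" and "B = q ^ r"
  have nz: "A \<noteq> 0" "B \<noteq> 0" "Z \<noteq> 0" "I \<noteq> 0" using q by (simp_all add: A_def B_def Z_def I_def)
  have Q: "Q = A / B ^ 2" by (simp add: Q_def A_def B_def)
  note pw = power_int_simps[OF q] power_int_numeral_mult power_int_1_right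
    A_def[symmetric] B_def[symmetric] Z_def[symmetric] I_def[symmetric]
  show "q powi (- int d) = 1 / Z" "q powi (int d - 1) = Z / q"
    "q powi (int D - int d - 2 * int r) = Q / Z" "q powi (int d - int D + 2 * int r) = Z / Q"
    "q powi (int D - 2 * int r - 1) = Q / q" "q powi (int D - 2 * int d - 2 * int r + 1) = Q * q / Z ^ 2"
    "q powi (int i - int d) = I / Z" "q powi (int d - int i) = Z / I" "q powi (- int i) = 1 / I"
    "q powi (2 * int r + int i - int D) = I / Q" "q powi (int D - 2 * int r - int i) = Q / I"
    "q powi (2 * int r + 2 * int i - int D) = I ^ 2 / Q"
    "q powi (int D - 2 * int r - 2 * int i) = Q / I ^ 2"
    "q powi (int D - 2 * int r - 2 * int i - 1) = Q / (I ^ 2 * q)"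
    "q powi (int D - 2 * int r - 2 * int i + 1) = Q * q / I ^ 2"
    "q powi (int d + 2 * int r + int i - int D) = Z * I / Q"
    "q powi (int D - int d - 2 * int r - int i) = Q / (Z * I)"
    "q powi (2 * int d - int D + 2 * int r - 2 * int i + 1) = Z ^ 2 * q / (Q * I ^ 2)"
    "q powi (2 * int r - int D) = 1 / Q"
    unfolding pw Q using nz q by (simp_all add: field_simps)
  show "q powi (3 * int D - 2 * int d - 6 * int r - 1) = Q ^ 3 / (Z ^ 2 * q)"
    "q powi (3 * int D - 2 * int d - 6 * int r - 2 * int i - 1) = Q ^ 3 / (Z ^ 2 * I ^ 2 * q)"
    unfolding pw Q using nz q by (simp_all add: power_divide flip: power_mult)
qed

theorem theorem14p7:
  fixes R :: "('x::finite \<times> 'x) set"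
    and E :: "nat \<Rightarrow> complex^'x^'x"
    and D :: nat
    and \<theta> \<tau> :: "nat \<Rightarrow> complex"
    and a q \<alpha> \<beta> f :: complex
    and W :: "complex^'x^'x"
  assumes dr: "distance_regular R"
    and D_def: "D = graph_diameter R" and D_ge_1: "D \<ge> 1"
    and idem: "primitive_idempotents R E"
    and self_dual: "formally_self_dual R E"
    and \<theta>_def: "\<And>i. i \<le> D \<Longrightarrow> \<theta> i = eigenmatrix_P R E i 1"
    and a_nz: "a \<noteq> 0" and q_nz: "q \<noteq> 0"
    and \<alpha>_def: "\<alpha> = (a * q powi (2 - int D) - inverse a * q powi (int D - 2))
                      * (a + q powi (int D - 1))
                    / (q powi (int D - 1) * (inverse q - q) * (a * q - inverse a * inverse q)
                      * (a - q powi (1 - int D)))"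
    and \<beta>_def: "\<beta> = q * (a + inverse a) * (a + q powi (- int D - 1))
                      * (a * q powi (2 - int D) - inverse a * q powi (int D - 2))
                    / ((q - inverse q) * (a - q powi (1 - int D)) * (a * q - inverse a * inverse q))"
    and \<theta>_eq: "\<And>i. i \<le> D \<Longrightarrow>
          \<theta> i = \<alpha> * (a * q powi (2 * int i - int D) + inverse a * q powi (int D - 2 * int i)) + \<beta>"
    and q_cond: "\<And>i. 1 \<le> i \<Longrightarrow> i \<le> D \<Longrightarrow> q ^ (2 * i) \<noteq> 1"
    and a2_cond: "\<And>i::int. 1 - int D \<le> i \<Longrightarrow> i \<le> int D - 1 \<Longrightarrow> a ^ 2 * q powi (2 * i) \<noteq> 1"
    and a3_cond: "\<And>i. 1 \<le> i \<Longrightarrow> i \<le> D \<Longrightarrow> a ^ 3 * q powi (2 * int i - int D - 1) \<noteq> 1"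
    and b_0: "of_nat (graph_b R 0) =
          \<alpha> * (q powi (- int D) - q ^ D) * (a ^ 3 - q powi (int D - 1))
          / (a * (a + q powi (int D - 1)))"
    and c_D: "of_nat (graph_c R D) =
          \<alpha> * (q powi (- int D) - q ^ D) * (a - q powi (int D - 1))
          / (q powi (int D - 1) * (a + q powi (1 - int D)))"
    and b_i: "\<And>i. 1 \<le> i \<Longrightarrow> i \<le> D - 1 \<Longrightarrow> of_nat (graph_b R i) =
          \<alpha> * (q powi (int i - int D) - q powi (int D - int i))
            * (a * q powi (int i - int D) - inverse a * q powi (int D - int i))
            * (a ^ 3 - q powi (int D - 2 * int i - 1))
          / (a * (a * q powi (2 * int i - int D) - inverse a * q powi (int D - 2 * int i))
              * (a + q powi (int D - 2 * int i - 1)))"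
    and c_i: "\<And>i. 1 \<le> i \<Longrightarrow> i \<le> D - 1 \<Longrightarrow> of_nat (graph_c R i) =
          \<alpha> * a * (q ^ i - q powi (- int i))
            * (a * q ^ i - inverse a * q powi (- int i))
            * (inverse a - q powi (int D - 2 * int i + 1))
          / ((a * q powi (2 * int i - int D) - inverse a * q powi (int D - 2 * int i))
              * (a + q powi (int D - 2 * int i + 1)))"
    and thin: "\<And>x U. irreducible_T_module R x U \<Longrightarrow> thin_module R x U"
    and endpoints: "\<And>x U. irreducible_T_module R x U \<Longrightarrow> endpoint R x U = dual_endpoint R E U"
    and module_b_i: "\<And>x U r d i. irreducible_T_module R x U \<Longrightarrow>
          r = endpoint R x U \<Longrightarrow> d = module_diameter R x U \<Longrightarrow> 1 \<le> i \<Longrightarrow> i \<le> d - 1 \<Longrightarrow>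
          module_b R E x U i =
          \<alpha> * (q powi (int i - int d) - q powi (int d - int i))
            * (a * q powi (2 * int r + int i - int D) - inverse a * q powi (int D - 2 * int r - int i))
            * (a ^ 3 - q powi (3 * int D - 2 * int d - 6 * int r - 2 * int i - 1))
          / (a * q powi (int D - int d - 2 * int r)
              * (a * q powi (2 * int r + 2 * int i - int D)
                 - inverse a * q powi (int D - 2 * int r - 2 * int i))
              * (a + q powi (int D - 2 * int r - 2 * int i - 1)))"
    and module_c_i: "\<And>x U r d i. irreducible_T_module R x U \<Longrightarrow>
          r = endpoint R x U \<Longrightarrow> d = module_diameter R x U \<Longrightarrow> 1 \<le> i \<Longrightarrow> i \<le> d - 1 \<Longrightarrow>
          module_c R E x U i =
          \<alpha> * a * (q ^ i - q powi (- int i))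
            * (a * q powi (int d + 2 * int r + int i - int D)
               - inverse a * q powi (int D - int d - 2 * int r - int i))
            * (inverse a - q powi (2 * int d - int D + 2 * int r - 2 * int i + 1))
          / (q powi (int d - int D + 2 * int r)
              * (a * q powi (2 * int r + 2 * int i - int D)
                 - inverse a * q powi (int D - 2 * int r - 2 * int i))
              * (a + q powi (int D - 2 * int r - 2 * int i + 1)))"
    and module_b_0: "\<And>x U r d. irreducible_T_module R x U \<Longrightarrow>
          r = endpoint R x U \<Longrightarrow> d = module_diameter R x U \<Longrightarrow> 1 \<le> d \<Longrightarrow>
          module_b R E x U 0 =
          \<alpha> * (q powi (- int d) - q ^ d)
            * (a ^ 3 - q powi (3 * int D - 2 * int d - 6 * int r - 1))
          / (a * q powi (int D - int d - 2 * int r) * (a + q powi (int D - 2 * int r - 1)))"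
    and module_c_d: "\<And>x U r d. irreducible_T_module R x U \<Longrightarrow>
          r = endpoint R x U \<Longrightarrow> d = module_diameter R x U \<Longrightarrow> 1 \<le> d \<Longrightarrow>
          module_c R E x U d =
          \<alpha> * (q powi (- int d) - q ^ d) * (a - q powi (int D - 2 * int r - 1))
          / (q powi (int d - 1) * (a + q powi (int D - 2 * int d - 2 * int r + 1)))"
    and \<tau>_def: "\<And>i. i \<le> D \<Longrightarrow> \<tau> i = (- 1) ^ i * a powi (- int i) * q ^ (i * (D - i))"
    and f_sq: "f ^ 2 = complex_of_real (real CARD('x) powr (3 / 2))
                 * qpochhammer (a * q powi (1 - int D)) (q ^ 2) D
                 / qpochhammer (a powi (- 2)) (q ^ 2) D"
    and W_def: "W = f *\<^sub>M (\<Sum>i\<le>D. \<tau> i *\<^sub>M E i)"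
  shows "spin_model W \<and> affords R W"
proof -
  have D1: "1 \<le> graph_diameter R" using D_ge_1 D_def by simp
  have alpha: "\<alpha> \<noteq> 0"
    by (rule eigenvalue_scale_nonzero[OF dr D1 idem,
          of \<alpha> "\<lambda>i. a * q powi (2 * int i - int D) + inverse a * q powi (int D - 2 * int i)" \<beta>])
      (use \<theta>_def \<theta>_eq D_def in simp)
  have theta': "eigenmatrix_P R E i 1 = \<theta> i" if "i \<le> D" for i using \<theta>_def[OF that] by simp
  have W': "W = f *\<^sub>M spectral_sum D E \<tau>" by (simp add: W_def spectral_sum_def)
  have q2_ne: "q powi (2 * k) \<noteq> 1" if "1 \<le> \<bar>k\<bar>" "\<bar>k\<bar> \<le> int D" for k
  proof
    assume 1: "q powi (2 * k) = 1"
    have "q powi (2 * \<bar>k\<bar>) = 1"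
    proof (cases "0 \<le> k")
      case False
      have "q powi (- (2 * k)) = 1" unfolding power_int_minus 1 by simp
      then show ?thesis using False by simp
    qed (use 1 in simp)
    moreover have "2 * \<bar>k\<bar> = int (2 * nat \<bar>k\<bar>)" by simp
    ultimately have "q ^ (2 * nat \<bar>k\<bar>) = 1" by (metis power_int_of_nat)
    then show False using q_cond[of "nat \<bar>k\<bar>"] that by auto
  qed
  have theta_t: "\<theta> i = \<alpha> * (t i + 1 / t i) + \<beta>"
    if "i \<le> D" "\<And>i. t i = a * q powi (2 * int i - int D)" for i and t :: "nat \<Rightarrow> complex"
  proof -
    have "1 / t i = inverse a * q powi (int D - 2 * int i)"
      using a_nz q_nz by (simp add: that(2) power_int_diff field_simps)
    then show ?thesis using \<theta>_eq[OF that(1)] that(2) by simp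
  qed
  show ?thesis
  proof (cases "q ^ 4 = 1")
    case False
    define t where "t i = a * q powi (2 * int i - int D)" for i :: nat
    have t_nz: "t i \<noteq> 0" for i using a_nz q_nz by (simp add: t_def)
    have t_Suc: "t (Suc i) = t i * q ^ 2" for i
    proof -
      have "2 * int (Suc i) - int D = (2 * int i - int D) + 2" by simp
      then show ?thesis
        unfolding t_def using power_int_add[of q "2 * int i - int D" 2] q_nz by (simp only:) simp
    qed
    have t_prod: "t i * t j = a ^ 2 * q powi (2 * (int i + int j - int D))" for i j
    proof -
      have e: "2 * (int i + int j - int D) = (2 * int i - int D) + (2 * int j - int D)" by simp
      have "q powi (2 * (int i + int j - int D)) = q powi (2 * int i - int D) * q powi (2 * int j - int D)"
        unfolding e by (rule power_int_add) (simp add: q_nz)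
      then show ?thesis unfolding t_def by (simp only: power2_eq_square mult_ac)
    qed
    have t_inj: "t i \<noteq> t j" if "i \<le> D" "j \<le> D" "i \<noteq> j" for i j
    proof
      assume "t i = t j"
      then have "q powi (2 * int i - int D) = q powi (2 * int j - int D)" using a_nz by (simp add: t_def)
      moreover have "2 * int i - int D = 2 * (int i - int j) + (2 * int j - int D)" by simp
      ultimately have "q powi (2 * (int i - int j)) * q powi (2 * int j - int D) = q powi (2 * int j - int D)"
        using q_nz by (metis power_int_add)
      then have "q powi (2 * (int i - int j)) = 1" using q_nz by simp
      moreover have "1 \<le> \<bar>int i - int j\<bar>" "\<bar>int i - int j\<bar> \<le> int D" using that by linarith+
      ultimately show False using q2_ne by blast
    qed
    have t_prod_ne: "t i * t j \<noteq> 1" if "i \<le> D" "j \<le> D" "i \<noteq> j" for i j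
      unfolding t_prod using that by (intro a2_cond) auto
    have theta: "\<theta> i = \<alpha> * (t i + 1 / t i) + \<beta>" if "i \<le> D" for i
      by (rule theta_t[OF that]) (rule t_def)
    have inj: "inj_on \<theta> {..D}"
      by (rule eigenvalue_inj[OF theta alpha t_nz t_inj t_prod_ne])
    have a_eq: "a = t r * (q ^ D / (q ^ r) ^ 2)" for r
      unfolding t_def module_exponents(21)[OF q_nz] using q_nz by simp
    have nzs: "q ^ D / (q ^ r) ^ 2 \<noteq> 0" "q ^ d \<noteq> 0" for r d using q_nz by auto
    have sq: "(q ^ n) ^ 2 = q ^ (2 * n)" for n by (simp add: mult.commute flip: power_mult)
    interpret spin_graph R E D \<theta> q \<alpha> \<beta> t \<tau>
    proof unfold_locales
      show "t i ^ 2 \<noteq> 1" if "1 \<le> i" "i < D" for i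
        using a2_cond[of "int i + int i - int D"] that t_prod[of i i] by (simp add: power2_eq_square)
      show "(t i * q) ^ 2 \<noteq> 1" if "i < D" for i
      proof -
        have "(t i * q) ^ 2 = t i * t (Suc i)" by (simp add: t_Suc power2_eq_square)
        then show ?thesis
          using a2_cond[of "int i + int (Suc i) - int D"] that t_prod[of i "Suc i"] by simp
      qed
      show "\<tau> 0 = 1" using \<tau>_def[of 0] by simp
      show "\<tau> (Suc i) * (t i * q) = - \<tau> i" if "i < D" for i
      proof -
        from less_imp_Suc_add[OF that] obtain e where D: "D = i + Suc e" by auto
        have "a powi (- int (Suc i)) * a = a powi (- int i)"
          using a_nz power_int_add[of a "- int (Suc i)" 1] by simp
        moreover have "q ^ (Suc i * e) * (q powi (2 * int i - int D) * q) = q ^ (i * Suc e)"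
        proof -
          have "q ^ (Suc i * e) * (q powi (2 * int i - int D) * q)
              = q powi (int (Suc i * e) + (2 * int i - int D) + 1)"
            by (simp only: power_int_add[OF disjI1[OF q_nz]] power_int_of_nat power_int_1_right mult.assoc)
          also have "int (Suc i * e) + (2 * int i - int D) + 1 = int (i * Suc e)"
            by (simp add: D algebra_simps)
          finally show ?thesis by (simp only: power_int_of_nat)
        qed
        moreover have "D - Suc i = e" "D - i = Suc e" using D by auto
        moreover have "\<tau> (Suc i) * (t i * q) = - ((- 1) ^ i) * (a powi (- int (Suc i)) * a)
            * (q ^ (Suc i * (D - Suc i)) * (q powi (2 * int i - int D) * q))"
          using \<tau>_def[of "Suc i"] that by (simp add: t_def mult_ac del: mult_Suc of_nat_Suc)
        ultimately show ?thesis using \<tau>_def[of i] that by simp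
      qed
      fix x U r d s \<delta>
      assume irr: "irreducible_T_module R x U" and r: "r = endpoint R x U" and d: "d = module_diameter R x U"
        and s: "s = t r" and \<delta>: "\<delta> = q ^ (2 * d)"
      have s_nz: "s \<noteq> 0" and a: "a = s * (q ^ D / (q ^ r) ^ 2)" using s t_nz a_eq by auto
      note norm = q_nz s_nz nzs a
      show "module_b R E x U 0 = \<alpha> * (coeff_b_first s q \<delta>)" if "1 \<le> d"
        unfolding module_b_0[OF irr r d that] module_exponents[OF q_nz] \<delta> sq[symmetric]
          normalize_b_0[OF norm, symmetric]
        by (simp only: times_divide_eq_right mult.assoc)
      show "module_c R E x U d = \<alpha> * (coeff_c_last s q \<delta>)" if "1 \<le> d"
        unfolding module_c_d[OF irr r d that] module_exponents[OF q_nz] \<delta> sq[symmetric]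
          normalize_c_d[OF norm, symmetric]
        by (simp only: times_divide_eq_right mult.assoc)
      fix i \<eta> assume i: "1 \<le> i" "i < d" and \<eta>: "\<eta> = q ^ (2 * i)"
      have i': "i \<le> d - 1" using i by simp
      show "module_b R E x U i = \<alpha> * (coeff_b s q \<delta> \<eta>)"
        unfolding module_b_i[OF irr r d i(1) i'] module_exponents[OF q_nz] \<delta> \<eta> sq[symmetric]
          normalize_b_i[OF norm nzs(2), symmetric]
        by (simp only: times_divide_eq_right mult.assoc)
      show "module_c R E x U i = \<alpha> * (coeff_c s q \<delta> \<eta>)"
        unfolding module_c_i[OF irr r d i(1) i'] module_exponents(17)[OF q_nz, of D r i]
        unfolding module_exponents[OF q_nz] \<delta> \<eta> sq[symmetric]
          normalize_c_i[OF norm nzs(2), symmetric]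
        by (simp only: times_divide_eq_right mult.assoc)
    qed (use dr D_def D_ge_1 idem self_dual theta' inj q_nz False alpha theta t_Suc t_nz t_inj t_prod_ne
        thin endpoints in auto)
    have a0: "a = t 0 * q ^ D" using a_eq[of 0] by simp
    have t0: "t 0 = a * q powi (- int D)" by (simp add: t_def)
    note norm0 = q_nz t_nz[of 0] nzs(2)[of D] nzs(2)[of D] a0
    show ?thesis
    proof (rule spin_model_from_normalization[OF _ _ _ W'])
      fix \<delta> assume \<delta>: "\<delta> = q ^ (2 * D)"
      have "of_nat (graph_c R D) = \<alpha> * ((1 / q ^ D - q ^ D) * (a - q ^ D / q) / (q ^ D / q * (a + q ^ D * q / (q ^ D) ^ 2)))"
      proof -
        have "q powi (1 - int D) = q ^ D * q / (q ^ D) ^ 2"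
          using q_nz by (simp add: power_int_diff power2_eq_square)
        moreover have "q powi (int D - 1) = q ^ D / q" "q powi (- int D) = 1 / q ^ D"
          using q_nz by (simp_all add: power_int_diff power_int_minus_divide)
        ultimately show ?thesis unfolding c_D by (simp only: times_divide_eq_right mult.assoc)
      qed
      also have "\<dots> = \<alpha> * (coeff_c_last (t 0) q \<delta>)"
        unfolding normalize_c_d[OF norm0] by (simp only: \<delta> sq)
      finally show "of_nat (graph_c R D) = \<alpha> * (coeff_c_last (t 0) q \<delta>)" .
      fix i \<eta> assume i: "1 \<le> i" "i < D" and \<eta>: "\<eta> = q ^ (2 * i)"
      have i': "i \<le> D - 1" using i by simp
      let ?Z = "q ^ D" and ?I = "q ^ i"
      have "of_nat (graph_c R i) = \<alpha> * (a * (?I - 1 / ?I) * (a * (?Z * ?I / ?Z) - inverse a * (?Z / (?Z * ?I)))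
          * (inverse a - ?Z ^ 2 * q / (?Z * ?I ^ 2))
          / (?Z / ?Z * (a * (?I ^ 2 / ?Z) - inverse a * (?Z / ?I ^ 2)) * (a + ?Z * q / ?I ^ 2)))"
      proof -
        have "q powi (int D - 2 * int i + 1) = ?Z * q / ?I ^ 2" "q powi (2 * int i - int D) = ?I ^ 2 / ?Z"
            "q powi (int D - 2 * int i) = ?Z / ?I ^ 2" "q powi (- int i) = 1 / ?I"
          using q_nz by (simp_all add: power_int_add power_int_diff power_int_numeral_mult power_int_minus_divide)
        moreover have "?Z * ?I / ?Z = ?I" "?Z / (?Z * ?I) = 1 / ?I" "?Z ^ 2 * q / (?Z * ?I ^ 2) = ?Z * q / ?I ^ 2"
            "?Z / ?Z = 1"
          using q_nz by (simp_all add: power2_eq_square)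
        ultimately show ?thesis unfolding c_i[OF i(1) i']
          by (simp only: times_divide_eq_right mult.assoc mult_1_left)
      qed
      also have "\<dots> = \<alpha> * (coeff_c (t 0) q \<delta> \<eta>)"
        unfolding normalize_c_i[OF norm0 nzs(2)] by (simp only: \<delta> \<eta> sq)
      finally show "of_nat (graph_c R i) = \<alpha> * (coeff_c (t 0) q \<delta> \<eta>)" .
    next
      have "a * q powi (1 - int D) * (q ^ 2) ^ j = t 0 * q ^ (2 * j + 1)" for j
        using q_nz by (simp add: t0 power_int_diff power_int_minus_divide power_mult)
      moreover have "a powi (- 2) * (q ^ 2) ^ j = q ^ (2 * j) / (t 0 ^ 2 * q ^ (2 * D))" for j
      proof -
        have "a powi (- 2) = 1 / a ^ 2" by (simp add: power_int_minus_divide)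
        also have "a ^ 2 = t 0 ^ 2 * q ^ (2 * D)"
          using sq[of D] by (simp add: a0 power_mult_distrib)
        finally show ?thesis by (simp add: power_mult)
      qed
      ultimately show "f ^ 2 = complex_of_real (real CARD('x) powr (3 / 2))
          * (\<Prod>j<D. 1 - t 0 * q ^ (2 * j + 1)) / (\<Prod>j<D. 1 - q ^ (2 * j) / (t 0 ^ 2 * q ^ (2 * D)))"
        unfolding f_sq qpochhammer_def by simp
    qed
  next
    case True
    have D: "D = 1"
    proof (rule ccontr)
      assume "D \<noteq> 1"
      then show False using q_cond[of 2] True D_ge_1 by simp
    qed
    have q2: "q ^ 2 \<noteq> 1" using q_cond[of 1] D by simp
    have a2: "a ^ 2 \<noteq> 1" using a2_cond[of 0] D by simp
    \<comment> \<open>Since \<open>q\<^sup>2\<^sup>i \<noteq> 1\<close> for \<open>i \<le> D\<close>, the equation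
      \<open>q\<^sup>4 = 1\<close> forces \<open>D = 1\<close>. Then \<open>q\<close> enters the intersection numbers and the
      difference of the two eigenvalues only through \<open>\<alpha> (1/q - q)\<close>, so \<open>\<alpha>\<close> can absorb
      its replacement by \<open>2\<close>, which has \<open>2\<^sup>4 \<noteq> 1\<close>.\<close>
    define t where "t i = a / 2 * 4 ^ i" for i :: nat
    define \<alpha>' where "\<alpha>' = \<alpha> * (1 / q - q) / (1 / 2 - 2)"
    define \<beta>' where "\<beta>' = \<theta> 0 - \<alpha>' * (t 0 + 1 / t 0)"
    have \<alpha>': "\<alpha> * (1 / q - q) = - 3 / 2 * \<alpha>'" by (simp add: \<alpha>'_def)
    have \<alpha>'_nz: "\<alpha>' \<noteq> 0"
      using alpha q2 q_nz by (simp add: \<alpha>'_def power2_eq_square divide_eq_eq)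
    have t_nz: "t i \<noteq> 0" for i using a_nz by (simp add: t_def)
    have t_inj: "t i \<noteq> t j" if "i \<le> D" "j \<le> D" "i \<noteq> j" for i j
      using that a_nz D by (auto simp: t_def le_Suc_eq)
    have t_prod_ne: "t i * t j \<noteq> 1" if "i \<le> D" "j \<le> D" "i \<noteq> j" for i j
      using that a2 D by (auto simp: t_def le_Suc_eq power2_eq_square)
    have theta: "\<theta> i = \<alpha>' * (t i + 1 / t i) + \<beta>'" if "i \<le> D" for i
    proof (cases "i = 0")
      case False
      then have i: "i = 1" using that D by simp
      have "\<theta> 1 - \<theta> 0 = \<alpha> * (1 / q - q) * (1 / a - a)"
        using \<theta>_eq[of 0] \<theta>_eq[of 1] D a_nz q_nz by (simp add: power_int_minus_divide field_simps)
      also have "\<dots> = \<alpha>' * ((t 1 + 1 / t 1) - (t 0 + 1 / t 0))"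
        unfolding \<alpha>' using a_nz by (simp add: t_def field_simps)
      finally show ?thesis unfolding i \<beta>'_def by (simp add: algebra_simps)
    qed (simp add: \<beta>'_def)
    have inj: "inj_on \<theta> {..D}"
      by (rule eigenvalue_inj[OF theta \<alpha>'_nz t_nz t_inj t_prod_ne])
    have scale: "- 3 / 2 * x * y / z = x * (- 3 * y / (2 * z))" for x y z :: complex by simp
    have c_1: "\<alpha> * (1 / q - q) * (a - 1) / (a + 1) = \<alpha>' * ((1 - 4) * (t 0 * 2 - 1) / (t 0 * 4 + 2))"
    proof -
      have "t 0 * 4 + 2 = 2 * (a + 1)" "(1 - 4) * (t 0 * 2 - 1) = - 3 * (a - 1)"
        by (simp_all add: t_def algebra_simps)
      then show ?thesis unfolding \<alpha>' by (simp only: scale)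
    qed
    interpret spin_graph R E D \<theta> 2 \<alpha>' \<beta>' t \<tau>
    proof unfold_locales
      show "\<tau> 0 = 1" using \<tau>_def[of 0] by simp
      show "\<tau> (Suc i) * (t i * 2) = - \<tau> i" if "i < D" for i
        using that D \<tau>_def[of 0] \<tau>_def[of 1] a_nz by (simp add: t_def power_int_minus_divide)
      show "(t i * 2) ^ 2 \<noteq> 1" if "i < D" for i using that D a2 by (simp add: t_def)
      fix x U r d s \<delta>
      assume irr: "irreducible_T_module R x U" and r: "r = endpoint R x U" and d: "d = module_diameter R x U"
        and s: "s = t r" and \<delta>: "\<delta> = (2 :: complex) ^ (2 * d)" and rd: "r + d \<le> D"
      show "module_b R E x U 0 = \<alpha>' * (coeff_b_first s 2 \<delta>)" if "1 \<le> d"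
      proof -
        have r0: "r = 0" and d1: "d = 1" using rd D that by auto
        have "module_b R E x U 0 = \<alpha> * (1 / q - q) * (a ^ 3 - 1) / (a * (a + 1))"
          using module_b_0[OF irr r d that] r0 d1 D by (simp add: power_int_minus_divide)
        also have "\<dots> = \<alpha>' * ((1 - 4) * (t 0 ^ 3 * 4 * 2 - 1) / (t 0 * 4 * (t 0 * 2 + 1)))"
        proof -
          have "t 0 * 4 * (t 0 * 2 + 1) = 2 * (a * (a + 1))" by (simp add: t_def)
          moreover have "t 0 ^ 3 * 4 * 2 = a ^ 3" by (simp add: t_def power_divide)
          moreover have "1 - 4 = (- 3 :: complex)" by simp
          ultimately show ?thesis unfolding \<alpha>' by (simp only: scale)
        qed
        finally show ?thesis by (simp add: s \<delta> r0 d1)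
      qed
      show "module_c R E x U d = \<alpha>' * (coeff_c_last s 2 \<delta>)" if "1 \<le> d"
      proof -
        have r0: "r = 0" and d1: "d = 1" using rd D that by auto
        have "module_c R E x U d = \<alpha> * (1 / q - q) * (a - 1) / (a + 1)"
          using module_c_d[OF irr r d that] r0 d1 D by (simp add: power_int_minus_divide)
        then show ?thesis unfolding c_1 by (simp add: s \<delta> r0 d1)
      qed
    qed (use dr D_def D_ge_1 idem self_dual theta' inj \<alpha>'_nz theta t_nz t_inj t_prod_ne thin endpoints D
        in \<open>auto simp: t_def\<close>)
    show ?thesis
    proof (rule spin_model_from_normalization[OF _ _ _ W'])
      fix \<delta> :: complex assume \<delta>: "\<delta> = 2 ^ (2 * D)"
      have "of_nat (graph_c R D) = \<alpha> * (1 / q - q) * (a - 1) / (a + 1)"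
        using c_D D by (simp add: power_int_minus_divide)
      then show "of_nat (graph_c R D) = \<alpha>' * (coeff_c_last (t 0) 2 \<delta>)"
        unfolding c_1 by (simp add: \<delta> D)
    next
      have "a powi (- 2) = 1 / (t 0 ^ 2 * 4)" by (simp add: t_def power_int_minus_divide power_divide)
      then show "f ^ 2 = complex_of_real (real CARD('x) powr (3 / 2))
          * (\<Prod>j<D. 1 - t 0 * 2 ^ (2 * j + 1)) / (\<Prod>j<D. 1 - 2 ^ (2 * j) / (t 0 ^ 2 * 2 ^ (2 * D)))"
        using f_sq D by (simp add: qpochhammer_def t_def)
    qed (use D in simp)
  qed
qed

end
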